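(* Let $K$ be a knot type, $\Lambda,\Delta,\tau>0$, and let $(\gamma,F)\in\mathcal Z^{\mathrm{ess}}_{\Lambda,\Delta,\tau}(K)$ with $F$ connected, $\partial F\ne\varnothing$, and non-meridional boundary slope of numerical value $r=p/q$ ($\gcd(p,q)=1$, $q\ge1$). Then $$\bigl|r-\operatorname{Wr}(\gamma)\bigr|\le\frac{\operatorname{Area}(F)}{2\pi\rho_0\,c_{\mathrm{col}}(\tau)\,q}\le\frac{\Delta}{2\pi\rho_0\,c_{\mathrm{col}}(\tau)}=:w(\Delta,\tau).$$ Consequently, for a fixed representative $\gamma$, all (non-meridional) numerical boundary slopes of connected essential surfaces $F\subset E(\gamma)$ with $\operatorname{Thi}(F)\ge\tau$ and $\operatorname{Area}(F)\le\Delta$ lie in $[\operatorname{Wr}(\gamma)-w,\operatorname{Wr}(\gamma)+w]$ with $w=w(\Delta,\tau)$, and any two such slopes $r=p/q$, $r'=p'/q'$ satisfy $$\Delta_T^{\mathrm{rate}}(r,r')=\Bigl|\frac pq-\frac{p'}{q'}\Bigr|\le2\,w(\Delta,\tau),$$ independently of $\Lambda$.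
   Context: Ambient conventions. Identify $S^3=\mathbb R^3\cup\{\infty\}$; all lengths, areas, distances and reaches are Euclidean. A representative of a knot type $K$ is a $C^{1,1}$ embedded closed curve $\gamma\subset\mathbb R^3$ of type $K$; $\operatorname{Len}(\gamma)$ is its length and $\operatorname{Thi}(\gamma)$ its thickness, the radius of the largest embedded normal tube (equivalently, the Federer reach of $\gamma$). Fix $\rho_0=\tfrac12$. For $\operatorname{Thi}(\gamma)\ge1$, $N_{\rho_0}(\gamma)$ is the closed normal tube of radius $\rho_0$ and $E(\gamma)=S^3\setminus\operatorname{int}N_{\rho_0}(\gamma)$ is the exterior. Compact surfaces in $E(\gamma)$ are taken disjoint from $\infty$. Relative thickness. Universal constants $0<c_0<1$ and $L_0\ge1$ are fixed once and for all. Let $F\subset E(\gamma)$ be a compact properly embedded $C^{1,1}$ surface (possibly disconnected, non-orientable, or with boundary), and let $T=\partial E(\gamma)$. $\operatorname{Thi}(F)\ge r$ means that the following hold: (i) the closed set $F\subset\mathbb R^3$ (with its boundary) has Federer reach at least $r$; (ii) for every $x\in F\setminus\partial F$, in rigid coordinates with $x=0$ and $T_xF$ horizontal, there is a $C^{1,1}$ function $u$ on the disk of radius $c_0r$ in $T_xF$ with $u(0)=0$, $Du(0)=0$, whose $C^1$-norm and Lipschitz norm of $Du$ are bounded by $L_0$ after scaling by $r^{-1}$, with $F\cap B(x,c_0r)\subseteq\operatorname{graph}(u)$ and $\operatorname{graph}(u|_{\text{disk of radius }c_0r/2})\subseteq F$; (iii) for every $x\in\partial F$ the same holds with half-disks,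 $\partial F$ corresponding to the boundary diameter; (iv) the inward conormal collar map $C_F:[0,c_0r]\times\partial F\to F$, $C_F(0,p)=p$, is an embedding; for $p,q$ on the same component of $\partial F$, with $d_{\partial F}$ arclength distance, $L_0^{-1}\min\{r,|s-t|+d_{\partial F}(p,q)\}\le|C_F(s,p)-C_F(t,q)|\le L_0(|s-t|+d_{\partial F}(p,q))$; for $p,q$ on different components $|C_F(s,p)-C_F(t,q)|\ge c_0r$; and after scaling by $r^{-1}$ the first derivative of $C_F$ is bounded by $L_0$ and $L_0$-Lipschitz; (v) $\operatorname{dist}(C_F(s,p),T)\ge c_0s$ for $0\le s\le c_0r$, and $\operatorname{dist}(F\setminus C_F([0,c_0r/2]\times\partial F),T)\ge\tfrac{c_0^2}{4}r$ (with $F$ itself in place of the complement if $F$ is closed). $\operatorname{Thi}(F)$ is the largest such $r$ ($0$ if there is none). For disconnected $F$ the clauses are imposed on the union and area means total area. Essential. A compact properly embedded surface or finite surface system in $E(\gamma)$ is essential if every component is incompressible, boundary-incompressible and not boundary-parallel; a $2$-sphere is essential only if it bounds no ball in $E(\gamma)$. $\mathcal Z^{\mathrm{ess}}_{\Lambda,\Delta,\tau}(K)$ is the set of pairs $(\gamma,F)$ with $\gamma$ a representative of $K$, $\operatorname{Thi}(\gamma)=1$, $\operatorname{Len}(\gamma)\le\Lambda$, $F\subset E(\gamma)$ essential, $\operatorname{Thi}(F)\ge\tau$, $\operatorname{Area}(F)\le\Delta$. Collar constant. For $\tau>0$, $c_{\mathrm{col}}(\tau)>0$ is a fixed constant, depending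 only on $\tau$ and the relative-thickness convention, such that every such surface $F$ with $\operatorname{Thi}(F)\ge\tau$ has an embedded boundary collar $\operatorname{Col}(\partial F)\subset F$ with $\operatorname{Area}(\operatorname{Col}(\partial F))\ge c_{\mathrm{col}}(\tau)\operatorname{Len}(\partial F)$. Slopes and writhe. Orient $\gamma$. On $\partial E(\gamma)=\partial N_{\rho_0}(\gamma)$ let $\mu$ be the meridian with $\operatorname{lk}(\mu,\gamma)=+1$ and $\lambda$ the preferred (Seifert) longitude, $\operatorname{lk}(\lambda,\gamma)=0$, parallel to $\gamma$. A slope is a primitive class $a\mu+b\lambda$ up to sign; all boundary components of a connected essential surface have a common slope. A non-meridional slope is written $p\mu+q\lambda$ with $\gcd(p,q)=1$, $q\ge1$, and has numerical value $p/q$. $\Delta_T(a\mu+b\lambda,a'\mu+b'\lambda)=|ab'-a'b|$ and $\Delta_T^{\mathrm{rate}}(p/q,p'/q')=|pq'-p'q|/(qq')$. $\operatorname{Wr}(\gamma)$ is the writhe, i.e. the Gauss double integral of $\gamma$, with signs such that $\operatorname{lk}(\gamma,\gamma_v)=\operatorname{Tw}(\gamma,v)+\operatorname{Wr}(\gamma)$ for a framing $v$, where $\operatorname{Tw}(\gamma,v)=\frac1{2\pi}\oint\langle v',\gamma'\times v\rangle\,ds$.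
   Formalization: In Thi(F), clause (ii) as written excludes every surface with boundary; here graph(u on the half-size disk) ⊆ F is required only if B(x,c_0r) misses ∂F, and in (iii) the half-disk's diameter may be a C^{1,1} curve with the same bounds. The collar constant is taken for this class. *)

theory Defs
  imports "HOL-Analysis.Analysis" "HOL-Homology.Homology"
begin

type_synonym E3 = "real^3"

section \<open>Length, area, reach\<close>

text \<open>
  Length and area are the normalised 1- and 2-dimensional Hausdorff measures, with values in
  \<open>[0,\<infinity>]\<close>.  Covering sets must be bounded because \<^const>\<open>diameter\<close> is a junk value otherwise.
\<close>

definition hausdorff_delta :: "nat \<Rightarrow> real \<Rightarrow> E3 set \<Rightarrow> ennreal" where
  "hausdorff_delta m \<delta> A =
     (INF C \<in> {C :: nat \<Rightarrow> E3 set. A \<subseteq> (\<Union>i. C i) \<and> (\<forall>i. bounded (C i) \<and> diameter (C i) \<le> \<delta>)}.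
        suminf (\<lambda>i. ennreal (unit_ball_vol (real m) * (diameter (C i) / 2) ^ m)))"

definition hausdorff :: "nat \<Rightarrow> E3 set \<Rightarrow> ennreal" where
  "hausdorff m A = (SUP \<delta> \<in> {0<..}. hausdorff_delta m \<delta> A)"

definition Len :: "E3 set \<Rightarrow> ennreal" where "Len A = hausdorff 1 A"

definition Area :: "E3 set \<Rightarrow> ennreal" where "Area A = hausdorff 2 A"

text \<open>Federer reach at least \<open>r\<close>: points at distance less than \<open>r\<close> have a unique nearest point.\<close>

definition reach_ge :: "E3 set \<Rightarrow> real \<Rightarrow> bool" where
  "reach_ge A r \<longleftrightarrow>
     (\<forall>x. A \<noteq> {} \<and> infdist x A < r \<longrightarrow> (\<exists>!a. a \<in> A \<and> dist x a = infdist x A))"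

section \<open>Closed curves, knots\<close>

text \<open>
  A closed curve is given by a 1-periodic regular parametrisation of the line; the curve as a subset
  of space is its range, and its restriction to \<open>[0,1]\<close> is a loop in the sense of the library.
  The parametrisation carries the orientation.
\<close>

abbreviation vel :: "(real \<Rightarrow> E3) \<Rightarrow> real \<Rightarrow> E3" where
  "vel \<gamma> t \<equiv> vector_derivative \<gamma> (at t)"

definition closed_curve :: "(real \<Rightarrow> E3) \<Rightarrow> bool" where
  "closed_curve \<gamma> \<longleftrightarrow>
     (\<forall>t. \<gamma> (t + 1) = \<gamma> t) \<and> inj_on \<gamma> {0..<1} \<and>
     \<gamma> C1_differentiable_on UNIV \<and> (\<forall>t. vel \<gamma> t \<noteq> 0)"

definition c11_knot :: "(real \<Rightarrow> E3) \<Rightarrow> bool" where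
  "c11_knot \<gamma> \<longleftrightarrow> closed_curve \<gamma> \<and> (\<exists>M. M-lipschitz_on UNIV (vel \<gamma>))"

text \<open>The 3-sphere as one-point compactification; \<^const>\<open>None\<close> is the point at infinity.\<close>

definition S3 :: "E3 option topology" where
  "S3 = Alexandroff_compactification euclidean"

definition ambient_isotopic :: "E3 set \<Rightarrow> E3 set \<Rightarrow> bool" where
  "ambient_isotopic A B \<longleftrightarrow>
     (\<exists>H. continuous_map (prod_topology (top_of_set {0..1::real}) S3) S3 H \<and>
          (\<forall>t\<in>{0..1}. homeomorphic_map S3 S3 (\<lambda>x. H (t, x))) \<and>
          (\<forall>x. H (0, x) = x) \<and>
          (\<lambda>x. H (1, x)) ` (Some ` A) = Some ` B)"

definition knot_type :: "E3 set set \<Rightarrow> bool" where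
  "knot_type K \<longleftrightarrow> (\<exists>\<gamma>. c11_knot \<gamma> \<and> K = {A. ambient_isotopic (range \<gamma>) A})"

definition representative :: "(real \<Rightarrow> E3) \<Rightarrow> E3 set set \<Rightarrow> bool" where
  "representative \<gamma> K \<longleftrightarrow> c11_knot \<gamma> \<and> range \<gamma> \<in> K"

text \<open>Thickness of a curve: the radius of the largest embedded normal tube.\<close>

definition embedded_tube :: "(real \<Rightarrow> E3) \<Rightarrow> real \<Rightarrow> bool" where
  "embedded_tube \<gamma> r \<longleftrightarrow>
     inj_on (\<lambda>(t, v). \<gamma> t + v) {(t, v). 0 \<le> t \<and> t < 1 \<and> v \<bullet> vel \<gamma> t = 0 \<and> norm v < r}"

definition thickness :: "(real \<Rightarrow> E3) \<Rightarrow> real" where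
  "thickness \<gamma> = Sup {r. 0 < r \<and> embedded_tube \<gamma> r}"

definition rho0 :: real where "rho0 = 1/2"

definition tube :: "(real \<Rightarrow> E3) \<Rightarrow> E3 set" where
  "tube \<gamma> = {\<gamma> t + v | t v. v \<bullet> vel \<gamma> t = 0 \<and> norm v \<le> rho0}"

definition exterior :: "(real \<Rightarrow> E3) \<Rightarrow> E3 option set" where
  "exterior \<gamma> = UNIV - Some ` interior (tube \<gamma>)"

definition torus :: "(real \<Rightarrow> E3) \<Rightarrow> E3 set" where
  "torus \<gamma> = frontier (tube \<gamma>)"

section \<open>Linking number, writhe, slopes\<close>

text \<open>
  The sign is the one for which a right-handed meridian has linking number \<open>+1\<close>, equivalently
  for which \<open>lk(\<gamma>, \<gamma>\<^sub>v) = Tw(\<gamma>, v) + Wr(\<gamma>)\<close> with \<open>Tw = (1/2\<pi>) \<integral> \<langle>v', \<gamma>' \<times> v\<rangle> ds\<close>.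
  On the diagonal of the writhe integral the integrand is \<open>0\<close>.
\<close>

definition gauss_integral :: "(real \<Rightarrow> E3) \<Rightarrow> (real \<Rightarrow> E3) \<Rightarrow> real" where
  "gauss_integral \<alpha> \<beta> =
     1 / (4 * pi) * integral ({0..1} \<times> {0..1})
       (\<lambda>(s, t). ((\<alpha> s - \<beta> t) \<bullet> cross3 (vel \<alpha> s) (vel \<beta> t)) / norm (\<alpha> s - \<beta> t) ^ 3)"

definition lk :: "(real \<Rightarrow> E3) \<Rightarrow> (real \<Rightarrow> E3) \<Rightarrow> real" where
  "lk \<alpha> \<beta> = gauss_integral \<alpha> \<beta>"

definition Wr :: "(real \<Rightarrow> E3) \<Rightarrow> real" where
  "Wr \<gamma> = gauss_integral \<gamma> \<gamma>"

definition is_meridian :: "(real \<Rightarrow> E3) \<Rightarrow> (real \<Rightarrow> E3) \<Rightarrow> bool" where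
  "is_meridian \<gamma> \<mu> \<longleftrightarrow>
     closed_curve \<mu> \<and> range \<mu> \<subseteq> torus \<gamma> \<and>
     (\<exists>a. homotopic_loops (tube \<gamma>) \<mu> (\<lambda>_. a)) \<and> lk \<mu> \<gamma> = 1"

definition is_longitude :: "(real \<Rightarrow> E3) \<Rightarrow> (real \<Rightarrow> E3) \<Rightarrow> bool" where
  "is_longitude \<gamma> l \<longleftrightarrow>
     closed_curve l \<and> range l \<subseteq> torus \<gamma> \<and>
     homotopic_loops (tube \<gamma>) l \<gamma> \<and> lk l \<gamma> = 0"

text \<open>
  The singular 1-chain of a loop: the coordinate \<open>x 1\<close> identifies the standard 1-simplex with \<open>[0,1]\<close>.
\<close>

definition loop_chain :: "(real \<Rightarrow> E3) \<Rightarrow> E3 chain" where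
  "loop_chain \<beta> = frag_of (restrict (\<lambda>x. \<beta> (x 1)) (standard_simplex 1))"

text \<open>\<open>[\<beta>] = a[\<mu>] + b[\<lambda>]\<close> in \<open>H\<^sub>1(\<partial>E(\<gamma>))\<close>\<close>

definition torus_class :: "(real \<Rightarrow> E3) \<Rightarrow> (real \<Rightarrow> E3) \<Rightarrow> int \<Rightarrow> int \<Rightarrow> bool" where
  "torus_class \<gamma> \<beta> a b \<longleftrightarrow>
     (\<exists>\<mu> l. is_meridian \<gamma> \<mu> \<and> is_longitude \<gamma> l \<and>
        homologous_rel 1 (top_of_set (torus \<gamma>)) {} (loop_chain \<beta>)
          (frag_cmul a (loop_chain \<mu>) + frag_cmul b (loop_chain l)))"

section \<open>Surfaces\<close>

definition halfplane :: "(real^2) set" where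
  "halfplane = {z. 0 \<le> z $ 2}"

definition c11_on ::
  "'a::real_normed_vector set \<Rightarrow> ('a \<Rightarrow> 'b::real_normed_vector) \<Rightarrow> ('a \<Rightarrow> 'a \<Rightarrow> 'b) \<Rightarrow> bool" where
  "c11_on U f f' \<longleftrightarrow>
     (\<forall>z\<in>U. (f has_derivative f' z) (at z)) \<and>
     (\<exists>M. \<forall>z\<in>U. \<forall>w\<in>U. onorm (\<lambda>v. f' z v - f' w v) \<le> M * dist z w)"

text \<open>
  A \<open>C\<^sup>1\<^sup>,\<^sup>1\<close> immersive chart at \<open>x\<close>, \<open>\<phi> 0 = x\<close>, whose restriction to the model
  \<open>H\<close> (plane or half-plane) parametrises a neighbourhood of \<open>x\<close> in \<open>F\<close>.
\<close>

definition surface_chart ::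
  "E3 set \<Rightarrow> (real^2) set \<Rightarrow> E3 \<Rightarrow> (real^2 \<Rightarrow> E3) \<Rightarrow> (real^2 \<Rightarrow> real^2 \<Rightarrow> E3) \<Rightarrow> bool" where
  "surface_chart F H x \<phi> \<phi>' \<longleftrightarrow>
     (\<exists>U V. open U \<and> 0 \<in> U \<and> open V \<and> x \<in> V \<and> \<phi> 0 = x \<and>
        c11_on U \<phi> \<phi>' \<and> (\<forall>z\<in>U. inj (\<phi>' z)) \<and>
        (\<exists>\<psi>. homeomorphism (U \<inter> H) (F \<inter> V) \<phi> \<psi>))"

definition bd :: "E3 set \<Rightarrow> E3 set" where
  "bd F = {x. \<exists>\<phi> \<phi>'. surface_chart F halfplane x \<phi> \<phi>'}"

definition c11_surface :: "E3 set \<Rightarrow> bool" where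
  "c11_surface F \<longleftrightarrow>
     (\<forall>x\<in>F. \<exists>H\<in>{UNIV, halfplane}. \<exists>\<phi> \<phi>'. surface_chart F H x \<phi> \<phi>')"

definition tangent_plane :: "E3 set \<Rightarrow> E3 \<Rightarrow> E3 set" where
  "tangent_plane F x =
     {v. \<exists>H\<in>{UNIV, halfplane}. \<exists>\<phi> \<phi>'. surface_chart F H x \<phi> \<phi>' \<and> v \<in> range (\<phi>' 0)}"

text \<open>In a boundary chart, vectors with vanishing second coordinate are mapped to vectors tangent
  to the boundary, and a positive second coordinate points into the surface.\<close>

definition inward_conormal :: "E3 set \<Rightarrow> E3 \<Rightarrow> E3 \<Rightarrow> bool" where
  "inward_conormal F x \<nu> \<longleftrightarrow>
     (\<exists>\<phi> \<phi>' v. surface_chart F halfplane x \<phi> \<phi>' \<and> \<nu> = \<phi>' 0 v \<and> 0 < v $ 2 \<and> norm \<nu> = 1 \<and>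
        (\<forall>w. w $ 2 = 0 \<longrightarrow> \<nu> \<bullet> \<phi>' 0 w = 0))"

definition properly_embedded_surface :: "(real \<Rightarrow> E3) \<Rightarrow> E3 set \<Rightarrow> bool" where
  "properly_embedded_surface \<gamma> F \<longleftrightarrow>
     compact F \<and> c11_surface F \<and> Some ` F \<subseteq> exterior \<gamma> \<and> bd F = F \<inter> torus \<gamma>"

section \<open>Relative thickness of a surface\<close>

definition orthonormal_frame :: "E3 \<Rightarrow> E3 \<Rightarrow> E3 \<Rightarrow> bool" where
  "orthonormal_frame e1 e2 n \<longleftrightarrow>
     norm e1 = 1 \<and> norm e2 = 1 \<and> norm n = 1 \<and> e1 \<bullet> e2 = 0 \<and> e1 \<bullet> n = 0 \<and> e2 \<bullet> n = 0"

definition graph_over ::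
  "E3 \<Rightarrow> E3 \<Rightarrow> E3 \<Rightarrow> E3 \<Rightarrow> (real^2 \<Rightarrow> real) \<Rightarrow> (real^2) set \<Rightarrow> E3 set" where
  "graph_over x e1 e2 n u D = (\<lambda>z. x + (z $ 1) *\<^sub>R e1 + (z $ 2) *\<^sub>R e2 + u z *\<^sub>R n) ` D"

text \<open>
  Bounds by \<open>L\<close> on the \<open>C\<^sup>1\<close>-norm (sup of the function plus sup of its derivative) and on the
  Lipschitz constant of the derivative of the rescaled function \<open>z \<mapsto> u (r z) / r\<close>.
\<close>

definition scaled_c11_bound ::
  "real \<Rightarrow> real \<Rightarrow> 'a::real_normed_vector set \<Rightarrow> ('a \<Rightarrow> real) \<Rightarrow> ('a \<Rightarrow> 'a \<Rightarrow> real) \<Rightarrow> bool" where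
  "scaled_c11_bound L r D u u' \<longleftrightarrow>
     (\<forall>z\<in>D. (u has_derivative u' z) (at z within D)) \<and>
     (\<forall>z\<in>D. \<forall>w\<in>D. \<bar>u z\<bar> / r + onorm (u' w) \<le> L) \<and>
     (\<forall>z\<in>D. \<forall>w\<in>D. onorm (\<lambda>v. u' z v - u' w v) \<le> L / r * dist z w)"

text \<open>
  Interior graph charts.  All of \<open>F\<close> near \<open>x\<close> lies on the graph.  The reverse inclusion (the half-size
  disk of the graph lies in \<open>F\<close>) is demanded only where the ball of the chart does not meet the
  boundary of \<open>F\<close>: an interior point close to the boundary never has a whole disk of a fixed size
  around it inside \<open>F\<close>, so that without this proviso no surface with boundary would satisfy the
  clause.  For closed \<open>F\<close> the proviso is void.
\<close>

definition interior_graph_charts :: "real \<Rightarrow> real \<Rightarrow> E3 set \<Rightarrow> real \<Rightarrow> bool" where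
  "interior_graph_charts c0 L0 F r \<longleftrightarrow>
     (\<forall>x \<in> F - bd F. \<exists>e1 e2 n u u'.
        orthonormal_frame e1 e2 n \<and> tangent_plane F x = span {e1, e2} \<and>
        u 0 = 0 \<and> u' 0 = (\<lambda>_. 0) \<and> scaled_c11_bound L0 r (ball 0 (c0 * r)) u u' \<and>
        F \<inter> ball x (c0 * r) \<subseteq> graph_over x e1 e2 n u (ball 0 (c0 * r)) \<and>
        (ball x (c0 * r) \<inter> bd F = {} \<longrightarrow>
           graph_over x e1 e2 n u (ball 0 (c0 * r / 2)) \<subseteq> F))"

text \<open>
  Boundary graph charts.  The half-disk is the part \<open>h(z\<^sub>1) \<le> z\<^sub>2\<close> of the disk, its diameter being the
  graph of a \<open>C\<^sup>1\<^sup>,\<^sup>1\<close> function \<open>h\<close> with the same bounds, tangent to the first axis at the origin.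
  A straight diameter (\<open>h = 0\<close>) would force the boundary of \<open>F\<close> to project to straight segments and
  would exclude even a flat round disk.
\<close>

definition half_disk :: "(real \<Rightarrow> real) \<Rightarrow> real \<Rightarrow> (real^2) set" where
  "half_disk h R = {z \<in> ball 0 R. h (z $ 1) \<le> z $ 2}"

definition half_disk_diameter :: "(real \<Rightarrow> real) \<Rightarrow> real \<Rightarrow> (real^2) set" where
  "half_disk_diameter h R = {z \<in> ball 0 R. h (z $ 1) = z $ 2}"

definition boundary_graph_charts :: "real \<Rightarrow> real \<Rightarrow> E3 set \<Rightarrow> real \<Rightarrow> bool" where
  "boundary_graph_charts c0 L0 F r \<longleftrightarrow>
     (\<forall>x \<in> bd F. \<exists>e1 e2 n u u' h h'.
        orthonormal_frame e1 e2 n \<and> tangent_plane F x = span {e1, e2} \<and>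
        h 0 = 0 \<and> h' 0 = (\<lambda>_. 0) \<and> scaled_c11_bound L0 r {- (c0 * r)<..<c0 * r} h h' \<and>
        u 0 = 0 \<and> u' 0 = (\<lambda>_. 0) \<and> scaled_c11_bound L0 r (half_disk h (c0 * r)) u u' \<and>
        F \<inter> ball x (c0 * r) \<subseteq> graph_over x e1 e2 n u (half_disk h (c0 * r)) \<and>
        graph_over x e1 e2 n u (half_disk h (c0 * r / 2)) \<subseteq> F \<and>
        bd F \<inter> ball x (c0 * r) \<subseteq> graph_over x e1 e2 n u (half_disk_diameter h (c0 * r)) \<and>
        graph_over x e1 e2 n u (half_disk_diameter h (c0 * r / 2)) \<subseteq> bd F)"

text \<open>
  An arclength parametrisation of a closed curve by the whole line (hence automatically periodic), and
  the induced arclength distance.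
\<close>

definition arclength_param :: "E3 set \<Rightarrow> (real \<Rightarrow> E3) \<Rightarrow> bool" where
  "arclength_param B b \<longleftrightarrow>
     b C1_differentiable_on UNIV \<and> (\<forall>t. norm (vel b t) = 1) \<and> range b = B"

definition arc_dist :: "E3 set \<Rightarrow> E3 \<Rightarrow> E3 \<Rightarrow> real" where
  "arc_dist B p q = Inf {\<bar>t - t'\<bar> | t t'. \<exists>b. arclength_param B b \<and> b t = p \<and> b t' = q}"

text \<open>
  The collar map \<open>C\<close> is an embedded collar leaving the boundary in the direction of the inward unit
  conormal.  Its derivative is taken in the coordinates \<open>(s, t)\<close>, \<open>t\<close> being arclength
  along a boundary component.
\<close>

definition conormal_collar :: "real \<Rightarrow> real \<Rightarrow> E3 set \<Rightarrow> real \<Rightarrow> (real \<times> E3 \<Rightarrow> E3) \<Rightarrow> bool" where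
  "conormal_collar c0 L0 F r C \<longleftrightarrow>
     embedding_map (top_of_set ({0..c0 * r} \<times> bd F)) (top_of_set F) C \<and>
     (\<forall>p\<in>bd F. C (0, p) = p \<and>
        (\<exists>\<nu>. inward_conormal F p \<nu> \<and>
             ((\<lambda>s. C (s, p)) has_vector_derivative \<nu>) (at 0 within {0..c0 * r}))) \<and>
     (\<forall>B\<in>components (bd F). \<forall>p\<in>B. \<forall>q\<in>B. \<forall>s\<in>{0..c0 * r}. \<forall>t\<in>{0..c0 * r}.
        min r (\<bar>s - t\<bar> + arc_dist B p q) / L0 \<le> dist (C (s, p)) (C (t, q)) \<and>
        dist (C (s, p)) (C (t, q)) \<le> L0 * (\<bar>s - t\<bar> + arc_dist B p q)) \<and>
     (\<forall>B\<in>components (bd F). \<forall>B'\<in>components (bd F). B \<noteq> B' \<longrightarrow>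
        (\<forall>p\<in>B. \<forall>q\<in>B'. \<forall>s\<in>{0..c0 * r}. \<forall>t\<in>{0..c0 * r}.
           c0 * r \<le> dist (C (s, p)) (C (t, q)))) \<and>
     (\<forall>B\<in>components (bd F). \<forall>b. arclength_param B b \<longrightarrow>
        (\<exists>G'. (\<forall>z \<in> {0..c0 * r} \<times> UNIV.
                  ((\<lambda>(s, t). C (s, b t)) has_derivative G' z) (at z within {0..c0 * r} \<times> UNIV) \<and>
                  onorm (G' z) \<le> L0) \<and>
              (\<forall>z \<in> {0..c0 * r} \<times> UNIV. \<forall>w \<in> {0..c0 * r} \<times> UNIV.
                  onorm (\<lambda>v. G' z v - G' w v) \<le> L0 / r * dist z w)))"

definition collar_separation :: "real \<Rightarrow> E3 set \<Rightarrow> E3 set \<Rightarrow> real \<Rightarrow> (real \<times> E3 \<Rightarrow> E3) \<Rightarrow> bool" where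
  "collar_separation c0 T F r C \<longleftrightarrow>
     (\<forall>p\<in>bd F. \<forall>s\<in>{0..c0 * r}. c0 * s \<le> infdist (C (s, p)) T) \<and>
     (\<forall>x \<in> F - C ` ({0..c0 * r / 2} \<times> bd F). c0\<^sup>2 / 4 * r \<le> infdist x T)"

definition surface_thickness_ge ::
  "real \<Rightarrow> real \<Rightarrow> (real \<Rightarrow> E3) \<Rightarrow> E3 set \<Rightarrow> real \<Rightarrow> bool" where
  "surface_thickness_ge c0 L0 \<gamma> F r \<longleftrightarrow>
     0 < r \<and> reach_ge F r \<and>
     interior_graph_charts c0 L0 F r \<and> boundary_graph_charts c0 L0 F r \<and>
     (\<exists>C. conormal_collar c0 L0 F r C \<and> collar_separation c0 (torus \<gamma>) F r C)"

section \<open>Essential surfaces\<close>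

text \<open>
  Disks and balls live in the exterior inside the 3-sphere and may pass through infinity.
\<close>

abbreviation disk :: "(real^2) set" where "disk \<equiv> cball 0 1"
abbreviation circle :: "(real^2) set" where "circle \<equiv> sphere 0 1"
abbreviation upper_arc :: "(real^2) set" where "upper_arc \<equiv> {z \<in> circle. 0 \<le> z $ 2}"
abbreviation lower_arc :: "(real^2) set" where "lower_arc \<equiv> {z \<in> circle. z $ 2 \<le> 0}"

definition incompressible :: "(real \<Rightarrow> E3) \<Rightarrow> E3 set \<Rightarrow> bool" where
  "incompressible \<gamma> F \<longleftrightarrow>
     (\<forall>f. embedding_map (top_of_set disk) S3 f \<and> f ` disk \<subseteq> exterior \<gamma> \<and>
          f ` disk \<inter> Some ` F = f ` circle \<longrightarrow>
        (\<exists>g. embedding_map (top_of_set disk) S3 g \<and> g ` disk \<subseteq> Some ` F \<and>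
             g ` circle = f ` circle))"

definition boundary_incompressible :: "(real \<Rightarrow> E3) \<Rightarrow> E3 set \<Rightarrow> bool" where
  "boundary_incompressible \<gamma> F \<longleftrightarrow>
     (\<forall>f. embedding_map (top_of_set disk) S3 f \<and> f ` disk \<subseteq> exterior \<gamma> \<and>
          f ` disk \<inter> Some ` F = f ` upper_arc \<and>
          f ` disk \<inter> Some ` torus \<gamma> = f ` lower_arc \<longrightarrow>
        (\<exists>g. embedding_map (top_of_set disk) S3 g \<and> g ` disk \<subseteq> Some ` F \<and>
             f ` upper_arc \<subseteq> g ` circle \<and> g ` circle - f ` upper_arc \<subseteq> Some ` bd F))"

text \<open>Boundary-parallel: \<open>F\<close> cuts off an embedded product region \<open>F \<times> [0,1]\<close>, with \<open>F \<times> {0} = F\<close> and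
  the rest of its boundary on \<open>\<partial>E(\<gamma>)\<close>.\<close>

definition boundary_parallel :: "(real \<Rightarrow> E3) \<Rightarrow> E3 set \<Rightarrow> bool" where
  "boundary_parallel \<gamma> F \<longleftrightarrow>
     (\<exists>h. embedding_map (top_of_set (F \<times> {0..1::real})) S3 h \<and>
          h ` (F \<times> {0..1}) \<subseteq> exterior \<gamma> \<and>
          (\<forall>x\<in>F. h (x, 0) = Some x) \<and>
          h ` (F \<times> {1} \<union> bd F \<times> {0..1}) \<subseteq> Some ` torus \<gamma>)"

definition bounds_ball :: "(real \<Rightarrow> E3) \<Rightarrow> E3 set \<Rightarrow> bool" where
  "bounds_ball \<gamma> F \<longleftrightarrow>
     (\<exists>f. embedding_map (top_of_set (cball (0::E3) 1)) S3 f \<and>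
          f ` cball 0 1 \<subseteq> exterior \<gamma> \<and> f ` sphere 0 1 = Some ` F)"

definition essential :: "(real \<Rightarrow> E3) \<Rightarrow> E3 set \<Rightarrow> bool" where
  "essential \<gamma> F \<longleftrightarrow>
     properly_embedded_surface \<gamma> F \<and>
     (\<forall>C\<in>components F.
        incompressible \<gamma> C \<and> boundary_incompressible \<gamma> C \<and> \<not> boundary_parallel \<gamma> C \<and>
        (C homeomorphic sphere (0::E3) 1 \<longrightarrow> \<not> bounds_ball \<gamma> C))"

definition Z_ess ::
  "real \<Rightarrow> real \<Rightarrow> E3 set set \<Rightarrow> real \<Rightarrow> real \<Rightarrow> real \<Rightarrow> ((real \<Rightarrow> E3) \<times> E3 set) set" where
  "Z_ess c0 L0 K \<Lambda> \<Delta> \<tau> =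
     {(\<gamma>, F). representative \<gamma> K \<and> thickness \<gamma> = 1 \<and> Len (range \<gamma>) \<le> ennreal \<Lambda> \<and>
        essential \<gamma> F \<and> surface_thickness_ge c0 L0 \<gamma> F \<tau> \<and> Area F \<le> ennreal \<Delta>}"

section \<open>Boundary slopes\<close>

text \<open>
  Every boundary component has slope \<open>a\<mu> + b\<lambda>\<close>; the sign ambiguity of slopes is absorbed in the
  choice of the orientation of the parametrisation \<open>\<beta>\<close>.
\<close>

definition boundary_slope :: "(real \<Rightarrow> E3) \<Rightarrow> E3 set \<Rightarrow> int \<Rightarrow> int \<Rightarrow> bool" where
  "boundary_slope \<gamma> F a b \<longleftrightarrow>
     bd F \<noteq> {} \<and> coprime a b \<and>
     (\<forall>B\<in>components (bd F). \<exists>\<beta>. closed_curve \<beta> \<and> range \<beta> = B \<and> torus_class \<gamma> \<beta> a b)"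

definition numerical_boundary_slope :: "(real \<Rightarrow> E3) \<Rightarrow> E3 set \<Rightarrow> int \<Rightarrow> int \<Rightarrow> bool" where
  "numerical_boundary_slope \<gamma> F p q \<longleftrightarrow> 1 \<le> q \<and> boundary_slope \<gamma> F p q"

definition slope_rate :: "int \<Rightarrow> int \<Rightarrow> int \<Rightarrow> int \<Rightarrow> real" where
  "slope_rate p q p' q' = real_of_int \<bar>p * q' - p' * q\<bar> / real_of_int (q * q')"

section \<open>Collar constant\<close>

definition boundary_collar :: "E3 set \<Rightarrow> E3 set \<Rightarrow> bool" where
  "boundary_collar F A \<longleftrightarrow>
     (\<exists>h. embedding_map (top_of_set ({0..1::real} \<times> bd F)) (top_of_set F) h \<and>
          (\<forall>p\<in>bd F. h (0, p) = p) \<and> A = h ` ({0..1} \<times> bd F))"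

definition collar_constant :: "real \<Rightarrow> real \<Rightarrow> real \<Rightarrow> real \<Rightarrow> bool" where
  "collar_constant c0 L0 \<tau> c \<longleftrightarrow>
     0 < c \<and>
     (\<forall>\<gamma> F. c11_knot \<gamma> \<and> 1 \<le> thickness \<gamma> \<and> essential \<gamma> F \<and> surface_thickness_ge c0 L0 \<gamma> F \<tau> \<longrightarrow>
        (\<exists>A. boundary_collar F A \<and> ennreal c * Len (bd F) \<le> Area A))"

definition slope_width :: "(real \<Rightarrow> real) \<Rightarrow> real \<Rightarrow> real \<Rightarrow> real" where
  "slope_width c_col \<Delta> \<tau> = \<Delta> / (2 * pi * rho0 * c_col \<tau>)"

text \<open>The pair \<open>(p, q)\<close> represents a numerical boundary slope of some connected essential surface of
  relative thickness at least \<open>\<tau>\<close> and area at most \<open>\<Delta>\<close> in the exterior of \<open>\<gamma>\<close>.\<close>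

definition realized_slope ::
  "real \<Rightarrow> real \<Rightarrow> (real \<Rightarrow> E3) \<Rightarrow> real \<Rightarrow> real \<Rightarrow> int \<Rightarrow> int \<Rightarrow> bool" where
  "realized_slope c0 L0 \<gamma> \<Delta> \<tau> p q \<longleftrightarrow>
     (\<exists>F. connected F \<and> essential \<gamma> F \<and> surface_thickness_ge c0 L0 \<gamma> F \<tau> \<and>
          Area F \<le> ennreal \<Delta> \<and> numerical_boundary_slope \<gamma> F p q)"

end

theory Submission
  imports Defs
begin

text \<open>
  Let a boundary component \<open>\<beta>\<close> of \<open>F\<close> have class \<open>p\<mu> + q\<lambda>\<close>.  The Biot--Savart field of \<open>\<gamma>\<close> is closed
  off \<open>\<gamma>\<close>, so integrating it over \<open>\<beta>\<close> gives \<open>4\<pi>p\<close>, and \<open>\<beta> = \<gamma> \<circ> \<theta> + v/2\<close> with \<open>v\<close> a unit normal and \<open>\<theta>\<close> advancing by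
  \<open>q\<close> periods.  Letting \<open>\<epsilon> \<rightarrow> 0\<close> in the Gauss integral of the push-off \<open>\<gamma> \<circ> \<theta> + \<epsilon>v\<close> gives \<open>q Wr(\<gamma>)\<close> plus the
  twist of \<open>v\<close>, which is at most \<open>Len(\<beta>) / (2\<pi>\<rho>\<^sub>0)\<close>; the collar constant bounds the length of \<open>\<beta>\<close>
  by the area of \<open>F\<close>.

  Since \<open>\<gamma>\<close> is only \<open>C\<^sup>1\<^sup>,\<^sup>1\<close>, one term of the Gauss integral need not converge pointwise.  It is odd
  in \<open>\<epsilon>\<close> to leading order, and the push-offs by \<open>\<epsilon>v\<close> and \<open>-\<epsilon>v\<close> are isotopic off \<open>\<gamma>\<close>, so it is removed
  by averaging the two.  The merely Lipschitz \<open>\<theta>\<close> and \<open>v\<close> are replaced by their Steklov averages.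
\<close>

section \<open>Length of a closed curve and Hausdorff measure\<close>

text \<open>The constant has a short origin. Formally differentiating \<beta> = \<gamma> o \<theta>
  + v/2 shows that the component of \<beta>' orthogonal to \<gamma>' is that of v'/2. So the twist
  density of v, which is 1/(2 pi) times a triple product of v, v' and the unit tangent, is at most
  |\<beta>'| / pi = |\<beta>'| / (2 pi \<rho>), \<rho> = 1/2 being the tube radius. Hence pi |p - q
  Wr| is at most the length of \<beta>, and division by q gives the factor 1/q.

  The obstacle is regularity: the projection of the tube to a C^{1,1} curve is only Lipschitz, so
  \<theta> and v need not be differentiable, and an average of v over a window of length h is
  neither exactly unit nor exactly normal. The kernel estimates therefore carry a defect \<delta> in
  both conditions. It enters linearly and is of order h, while \<epsilon> stays below h^3, so that
  all terms but the twist are O(h).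

  Homology is used only by pairing cycles with two-point functions that are additive near the
  diagonal: the circulation of the field, which detects p, and the change of the foot parameter,
  which detects q.\<close>

lemma hausdorff_mono: "A \<subseteq> B \<Longrightarrow> hausdorff m A \<le> hausdorff m B"
  unfolding hausdorff_def hausdorff_delta_def
  by (intro SUP_mono bexI INF_superset_mono) auto

text \<open>The interval from Inf to Sup is a measurable hull of a set that need not be measurable
  itself, such as the image of an arbitrary covering set.\<close>

lemma bounded_diff_imp_Icc_cover:
  fixes D :: "real set"
  assumes "0 \<le> K" and pair: "\<And>a b. a \<in> D \<Longrightarrow> b \<in> D \<Longrightarrow> a \<le> b + K"
  obtains I where "D \<subseteq> I" "I \<in> sets lborel" "emeasure lborel I \<le> ennreal K"
proof (cases "D = {}")
  case True
  then show ?thesis using that[of "{}"] by simp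
next
  case False
  then obtain a where a: "a \<in> D" by blast
  have bdd: "bdd_above D" "bdd_below D"
    using pair[OF _ a] pair[OF a] by (auto intro!: bdd_aboveI[of _ "a + K"] bdd_belowI[of _ "a - K"] simp: diff_le_eq)
  have "Sup D \<le> Inf D + K"
  proof (rule cSup_least[OF False])
    fix a assume a: "a \<in> D"
    have "a - K \<le> Inf D"
      by (rule cInf_greatest[OF False]) (use pair[OF a] in fastforce)
    then show "a \<le> Inf D + K" by simp
  qed
  moreover have "Inf D \<le> Sup D" using False bdd cInf_le_cSup by blast
  ultimately have "emeasure lborel {Inf D..Sup D} \<le> ennreal K"
    by (simp add: ennreal_leI)
  moreover have "D \<subseteq> {Inf D..Sup D}" using bdd by (auto intro: cInf_lower cSup_upper)
  ultimately show ?thesis using that[of "{Inf D..Sup D}"] by simp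
qed

text \<open>\<open>g\<close> does not enlarge small sets, so the images of a covering lie in
  intervals of total length at most the sum of the diameters, and together these contain an interval
  of length l. Only pairs at distance at most \<delta> matter, since Hausdorff measure is a supremum
  over scales.\<close>

lemma ennreal_le_hausdorff_1:
  fixes S :: "E3 set" and g :: "E3 \<Rightarrow> real"
  assumes "0 < \<delta>" "0 \<le> l" "{0..l} \<subseteq> g ` S"
    and lip: "\<And>x y. x \<in> S \<Longrightarrow> y \<in> S \<Longrightarrow> dist x y \<le> \<delta> \<Longrightarrow> \<bar>g x - g y\<bar> \<le> dist x y"
  shows "ennreal l \<le> hausdorff 1 S"
proof -
  have "ennreal l \<le> suminf (\<lambda>i. ennreal (unit_ball_vol (real 1) * (diameter (C i) / 2) ^ 1))"
    if C: "S \<subseteq> (\<Union>i. C i)" "\<forall>i. bounded (C i) \<and> diameter (C i) \<le> \<delta>" for C :: "nat \<Rightarrow> E3 set"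
  proof -
    define D where "D i = g ` (C i \<inter> S)" for i
    have pair: "a \<le> b + diameter (C i)" if "a \<in> D i" "b \<in> D i" for a b i
    proof -
      obtain x y where xy: "x \<in> C i" "x \<in> S" "y \<in> C i" "y \<in> S" "a = g x" "b = g y"
        using \<open>a \<in> D i\<close> \<open>b \<in> D i\<close> by (auto simp: D_def)
      have d: "dist x y \<le> diameter (C i)"
        using C(2) xy diameter_bounded_bound by blast
      then have "dist x y \<le> \<delta>" using C(2) order_trans by blast
      from lip[OF xy(2,4) this] d show ?thesis using xy by auto
    qed
    have "\<exists>I. D i \<subseteq> I \<and> I \<in> sets lborel \<and> emeasure lborel I \<le> ennreal (diameter (C i))" for i
      using bounded_diff_imp_Icc_cover[of "diameter (C i)" "D i"] pair diameter_ge_0 C(2) by metis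
    then obtain I where I: "\<And>i. D i \<subseteq> I i" "\<And>i. I i \<in> sets lborel"
      "\<And>i. emeasure lborel (I i) \<le> ennreal (diameter (C i))" by metis
    have "ennreal l = emeasure lborel {0..l}" using \<open>0 \<le> l\<close> by simp
    also have "\<dots> \<le> emeasure lborel (\<Union>i. I i)"
    proof (rule emeasure_mono)
      show "{0..l} \<subseteq> (\<Union>i. I i)"
      proof
        fix a assume "a \<in> {0..l}"
        then obtain x where "x \<in> S" "a = g x" using assms(3) by blast
        then obtain i where "x \<in> C i" using C(1) by blast
        then show "a \<in> (\<Union>i. I i)" using I(1)[of i] \<open>x \<in> S\<close> \<open>a = g x\<close> by (auto simp: D_def)
      qed
      show "(\<Union>i. I i) \<in> sets lborel" using I by blast
    qed
    also have "\<dots> \<le> suminf (\<lambda>i. emeasure lborel (I i))"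
      by (rule emeasure_subadditive_countably) (use I in auto)
    also have "\<dots> \<le> suminf (\<lambda>i. ennreal (diameter (C i)))"
      using I by (intro suminf_le summableI)
    finally show ?thesis by (simp add: unit_ball_vol_1)
  qed
  then have "ennreal l \<le> hausdorff_delta 1 \<delta> S"
    unfolding hausdorff_delta_def by (auto intro!: INF_greatest)
  also have "\<dots> \<le> hausdorff 1 S"
    unfolding hausdorff_def using \<open>0 < \<delta>\<close> by (intro SUP_upper) auto
  finally show ?thesis .
qed

lemma closed_curve_has_vector_derivative:
  assumes "closed_curve \<gamma>" shows "(\<gamma> has_vector_derivative vel \<gamma> t) (at t within S)"
  using assms unfolding closed_curve_def C1_differentiable_on_eq
  by (auto simp: vector_derivative_works intro: has_vector_derivative_at_within)

lemma closed_curve_continuous_vel: "closed_curve \<gamma> \<Longrightarrow> continuous_on S (vel \<gamma>)"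
  unfolding closed_curve_def C1_differentiable_on_eq
  using continuous_on_subset by blast

lemma closed_curve_continuous: "closed_curve \<gamma> \<Longrightarrow> continuous_on S \<gamma>"
  using closed_curve_has_vector_derivative[of \<gamma> _ S] has_vector_derivative_continuous
  unfolding continuous_on_eq_continuous_within by blast

text \<open>By uniform continuity the velocity is nearly constant on short intervals; its positive
  minimum m turns the additive error into a factor 1 + e.\<close>

lemma arclength_le_chord:
  assumes \<beta>: "closed_curve \<beta>" and "0 < e"
  obtains d where "0 < d" "\<And>s s'. s \<in> {0..1} \<Longrightarrow> s' \<in> {0..1} \<Longrightarrow> s \<le> s' \<Longrightarrow> s' - s < d \<Longrightarrow>
     integral {s..s'} (\<lambda>t. norm (vel \<beta> t)) \<le> (1 + e) * norm (\<beta> s' - \<beta> s)"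
proof -
  define v where "v = vel \<beta>"
  have cv: "continuous_on S v" for S
    using closed_curve_continuous_vel[OF \<beta>] by (simp add: v_def)
  have der: "(\<beta> has_vector_derivative v t) (at t within S)" for t S
    using closed_curve_has_vector_derivative[OF \<beta>] by (simp add: v_def)
  obtain m where m: "0 < m" "\<And>t. t \<in> {0..1} \<Longrightarrow> m \<le> norm (v t)"
  proof -
    have "continuous_on {0..1} (\<lambda>t. norm (v t))" by (intro continuous_on_norm cv)
    then obtain t0 where "t0 \<in> {0..1::real}" "\<forall>t\<in>{0..1}. norm (v t0) \<le> norm (v t)"
      using continuous_attains_inf[of "{0..1::real}" "\<lambda>t. norm (v t)"] by fastforce
    moreover have "v t0 \<noteq> 0" using \<beta> by (simp add: closed_curve_def v_def)
    ultimately show ?thesis using that[of "norm (v t0)"] by auto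
  qed
  \<comment> \<open>With this value (m + k) / (m - k) is exactly 1 + e.\<close>
  define k where "k = m * e / (2 + e)"
  have k: "0 < k" "k < m" "2 * k \<le> e * (m - k)"
    using m(1) \<open>0 < e\<close> by (auto simp: k_def field_simps)
  have "uniformly_continuous_on {0..1} v"
    by (intro compact_uniformly_continuous cv) auto
  then obtain d where d: "0 < d" "\<And>s t. s \<in> {0..1} \<Longrightarrow> t \<in> {0..1} \<Longrightarrow> dist t s < d \<Longrightarrow> dist (v t) (v s) < k"
    using k(1) unfolding uniformly_continuous_on_def by metis
  show ?thesis
  proof (rule that[OF d(1)])
    fix s s' :: real assume s: "s \<in> {0..1}" "s' \<in> {0..1}" "s \<le> s'" "s' - s < d"
    have near: "norm (v t - v s) \<le> k" if "t \<in> {s..s'}" for t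
      using d(2)[of s t] s that by (auto simp: dist_norm dist_real_def)
    have "norm (\<beta> s' - \<beta> s - (s' - s) *\<^sub>R v s) \<le> (s' - s) * k"
    proof -
      have "((\<lambda>t. v t - v s) has_integral (\<beta> s' - \<beta> s - (s' - s) *\<^sub>R v s)) {s..s'}"
        using has_integral_diff[OF fundamental_theorem_of_calculus[OF s(3), of \<beta> v] has_integral_const_real[of "v s" s s']]
          der s(3) by simp
      from has_integral_bound_real[OF _ _ this, of k "{}"] near k(1) s(3) show ?thesis
        by (simp add: mult.commute)
    qed
    then have low: "(s' - s) * (norm (v s) - k) \<le> norm (\<beta> s' - \<beta> s)"
    proof -
      have "norm ((s' - s) *\<^sub>R v s) \<le> norm (\<beta> s' - \<beta> s) + norm (\<beta> s' - \<beta> s - (s' - s) *\<^sub>R v s)"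
        using norm_triangle_ineq4[of "\<beta> s' - \<beta> s" "\<beta> s' - \<beta> s - (s' - s) *\<^sub>R v s"] by simp
      moreover have "norm ((s' - s) *\<^sub>R v s) = (s' - s) * norm (v s)" using s(3) by simp
      ultimately show ?thesis
        using \<open>norm (\<beta> s' - \<beta> s - (s' - s) *\<^sub>R v s) \<le> (s' - s) * k\<close>
        by (simp only: Rings.right_diff_distrib)
    qed
    have "integral {s..s'} (\<lambda>t. norm (v t)) \<le> integral {s..s'} (\<lambda>t. norm (v s) + k)"
    proof (rule integral_le)
      show "(\<lambda>t. norm (v t)) integrable_on {s..s'}"
        by (intro integrable_continuous_real continuous_on_norm cv)
      fix t assume "t \<in> {s..s'}"
      then show "norm (v t) \<le> norm (v s) + k" using near[of t] norm_triangle_sub[of "v t" "v s"] by linarith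
    qed auto
    also have "\<dots> = (s' - s) * (norm (v s) + k)" using s(3) by simp
    also have "\<dots> \<le> (s' - s) * ((1 + e) * (norm (v s) - k))"
    proof (rule mult_left_mono)
      have "e * (m - k) \<le> e * (norm (v s) - k)" using m(2)[of s] s \<open>0 < e\<close> by simp
      then show "norm (v s) + k \<le> (1 + e) * (norm (v s) - k)"
        using k(3) by (simp add: algebra_simps)
    qed (use s in auto)
    also have "\<dots> \<le> (1 + e) * norm (\<beta> s' - \<beta> s)"
      using low \<open>0 < e\<close> by (simp add: mult.left_commute mult_left_mono)
    finally show "integral {s..s'} (\<lambda>t. norm (vel \<beta> t)) \<le> (1 + e) * norm (\<beta> s' - \<beta> s)"
      by (simp add: v_def)
  qed
qed

text \<open>Arc length divided by 1 + e is a 1-Lipschitz function of the point on nearby pairs.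
  Stopping at b < 1 makes the parametrisation injective on a compact interval, so that its inverse
  is uniformly continuous.\<close>

lemma length_le_hausdorff_aux:
  assumes \<beta>: "closed_curve \<beta>" and "0 < e" "0 < b" "b < 1"
  shows "ennreal (integral {0..b} (\<lambda>t. norm (vel \<beta> t)) / (1 + e)) \<le> hausdorff 1 (range \<beta>)"
proof -
  have inj: "inj_on \<beta> {0..b}"
    using \<beta> \<open>b < 1\<close> unfolding closed_curve_def by (auto intro: inj_on_subset)
  define N where "N = (\<lambda>t. norm (vel \<beta> t))"
  have cN: "continuous_on S N" for S
    unfolding N_def by (intro continuous_on_norm closed_curve_continuous_vel[OF \<beta>])
  have iN: "N integrable_on {s..s'}" for s s' by (intro integrable_continuous_real cN)
  define h where "h s = integral {0..s} N / (1 + e)" for s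
  obtain d where d: "0 < d" "\<And>s s'. s \<in> {0..1} \<Longrightarrow> s' \<in> {0..1} \<Longrightarrow> s \<le> s' \<Longrightarrow> s' - s < d \<Longrightarrow>
     integral {s..s'} N \<le> (1 + e) * norm (\<beta> s' - \<beta> s)"
    using arclength_le_chord[OF \<beta> \<open>0 < e\<close>] unfolding N_def by metis
  \<comment> \<open>Rescaled arc length, read as a function of the point instead of the
    parameter.\<close>
  define g where "g x = h (the_inv_into {0..b} \<beta> x)" for x
  have g: "g (\<beta> s) = h s" if "s \<in> {0..b}" for s
    unfolding g_def using the_inv_into_f_f[OF inj that] by simp
  \<comment> \<open>Points close in space have close parameters, so the chord estimate applies to
    every pair at distance at most \<delta>.\<close>
  obtain \<delta> where \<delta>: "0 < \<delta>" "\<And>s s'. s \<in> {0..b} \<Longrightarrow> s' \<in> {0..b} \<Longrightarrow> dist (\<beta> s) (\<beta> s') \<le> \<delta> \<Longrightarrow> \<bar>s - s'\<bar> < d"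
  proof -
    have "uniformly_continuous_on (\<beta> ` {0..b}) (the_inv_into {0..b} \<beta>)"
      by (intro compact_uniformly_continuous continuous_on_inv_into compact_continuous_image
            closed_curve_continuous[OF \<beta>] inj) auto
    then obtain \<delta> where "0 < \<delta>" "\<forall>x\<in>\<beta> ` {0..b}. \<forall>y\<in>\<beta> ` {0..b}. dist y x < \<delta> \<longrightarrow>
        dist (the_inv_into {0..b} \<beta> y) (the_inv_into {0..b} \<beta> x) < d"
      using d(1) unfolding uniformly_continuous_on_def by metis
    then show ?thesis
      by (intro that[of "\<delta>/2"]) (auto simp: the_inv_into_f_f[OF inj] dist_real_def)
  qed
  have hdiff: "h s' - h s = integral {s..s'} N / (1 + e)" if "0 \<le> s" "s \<le> s'" for s s'
    using Henstock_Kurzweil_Integration.integral_combine[of 0 s s' N] that iN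
    unfolding h_def diff_divide_distrib[symmetric] by simp
  have mon: "\<bar>h s' - h s\<bar> \<le> dist (\<beta> s') (\<beta> s)" if "s \<in> {0..b}" "s' \<in> {0..b}" "s \<le> s'" "dist (\<beta> s') (\<beta> s) \<le> \<delta>" for s s'
  proof -
    have "s' - s < d" using \<delta>(2)[of s' s] that by auto
    then have "integral {s..s'} N \<le> (1 + e) * norm (\<beta> s' - \<beta> s)"
      using d(2)[of s s'] that \<open>b < 1\<close> by auto
    moreover have "0 \<le> integral {s..s'} N"
      by (intro integral_nonneg iN) (auto simp: N_def)
    ultimately show ?thesis using hdiff[of s s'] that \<open>0 < e\<close>
      by (simp add: dist_norm divide_le_eq mult.commute)
  qed
  have "ennreal (h b) \<le> hausdorff 1 (\<beta> ` {0..b})"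
  proof (rule ennreal_le_hausdorff_1[OF \<delta>(1), where g = g])
    show "0 \<le> h b" unfolding h_def using \<open>0 < e\<close>
      by (intro divide_nonneg_nonneg integral_nonneg iN) (auto simp: N_def)
    have "continuous_on {0..b} h"
      unfolding h_def using indefinite_integral_continuous_1[OF iN[of 0 b]] \<open>0 < e\<close>
      by (auto intro!: continuous_on_divide continuous_on_const)
    have "{0..h b} \<subseteq> h ` {0..b}"
    proof
      fix y assume "y \<in> {0..h b}"
      then show "y \<in> h ` {0..b}"
        using IVT'[of h 0 y b] \<open>continuous_on {0..b} h\<close> \<open>0 < b\<close> by (auto simp: h_def)
    qed
    also have "h ` {0..b} = g ` \<beta> ` {0..b}" using g by (force simp: image_image)
    finally show "{0..h b} \<subseteq> g ` \<beta> ` {0..b}" .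
    fix x y assume "x \<in> \<beta> ` {0..b}" "y \<in> \<beta> ` {0..b}" and xy: "dist x y \<le> \<delta>"
    then obtain s s' where s: "s \<in> {0..b}" "x = \<beta> s" "s' \<in> {0..b}" "y = \<beta> s'" by blast
    show "\<bar>g x - g y\<bar> \<le> dist x y"
      using mon[OF s(1,3)] mon[OF s(3,1)] s xy g
      by (cases "s \<le> s'") (auto simp: dist_commute abs_minus_commute)
  qed
  also have "\<dots> \<le> hausdorff 1 (range \<beta>)" by (intro hausdorff_mono) auto
  finally show ?thesis by (simp add: h_def N_def)
qed

text \<open>The losses of the preceding bound, the arc beyond b and the factor 1 + e, disappear in
  the limit. This is the direction by which a bound on the Hausdorff length of the boundary controls
  the integral of the speed.\<close>

lemma length_le_hausdorff:
  assumes \<beta>: "closed_curve \<beta>"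
  shows "ennreal (integral {0..1} (\<lambda>t. norm (vel \<beta> t))) \<le> hausdorff 1 (range \<beta>)"
proof (cases "hausdorff 1 (range \<beta>)")
  case (real H)
  define N where "N = (\<lambda>t. norm (vel \<beta> t))"
  have cN: "continuous_on {0..1} N"
    unfolding N_def by (intro continuous_on_norm closed_curve_continuous_vel[OF \<beta>])
  \<comment> \<open>The cut-off 1 - 1/(n + 2), with n + 2 in place of n + 1, keeps b positive at n =
    0.\<close>
  have "integral {0..1 - inverse (real (Suc (Suc n)))} N / (1 + inverse (real (Suc n))) \<le> H" for n
  proof -
    have "ennreal (integral {0..1 - inverse (real (Suc (Suc n)))} N / (1 + inverse (real (Suc n)))) \<le> ennreal H"
      unfolding N_def real(2)[symmetric]
      by (rule length_le_hausdorff_aux[OF \<beta>]) (auto simp: field_simps)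
    then show ?thesis using real(1) by (simp add: ennreal_le_iff)
  qed
  moreover have "(\<lambda>n. integral {0..1 - inverse (real (Suc (Suc n)))} N / (1 + inverse (real (Suc n)))) \<longlonglongrightarrow> integral {0..1} N / (1 + 0)"
  proof (intro tendsto_divide tendsto_add tendsto_const LIMSEQ_inverse_real_of_nat)
    have c: "continuous_on {0..1} (\<lambda>x. integral {0..x} N)"
      by (intro indefinite_integral_continuous_1 integrable_continuous_real cN)
    have "(\<lambda>n. 1 - inverse (real (Suc (Suc n)))) \<longlonglongrightarrow> 1 - 0"
      by (rule tendsto_diff[OF tendsto_const LIMSEQ_Suc[OF LIMSEQ_inverse_real_of_nat]])
    then show "(\<lambda>n. integral {0..1 - inverse (real (Suc (Suc n)))} N) \<longlonglongrightarrow> integral {0..1} N"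
      by (intro continuous_on_tendsto_compose[OF c]) (auto simp: inverse_le_1_iff)
  qed auto
  ultimately have "integral {0..1} N / (1 + 0) \<le> H"
    by (intro LIMSEQ_le_const2) auto
  then show ?thesis unfolding real(2) by (simp add: N_def ennreal_leI)
qed simp

section \<open>Multivalued functions as local cocycles\<close>

text \<open>A closed 1-form, or a map to the circle, is represented by a function of two points that is additive
  near the diagonal (an Alexander--Spanier cocycle); its values on distant points are junk.\<close>

definition cocycle_on :: "'a::metric_space set \<Rightarrow> ('a \<Rightarrow> 'a \<Rightarrow> real) \<Rightarrow> bool" where
  "cocycle_on U w \<longleftrightarrow>
     (\<forall>x\<in>U. \<exists>d>0. \<forall>a\<in>U \<inter> ball x d. \<forall>b\<in>U \<inter> ball x d. \<forall>c\<in>U \<inter> ball x d. w a b + w b c = w a c)"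

text \<open>The analogue of an antiderivative of a pulled-back closed form, or of a lift of a map to
  the circle. It makes sense along maps that are merely continuous.\<close>

definition primitive_along ::
  "('a \<Rightarrow> 'a \<Rightarrow> real) \<Rightarrow> ('b::metric_space \<Rightarrow> 'a) \<Rightarrow> 'b set \<Rightarrow> ('b \<Rightarrow> real) \<Rightarrow> bool" where
  "primitive_along w f S P \<longleftrightarrow>
     (\<forall>x\<in>S. \<exists>d>0. \<forall>y\<in>S \<inter> ball x d. \<forall>z\<in>S \<inter> ball x d. P z - P y = w (f y) (f z))"

lemma cocycle_on_subset:
  assumes w: "cocycle_on U w" and "V \<subseteq> U" shows "cocycle_on V w"
  unfolding cocycle_on_def
proof
  fix x assume "x \<in> V"
  then obtain d where "0 < d" "\<forall>a\<in>U \<inter> ball x d. \<forall>b\<in>U \<inter> ball x d. \<forall>c\<in>U \<inter> ball x d. w a b + w b c = w a c"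
    using w \<open>V \<subseteq> U\<close> unfolding cocycle_on_def by blast
  then show "\<exists>d>0. \<forall>a\<in>V \<inter> ball x d. \<forall>b\<in>V \<inter> ball x d. \<forall>c\<in>V \<inter> ball x d. w a b + w b c = w a c"
    using \<open>V \<subseteq> U\<close> by (intro exI[of _ d]) auto
qed

lemma cocycle_on_refl:
  assumes "cocycle_on U w" "x \<in> U" shows "w x x = 0"
proof -
  obtain d where "0 < d" "\<forall>a\<in>U \<inter> ball x d. \<forall>b\<in>U \<inter> ball x d. \<forall>c\<in>U \<inter> ball x d. w a b + w b c = w a c"
    using assms unfolding cocycle_on_def by blast
  then have "w x x + w x x = w x x" using assms(2) by simp
  then show ?thesis by simp
qed

lemma primitive_along_subset:
  assumes P: "primitive_along w f S P" and "T \<subseteq> S" shows "primitive_along w f T P"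
  unfolding primitive_along_def
proof
  fix x assume "x \<in> T"
  then obtain d where "0 < d" "\<forall>y\<in>S \<inter> ball x d. \<forall>z\<in>S \<inter> ball x d. P z - P y = w (f y) (f z)"
    using P \<open>T \<subseteq> S\<close> unfolding primitive_along_def by blast
  then show "\<exists>d>0. \<forall>y\<in>T \<inter> ball x d. \<forall>z\<in>T \<inter> ball x d. P z - P y = w (f y) (f z)"
    using \<open>T \<subseteq> S\<close> by (intro exI[of _ d]) auto
qed

lemma primitive_along_cong:
  assumes "\<And>x. x \<in> S \<Longrightarrow> f x = g x"
  shows "primitive_along w f S P \<longleftrightarrow> primitive_along w g S P"
  unfolding primitive_along_def using assms by simp

lemma primitive_along_compose:
  assumes P: "primitive_along w f S P" and g: "continuous_on R g" "g ` R \<subseteq> S"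
  shows "primitive_along w (\<lambda>x. f (g x)) R (\<lambda>x. P (g x))"
  unfolding primitive_along_def
proof
  fix x assume x: "x \<in> R"
  then have "g x \<in> S" using g(2) by auto
  then obtain d where d: "0 < d" "\<And>y z. y \<in> S \<inter> ball (g x) d \<Longrightarrow> z \<in> S \<inter> ball (g x) d \<Longrightarrow> P z - P y = w (f y) (f z)"
    using P unfolding primitive_along_def by meson
  obtain e where e: "0 < e" "\<And>y. y \<in> R \<Longrightarrow> dist y x < e \<Longrightarrow> dist (g y) (g x) < d"
    using g(1) x d(1) unfolding continuous_on_iff by meson
  show "\<exists>d>0. \<forall>y\<in>R \<inter> ball x d. \<forall>z\<in>R \<inter> ball x d. P (g z) - P (g y) = w (f (g y)) (f (g z))"
    using e g(2) by (intro exI[of _ e] conjI ballI d(2)) (auto simp: dist_commute image_subset_iff)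
qed

text \<open>Both functions have the increments of \<open>w\<close> near each point, so their
  difference is locally constant.\<close>

lemma primitive_along_unique:
  assumes "primitive_along w f S P" "primitive_along w f S Q" "connected S" "x \<in> S" "y \<in> S"
  shows "P x - Q x = P y - Q y"
proof (rule connected_local_const[OF assms(3-5), where f = "\<lambda>x. P x - Q x"], rule ballI)
  fix a assume a: "a \<in> S"
  then obtain d where d: "0 < d" "\<And>y. y \<in> S \<inter> ball a d \<Longrightarrow> P y - P a = w (f a) (f y)"
    using assms(1) unfolding primitive_along_def by (meson IntI centre_in_ball)
  obtain d' where d': "0 < d'" "\<And>y. y \<in> S \<inter> ball a d' \<Longrightarrow> Q y - Q a = w (f a) (f y)"
    using assms(2) a unfolding primitive_along_def by (meson IntI centre_in_ball)
  show "eventually (\<lambda>b. P a - Q a = P b - Q b) (at a within S)"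
    unfolding eventually_at
  proof (intro exI[of _ "min d d'"] conjI ballI impI)
    fix x assume "x \<in> S" "x \<noteq> a \<and> dist x a < min d d'"
    then show "P a - Q a = P x - Q x" using d(2)[of x] d'(2)[of x] by (auto simp: dist_commute)
  qed (use d d' in simp)
qed

text \<open>On the connected overlap the two primitives differ by a constant, which is absorbed into
  one of them. Closedness of the pieces isolates the points that lie in only one of them.\<close>

lemma primitive_along_glue:
  assumes w: "cocycle_on U w" and f: "continuous_on (S1 \<union> S2) f" "f ` (S1 \<union> S2) \<subseteq> U"
    and cl: "closed S1" "closed S2" and con: "connected (S1 \<inter> S2)"
    and P: "primitive_along w f S1 P" and Q: "primitive_along w f S2 Q"
  shows "\<exists>R. primitive_along w f (S1 \<union> S2) R"
proof -
  have "\<exists>k. \<forall>x\<in>S1 \<inter> S2. P x - Q x = k"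
  proof (cases "S1 \<inter> S2 = {}")
    case False
    then obtain x0 where x0: "x0 \<in> S1 \<inter> S2" by blast
    have "P x - Q x = P x0 - Q x0" if "x \<in> S1 \<inter> S2" for x
      using primitive_along_unique[OF primitive_along_subset[OF P] primitive_along_subset[OF Q] con that x0]
      by simp
    then show ?thesis by blast
  qed auto
  then obtain k where k: "\<And>x. x \<in> S1 \<inter> S2 \<Longrightarrow> P x - Q x = k" by blast
  define R where "R x = (if x \<in> S1 then P x else Q x + k)" for x
  have R1: "R x = P x" if "x \<in> S1" for x using that by (simp add: R_def)
  have R2: "R x = Q x + k" if "x \<in> S2" for x using that k[of x] by (auto simp: R_def)
  have p1: "primitive_along w f S1 R" using P R1 by (simp add: primitive_along_def)
  have p2: "primitive_along w f S2 R" using Q R2 by (simp add: primitive_along_def)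
  have one: "\<exists>d>0. \<forall>y\<in>(S \<union> T) \<inter> ball x d. \<forall>z\<in>(S \<union> T) \<inter> ball x d. R z - R y = w (f y) (f z)"
    if S: "primitive_along w f S R" "x \<in> S" "x \<notin> T" "closed T" for S T x
  proof -
    obtain d where d: "0 < d" "\<forall>y\<in>S \<inter> ball x d. \<forall>z\<in>S \<inter> ball x d. R z - R y = w (f y) (f z)"
      using S(1,2) unfolding primitive_along_def by meson
    obtain e where e: "0 < e" "ball x e \<subseteq> - T"
      using S(3,4) by (metis Compl_iff open_Compl open_contains_ball)
    show ?thesis
      using d e by (intro exI[of _ "min d e"]) auto
  qed
  have "primitive_along w f (S1 \<union> S2) R"
    unfolding primitive_along_def
  proof
    fix x assume "x \<in> S1 \<union> S2"
    then consider "x \<in> S1" "x \<notin> S2" | "x \<in> S2" "x \<notin> S1" | "x \<in> S1" "x \<in> S2" by blast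
    then show "\<exists>d>0. \<forall>y\<in>(S1 \<union> S2) \<inter> ball x d. \<forall>z\<in>(S1 \<union> S2) \<inter> ball x d. R z - R y = w (f y) (f z)"
    proof cases
      case 1 then show ?thesis using one[OF p1 1 cl(2)] by simp
    next
      case 2 then show ?thesis using one[OF p2 2 cl(1)] by (simp add: Un_commute)
    next
      case 3
      then have "f x \<in> U" using f(2) by auto
      then obtain e where e: "0 < e" "\<And>a b c. a \<in> U \<inter> ball (f x) e \<Longrightarrow> b \<in> U \<inter> ball (f x) e \<Longrightarrow>
          c \<in> U \<inter> ball (f x) e \<Longrightarrow> w a b + w b c = w a c"
        using w unfolding cocycle_on_def by meson
      obtain d0 where d0: "0 < d0" "\<And>y. y \<in> S1 \<union> S2 \<Longrightarrow> dist y x < d0 \<Longrightarrow> dist (f y) (f x) < e"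
        using f(1) 3 e(1) unfolding continuous_on_iff by (meson UnI1)
      obtain d1 where d1: "0 < d1" "\<And>y z. y \<in> S1 \<inter> ball x d1 \<Longrightarrow> z \<in> S1 \<inter> ball x d1 \<Longrightarrow> R z - R y = w (f y) (f z)"
        using p1 3 unfolding primitive_along_def by meson
      obtain d2 where d2: "0 < d2" "\<And>y z. y \<in> S2 \<inter> ball x d2 \<Longrightarrow> z \<in> S2 \<inter> ball x d2 \<Longrightarrow> R z - R y = w (f y) (f z)"
        using p2 3 unfolding primitive_along_def by meson
      \<comment> \<open>Two points in different pieces are compared through x, which lies in both;
        additivity of \<open>w\<close> near \<open>f x\<close> then combines the two
        increments.\<close>
      have fromx: "R y - R x = w (f x) (f y)" "R x - R y = w (f y) (f x)"
        if "y \<in> (S1 \<union> S2) \<inter> ball x (min d0 (min d1 d2))" for y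
        using that d1(2)[of x y] d1(2)[of y x] d2(2)[of x y] d2(2)[of y x] d1(1) d2(1) 3 by auto
      show ?thesis
      proof (intro exI[of _ "min d0 (min d1 d2)"] conjI ballI)
        fix y z assume yz: "y \<in> (S1 \<union> S2) \<inter> ball x (min d0 (min d1 d2))" "z \<in> (S1 \<union> S2) \<inter> ball x (min d0 (min d1 d2))"
        have "w (f y) (f x) + w (f x) (f z) = w (f y) (f z)"
          using yz d0(2)[of y] d0(2)[of z] f(2) \<open>f x \<in> U\<close> e(1) by (intro e(2)) (auto simp: dist_commute)
        then show "R z - R y = w (f y) (f z)" using fromx(1)[OF yz(2)] fromx(2)[OF yz(1)] by simp
      qed (use d0 d1 d2 in simp)
    qed
  qed
  then show ?thesis by blast
qed

text \<open>Simple connectivity in the form of bisection: primitives exist on sets below a Lebesgue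
  number, and rectangles glue because their intersections are convex. Gluing along one coordinate
  fills thin strips, gluing along the other fills the rectangle.\<close>

lemma primitive_along_rectangle:
  fixes f :: "real \<times> real \<Rightarrow> 'a::metric_space"
  assumes w: "cocycle_on U w" and f: "continuous_on ({a..b} \<times> {c..d}) f" "f ` ({a..b} \<times> {c..d}) \<subseteq> U"
    and "a \<le> b" "c \<le> d"
  shows "\<exists>P. primitive_along w f ({a..b} \<times> {c..d}) P"
proof -
  define D where "D = {a..b} \<times> {c..d}"
  define good where "good T = (\<exists>P. primitive_along w f (D \<inter> T) P)" for T
  have good_sub: "good S" if "good T" "S \<subseteq> T" for S T
    using that primitive_along_subset unfolding good_def by (meson Int_mono order_refl)
  have "\<exists>e>0. good (ball x e)" if x: "x \<in> D" for x
  proof -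
    have "f x \<in> U" using x f(2) by (auto simp: D_def)
    then obtain e where e: "0 < e" "\<And>a b c. a \<in> U \<inter> ball (f x) e \<Longrightarrow> b \<in> U \<inter> ball (f x) e \<Longrightarrow>
        c \<in> U \<inter> ball (f x) e \<Longrightarrow> w a b + w b c = w a c"
      using w unfolding cocycle_on_def by meson
    obtain d0 where d0: "0 < d0" "\<And>y. y \<in> D \<Longrightarrow> dist y x < d0 \<Longrightarrow> dist (f y) (f x) < e"
      using f(1) x e(1) unfolding continuous_on_iff D_def by meson
    have inU: "f y \<in> U \<inter> ball (f x) e" if "y \<in> D \<inter> ball x d0" for y
      using that d0(2)[of y] f(2) by (auto simp: D_def dist_commute)
    have "primitive_along w f (D \<inter> ball x d0) (\<lambda>y. w (f x) (f y))"
      unfolding primitive_along_def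
    proof (intro ballI exI[of _ 1] conjI)
      fix s y z assume "y \<in> D \<inter> ball x d0 \<inter> ball s 1" "z \<in> D \<inter> ball x d0 \<inter> ball s 1"
      then have "w (f x) (f y) + w (f y) (f z) = w (f x) (f z)"
        by (intro e(2) inU) (use x d0 in auto)
      then show "w (f x) (f z) - w (f x) (f y) = w (f y) (f z)" by simp
    qed simp
    then show ?thesis using d0(1) by (auto simp: good_def)
  qed
  then obtain r where r: "\<And>x. x \<in> D \<Longrightarrow> 0 < r x \<and> good (ball x (r x))" by metis
  have "compact D" unfolding D_def by (intro compact_Times) auto
  moreover have "D \<subseteq> \<Union> ((\<lambda>x. ball x (r x)) ` D)" using r by force
  ultimately obtain e where e: "0 < e" "\<And>x. x \<in> D \<Longrightarrow> \<exists>G\<in>(\<lambda>x. ball x (r x)) ` D. ball x e \<subseteq> G"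
    by (rule Heine_Borel_lemma) auto
  have leb: "good (ball x e)" if "x \<in> D" for x
    using e(2)[OF that] r good_sub by blast
  have glue: "good (S1 \<union> S2)" if "good S1" "good S2" "closed S1" "closed S2" "convex (S1 \<inter> S2)" for S1 S2
  proof -
    have "closed D" using \<open>compact D\<close> compact_imp_closed by blast
    have "convex (D \<inter> (S1 \<inter> S2))" unfolding D_def by (intro convex_Int convex_Times that) auto
    moreover have "D \<inter> S1 \<inter> (D \<inter> S2) = D \<inter> (S1 \<inter> S2)" by auto
    ultimately have "connected (D \<inter> S1 \<inter> (D \<inter> S2))" by (simp add: convex_connected)
    moreover have "continuous_on (D \<inter> S1 \<union> D \<inter> S2) f"
      by (rule continuous_on_subset[OF f(1)]) (auto simp: D_def)
    moreover have "f ` (D \<inter> S1 \<union> D \<inter> S2) \<subseteq> U" using f(2) by (auto simp: D_def)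
    ultimately show ?thesis
      using that primitive_along_glue[OF w, of "D \<inter> S1" "D \<inter> S2" f] \<open>closed D\<close>
      unfolding good_def Int_Un_distrib by (meson closed_Int)
  qed
  \<comment> \<open>Sides shorter than e/2 keep each piece in the ball of radius e about (x, y), as
    the distance is at most the sum of the coordinate differences.\<close>
  have strip: "good ({p..q} \<times> {c..d})" if pq: "p \<le> q" "q - p < e / 2" "x \<in> {a..b}" "p \<le> x" "x \<le> q" for p q x
    using \<open>c \<le> d\<close>
  proof (induction rule: Bolzano)
    case (trans s t u)
    have "{p..q} \<times> {s..u} = {p..q} \<times> {s..t} \<union> {p..q} \<times> {t..u}" using trans by auto
    moreover have "good ({p..q} \<times> {s..t} \<union> {p..q} \<times> {t..u})"
      by (intro glue trans closed_Times convex_Int convex_Times) auto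
    ultimately show ?case by simp
  next
    case (local y)
    have "good ({p..q} \<times> {s..t})" if "s \<le> y" "y \<le> t" "t - s < e/2" for s t
    proof (rule good_sub[OF leb[of "(x, y)"]])
      show "(x, y) \<in> D" using pq local by (auto simp: D_def)
      show "{p..q} \<times> {s..t} \<subseteq> ball (x, y) e"
      proof clarify
        fix x' y' assume "x' \<in> {p..q}" "y' \<in> {s..t}"
        then have "\<bar>x - x'\<bar> < e/2" "\<bar>y - y'\<bar> < e/2" using that pq by (simp_all only: abs_less_iff atLeastAtMost_iff) linarith+
        moreover have "dist (x, y) (x', y') \<le> \<bar>x - x'\<bar> + \<bar>y - y'\<bar>"
          unfolding dist_Pair_Pair dist_real_def by (rule sqrt_sum_squares_le_sum) auto
        ultimately show "(x', y') \<in> ball (x, y) e" by simp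
      qed
    qed
    then show ?case using e(1) by (intro exI[of _ "e/2"]) auto
  qed
  have "good ({a..b} \<times> {c..d})" using \<open>a \<le> b\<close>
  proof (induction rule: Bolzano)
    case (trans s t u)
    have "{s..u} \<times> {c..d} = {s..t} \<times> {c..d} \<union> {t..u} \<times> {c..d}" using trans by auto
    moreover have "good ({s..t} \<times> {c..d} \<union> {t..u} \<times> {c..d})"
      by (intro glue trans closed_Times convex_Int convex_Times) auto
    ultimately show ?case by simp
  next
    case (local x)
    then show ?case using strip[of _ _ x] e(1) by (intro exI[of _ "e/2"]) auto
  qed
  then show ?thesis by (simp add: good_def D_def)
qed

text \<open>A path is a rectangle of height 0.\<close>

lemma primitive_along_interval:
  fixes f :: "real \<Rightarrow> 'a::metric_space"
  assumes w: "cocycle_on U w" and f: "continuous_on {a..b} f" "f ` {a..b} \<subseteq> U" and "a \<le> b"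
  shows "\<exists>P. primitive_along w f {a..b} P"
proof -
  have "continuous_on ({a..b} \<times> {0..0::real}) (\<lambda>z. f (fst z))"
    by (rule continuous_on_compose2[OF f(1)]) (auto intro: continuous_intros)
  then obtain P where "primitive_along w (\<lambda>z. f (fst z)) ({a..b} \<times> {0..0::real}) P"
    using primitive_along_rectangle[OF w, of a b 0 0 "\<lambda>z. f (fst z)"] f(2) \<open>a \<le> b\<close> by force
  moreover have "continuous_on {a..b} (\<lambda>x. (x, 0::real))" by (intro continuous_intros)
  ultimately show ?thesis
    using primitive_along_compose[of w "\<lambda>z. f (fst z)" _ P "{a..b}" "\<lambda>x. (x, 0)"] by force
qed

text \<open>Variation of the cocycle along a path parametrised by \<open>[0,1]\<close>; junk if there is no primitive.\<close>

definition cvar :: "('a \<Rightarrow> 'a \<Rightarrow> real) \<Rightarrow> (real \<Rightarrow> 'a) \<Rightarrow> real" where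
  "cvar w p = (THE r. \<exists>P. primitive_along w p {0..1} P \<and> r = P 1 - P 0)"

lemma cvar_eq:
  assumes "primitive_along w p {0..1} P" shows "cvar w p = P 1 - P 0"
  unfolding cvar_def
proof (rule the_equality)
  fix r assume "\<exists>Q. primitive_along w p {0..1} Q \<and> r = Q 1 - Q 0"
  then obtain Q where Q: "primitive_along w p {0..1} Q" "r = Q 1 - Q 0" by blast
  show "r = P 1 - P 0"
    using primitive_along_unique[OF assms Q(1), of 0 1] Q(2) by simp
qed (use assms in blast)

lemma cvar_cong:
  assumes "\<And>t. t \<in> {0..1} \<Longrightarrow> p t = q t" shows "cvar w p = cvar w q"
  unfolding cvar_def using primitive_along_cong[of "{0..1}" p q w] assms by simp

lemma cvar_const: "cocycle_on U w \<Longrightarrow> a \<in> U \<Longrightarrow> cvar w (\<lambda>_. a) = 0"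
  by (subst cvar_eq[of _ _ "\<lambda>_. 0"]) (auto simp: primitive_along_def cocycle_on_refl intro!: exI[of _ 1])

text \<open>Stokes on the square: both sides are the increment of one primitive from (0, 0) to (1,
  1).\<close>

lemma cvar_square:
  fixes H :: "real \<times> real \<Rightarrow> 'a::metric_space"
  assumes w: "cocycle_on U w" and H: "continuous_on ({0..1} \<times> {0..1}) H" "H ` ({0..1} \<times> {0..1}) \<subseteq> U"
  shows "cvar w (\<lambda>t. H (t, 0)) + cvar w (\<lambda>t. H (1, t)) = cvar w (\<lambda>t. H (0, t)) + cvar w (\<lambda>t. H (t, 1))"
proof -
  obtain P where P: "primitive_along w H ({0..1} \<times> {0..1}) P"
    using primitive_along_rectangle[OF w H] by auto
  have side: "cvar w (\<lambda>t. H (g t)) = P (g 1) - P (g 0)"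
    if "continuous_on {0..1} g" "g ` {0..1} \<subseteq> {0..1} \<times> {0..1}" for g
    by (rule cvar_eq[OF primitive_along_compose[OF P that]])
  have "continuous_on {0..1} (\<lambda>t::real. (t, c))" "continuous_on {0..1} (\<lambda>t::real. (c, t))" for c :: real
    by (intro continuous_intros)+
  then show ?thesis
    using side[of "\<lambda>t. (t, 0)"] side[of "\<lambda>t. (t, 1)"] side[of "\<lambda>t. (0, t)"] side[of "\<lambda>t. (1, t)"]
    by (simp add: image_subset_iff)
qed

text \<open>In a homotopy through loops the two ends of the loop trace the same path, so the
  contributions of these sides cancel.\<close>

lemma cvar_homotopic_loops:
  fixes p q :: "real \<Rightarrow> 'a::metric_space"
  assumes w: "cocycle_on U w" and "homotopic_loops U p q"
  shows "cvar w p = cvar w q"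
proof -
  obtain h :: "real \<times> real \<Rightarrow> 'a" where h: "continuous_on ({0..1} \<times> {0..1}) h" "h \<in> {0..1} \<times> {0..1} \<rightarrow> U"
    "\<forall>x\<in>{0..1}. h (0, x) = p x" "\<forall>x\<in>{0..1}. h (1, x) = q x"
    "\<forall>t\<in>{0..1}. pathfinish (h \<circ> Pair t) = pathstart (h \<circ> Pair t)"
    using assms(2) unfolding homotopic_loops by blast
  have "cvar w (\<lambda>t. h (t, 0)) = cvar w (\<lambda>t. h (t, 1))"
    using h(5) by (intro cvar_cong) (auto simp: pathfinish_def pathstart_def)
  moreover have "cvar w (\<lambda>t. h (0, t)) = cvar w p" "cvar w (\<lambda>t. h (1, t)) = cvar w q"
    using h(3,4) by (auto intro!: cvar_cong)
  ultimately show ?thesis using cvar_square[OF w h(1)] h(2) by (simp add: image_subset_iff_funcset)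
qed

section \<open>Pairing of cocycles with singular 1-chains\<close>

definition edge_point :: "real \<Rightarrow> nat \<Rightarrow> real" where
  "edge_point t i = (if i = 0 then 1 - t else if i = 1 then t else 0)"

text \<open>The pairing of the cocycle with an integral singular 1-chain, as a total function: edges
  without a primitive contribute junk, and linearity holds regardless.\<close>

definition chain_var :: "('a \<Rightarrow> 'a \<Rightarrow> real) \<Rightarrow> 'a chain \<Rightarrow> real" where
  "chain_var w c = (\<Sum>\<sigma>\<in>Poly_Mapping.keys c. of_int (Poly_Mapping.lookup c \<sigma>) * cvar w (\<lambda>t. \<sigma> (edge_point t)))"

lemma chain_var_superset:
  assumes "finite A" "Poly_Mapping.keys c \<subseteq> A"
  shows "chain_var w c = (\<Sum>\<sigma>\<in>A. of_int (Poly_Mapping.lookup c \<sigma>) * cvar w (\<lambda>t. \<sigma> (edge_point t)))"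
  unfolding chain_var_def
  by (rule sum.mono_neutral_left) (use assms in \<open>auto simp: in_keys_iff\<close>)

lemma chain_var_add: "chain_var w (c + d) = chain_var w c + chain_var w d"
proof -
  let ?A = "Poly_Mapping.keys c \<union> Poly_Mapping.keys d"
  have "Poly_Mapping.keys (c + d) \<subseteq> ?A" by (rule Poly_Mapping.keys_add)
  then show ?thesis
    by (simp add: chain_var_superset[of ?A] lookup_add sum.distrib distrib_right)
qed

lemma chain_var_cmul: "chain_var w (frag_cmul k c) = of_int k * chain_var w c"
proof -
  have "Poly_Mapping.keys (frag_cmul k c) \<subseteq> Poly_Mapping.keys c" by (rule keys_cmul)
  then show ?thesis
    by (simp add: chain_var_superset[of "Poly_Mapping.keys c"] sum_distrib_left mult.assoc)
qed

lemma chain_var_diff: "chain_var w (c - d) = chain_var w c - chain_var w d"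
  using chain_var_add[of w c "frag_cmul (-1) d"] chain_var_cmul[of w "-1" d] by simp

lemma chain_var_of: "chain_var w (frag_of \<sigma>) = cvar w (\<lambda>t. \<sigma> (edge_point t))"
  by (simp add: chain_var_def)

lemma edge_point_in_simplex: "t \<in> {0..1} \<Longrightarrow> edge_point t \<in> standard_simplex 1"
  by (auto simp: standard_simplex_def edge_point_def)

text \<open>The map \<open>g\<close> below collapses one side of the square onto a vertex of the simplex and maps the other three
  sides onto its faces.\<close>

lemma chain_var_boundary_of_simplex:
  fixes T :: "'a::metric_space set"
  assumes w: "cocycle_on T w" and \<sigma>: "singular_simplex 2 (top_of_set T) \<sigma>"
  shows "chain_var w (chain_boundary 2 (frag_of \<sigma>)) = 0"
proof -
  define g where "g z i = (if i = 0 then 1 - fst z else if i = 1 then fst z * (1 - snd z)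
    else if i = 2 then fst z * snd z else (0::real))" for z :: "real \<times> real" and i :: nat
  have cg: "continuous_on ({0..1} \<times> {0..1}) g"
  proof (rule continuous_on_coordinatewise_then_product)
    fix i :: nat
    consider "i = 0" | "i = 1" | "i = 2" | "i \<noteq> 0" "i \<noteq> 1" "i \<noteq> 2" by blast
    then show "continuous_on ({0..1} \<times> {0..1}) (\<lambda>z. g z i)"
      by cases (simp_all add: g_def continuous_intros)
  qed
  have gs: "g z \<in> standard_simplex 2" if "z \<in> {0..1} \<times> {0..1}" for z
  proof -
    have "fst z * snd z \<le> fst z" "0 \<le> fst z * snd z"
      using that by (auto intro!: mult_right_le_one_le)
    then show ?thesis using that
      by (auto simp: standard_simplex_def g_def numeral_2_eq_2 algebra_simps)
  qed
  have "continuous_map (subtopology (powertop_real UNIV) (standard_simplex 2)) (top_of_set T) \<sigma>"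
    using \<sigma> unfolding singular_simplex_def by (rule conjunct1)
  then have "continuous_on (standard_simplex 2) \<sigma> \<and> \<sigma> \<in> standard_simplex 2 \<rightarrow> T"
    unfolding euclidean_product_topology continuous_map_subtopology_eu .
  then have c\<sigma>: "continuous_on (standard_simplex 2) \<sigma>" "\<And>x. x \<in> standard_simplex 2 \<Longrightarrow> \<sigma> x \<in> T"
    by auto
  have face: "cvar w (\<lambda>t. singular_face 2 k \<sigma> (edge_point t)) = cvar w (\<lambda>t. \<sigma> (g (h t)))"
    if "\<And>t. t \<in> {0..1} \<Longrightarrow> simplical_face k (edge_point t) = g (h t)" for k h
    by (rule cvar_cong) (use that edge_point_in_simplex in \<open>auto simp: singular_face_def\<close>)
  have f0: "cvar w (\<lambda>t. singular_face 2 0 \<sigma> (edge_point t)) = cvar w (\<lambda>t. \<sigma> (g (1, t)))"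
    by (rule face) (auto simp: simplical_face_def g_def edge_point_def fun_eq_iff)
  have f1: "cvar w (\<lambda>t. singular_face 2 1 \<sigma> (edge_point t)) = cvar w (\<lambda>t. \<sigma> (g (t, 1)))"
    by (rule face) (auto simp: simplical_face_def g_def edge_point_def fun_eq_iff)
  have f2: "cvar w (\<lambda>t. singular_face 2 2 \<sigma> (edge_point t)) = cvar w (\<lambda>t. \<sigma> (g (t, 0)))"
    by (rule face) (auto simp: simplical_face_def g_def edge_point_def fun_eq_iff)
  have sq: "cvar w (\<lambda>t. \<sigma> (g (t, 0))) + cvar w (\<lambda>t. \<sigma> (g (1, t))) = cvar w (\<lambda>t. \<sigma> (g (0, t))) + cvar w (\<lambda>t. \<sigma> (g (t, 1)))"
  proof (rule cvar_square[OF w, where H = "\<lambda>z. \<sigma> (g z)"])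
    show "continuous_on ({0..1} \<times> {0..1}) (\<lambda>z. \<sigma> (g z))"
      by (rule continuous_on_compose2[OF c\<sigma>(1) cg]) (use gs in auto)
    show "(\<lambda>z. \<sigma> (g z)) ` ({0..1} \<times> {0..1}) \<subseteq> T" using gs c\<sigma>(2) by (metis image_subsetI)
  qed
  have zero: "cvar w (\<lambda>t. \<sigma> (g (0, t))) = 0"
  proof -
    have "g (0, t) = g (0, 0)" for t by (auto simp: g_def fun_eq_iff)
    then have "(\<lambda>t. \<sigma> (g (0, t))) = (\<lambda>_. \<sigma> (g (0, 0)))" by (rule_tac ext, rule_tac arg_cong[of _ _ \<sigma>])
    then show ?thesis using cvar_const[OF w, of "\<sigma> (g (0, 0))"] gs[of "(0,0)"] c\<sigma>(2) by simp
  qed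
  have bdy: "chain_boundary 2 (frag_of \<sigma>) = frag_of (singular_face 2 0 \<sigma>)
      + frag_cmul (-1) (frag_of (singular_face 2 1 \<sigma>)) + frag_of (singular_face 2 2 \<sigma>)"
  proof -
    have "{..2::nat} = {0, 1, 2}" by auto
    then show ?thesis by (simp add: chain_boundary_of)
  qed
  have "chain_var w (chain_boundary 2 (frag_of \<sigma>)) = cvar w (\<lambda>t. singular_face 2 0 \<sigma> (edge_point t))
      + of_int (-1) * cvar w (\<lambda>t. singular_face 2 1 \<sigma> (edge_point t))
      + cvar w (\<lambda>t. singular_face 2 2 \<sigma> (edge_point t))"
    unfolding bdy chain_var_add chain_var_cmul chain_var_of by (rule refl)
  then show ?thesis using f0 f1 f2 sq zero by linarith
qed

lemma chain_var_boundary: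
  fixes T :: "'a::metric_space set"
  assumes w: "cocycle_on T w" and d: "singular_chain 2 (top_of_set T) d"
  shows "chain_var w (chain_boundary 2 d) = 0"
  using d unfolding singular_chain_def
proof (rule frag_induction[where P = "\<lambda>d. chain_var w (chain_boundary 2 d) = 0"])
  show "chain_var w (chain_boundary 2 0) = 0" by (simp add: chain_var_def)
  show "chain_var w (chain_boundary 2 (frag_of x)) = 0" if "x \<in> singular_simplex_set 2 (top_of_set T)" for x
    using chain_var_boundary_of_simplex[OF w] that by blast
  show "chain_var w (chain_boundary 2 (a - b)) = 0"
    if "chain_var w (chain_boundary 2 a) = 0" "chain_var w (chain_boundary 2 b) = 0" for a b
    using that by (simp only: chain_boundary_diff chain_var_diff)
qed

lemma chain_var_loop_chain: "chain_var w (loop_chain \<beta>) = cvar w \<beta>"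
  unfolding loop_chain_def chain_var_of
proof (rule cvar_cong)
  fix t :: real assume "t \<in> {0..1}"
  then have "edge_point t \<in> standard_simplex 1" by (rule edge_point_in_simplex)
  then show "restrict (\<lambda>x. \<beta> (x 1)) (standard_simplex 1) (edge_point t) = \<beta> t"
    unfolding restrict_apply by (subst if_P) (auto simp: edge_point_def)
qed

text \<open>A homology in the torus is the boundary of a 2-chain, on which the pairing vanishes. The
  curves \<mu> and l are fixed before the cocycle, so that two different cocycles can be evaluated
  on the same pair.\<close>

lemma cvar_torus_class:
  assumes "torus_class \<gamma> \<beta> a b"
  obtains \<mu> l where "is_meridian \<gamma> \<mu>" "is_longitude \<gamma> l"
    "\<And>w. cocycle_on (torus \<gamma>) w \<Longrightarrow> cvar w \<beta> = of_int a * cvar w \<mu> + of_int b * cvar w l"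
proof -
  obtain \<mu> l where ml: "is_meridian \<gamma> \<mu>" "is_longitude \<gamma> l"
    and h: "homologous_rel 1 (top_of_set (torus \<gamma>)) {} (loop_chain \<beta>)
          (frag_cmul a (loop_chain \<mu>) + frag_cmul b (loop_chain l))"
    using assms unfolding torus_class_def by blast
  from h obtain d where d: "singular_chain (Suc 1) (top_of_set (torus \<gamma>)) d"
    "chain_boundary (Suc 1) d = loop_chain \<beta> - (frag_cmul a (loop_chain \<mu>) + frag_cmul b (loop_chain l))"
    unfolding homologous_rel_def singular_boundary by blast
  have "cvar w \<beta> = of_int a * cvar w \<mu> + of_int b * cvar w l" if "cocycle_on (torus \<gamma>) w" for w
  proof -
    have "chain_var w (loop_chain \<beta> - (frag_cmul a (loop_chain \<mu>) + frag_cmul b (loop_chain l))) = 0"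
      using chain_var_boundary[OF that, of d] d by (simp add: numeral_2_eq_2)
    then show ?thesis by (simp add: chain_var_diff chain_var_add chain_var_cmul chain_var_loop_chain)
  qed
  then show ?thesis using that ml by blast
qed

section \<open>Tubes around thick curves\<close>

lemma closed_curve_period:
  assumes "closed_curve \<gamma>" shows "\<gamma> (t + of_int k) = \<gamma> t"
proof -
  have p: "\<gamma> (t + 1) = \<gamma> t" for t using assms by (simp add: closed_curve_def)
  have n: "\<gamma> (t + of_nat n) = \<gamma> t" for t n
  proof (induction n)
    case (Suc n)
    then show ?case using p[of "t + of_nat n"] by (simp add: add.assoc add.commute[of 1])
  qed simp
  show ?thesis
  proof (cases "k \<ge> 0")
    case True then show ?thesis using n[of t "nat k"] by simp
  next
    case False then show ?thesis using n[of "t + of_int k" "nat (- k)"] by simp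
  qed
qed

lemma closed_curve_vel_period:
  assumes "closed_curve \<gamma>" shows "vel \<gamma> (t + of_int k) = vel \<gamma> t"
proof -
  have "((\<lambda>t. t + of_int k) has_vector_derivative 1) (at t)"
    unfolding has_real_derivative_iff_has_vector_derivative[symmetric] by (auto intro!: derivative_eq_intros)
  then have "((\<lambda>t. \<gamma> (t + of_int k)) has_vector_derivative (1 *\<^sub>R vel \<gamma> (t + of_int k))) (at t)"
    using vector_diff_chain_at[of "\<lambda>t. t + of_int k" 1 t \<gamma> "vel \<gamma> (t + of_int k)"]
      closed_curve_has_vector_derivative[OF assms]
    by (simp add: o_def)
  then have "(\<gamma> has_vector_derivative vel \<gamma> (t + of_int k)) (at t)"
    using closed_curve_period[OF assms] by simp
  then show ?thesis by (rule vector_derivative_at[symmetric])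
qed

lemma closed_curve_eq_iff:
  assumes "closed_curve \<gamma>" "\<gamma> a = \<gamma> b" shows "a - b \<in> \<int>"
proof -
  have "\<gamma> (frac a) = \<gamma> (frac b)"
    using closed_curve_period[OF assms(1), of "frac a" "\<lfloor>a\<rfloor>"] closed_curve_period[OF assms(1), of "frac b" "\<lfloor>b\<rfloor>"] assms(2)
    by (simp add: frac_def)
  then have "frac a = frac b"
    using assms(1) unfolding closed_curve_def inj_on_def by (simp add: frac_lt_1)
  then have "a - b = of_int (\<lfloor>a\<rfloor> - \<lfloor>b\<rfloor>)" by (simp add: frac_def)
  then show ?thesis by simp
qed

text \<open>The chord-arc inequality stops at half a period because the curve closes up; a period
  shift brings any two parameters into that range.\<close>

locale c11_curve =
  fixes \<gamma> :: "real \<Rightarrow> E3" and m A M c :: real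
  assumes closed: "closed_curve \<gamma>"
    and m_pos: "0 < m" and vel_ge: "m \<le> norm (vel \<gamma> t)" and vel_le: "norm (vel \<gamma> t) \<le> A"
    and M_nonneg: "0 \<le> M" and vel_lipschitz: "norm (vel \<gamma> s - vel \<gamma> t) \<le> M * \<bar>s - t\<bar>"
    and c_pos: "0 < c" and chord: "\<bar>a - b\<bar> \<le> 1 / 2 \<Longrightarrow> c * \<bar>a - b\<bar> \<le> norm (\<gamma> a - \<gamma> b)"
begin

lemma A_pos: "0 < A" using m_pos vel_ge vel_le by (meson less_le_trans)

lemmas vd = closed_curve_has_vector_derivative[OF closed]
lemmas cont = closed_curve_continuous[OF closed]
lemmas cont_vel = closed_curve_continuous_vel[OF closed]
lemmas period = closed_curve_period[OF closed]
lemmas vel_period = closed_curve_vel_period[OF closed]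

end

text \<open>The mean value inequality gives M in place of the sharp M / 2; only the order of the
  remainder matters below.\<close>

lemma c11_taylor:
  assumes "closed_curve \<gamma>" and lip: "\<And>s t. norm (vel \<gamma> s - vel \<gamma> t) \<le> M * \<bar>s - t\<bar>" and "0 \<le> M"
  shows "norm (\<gamma> b - \<gamma> a - (b - a) *\<^sub>R vel \<gamma> a) \<le> M * (b - a)\<^sup>2"
proof -
  have "norm (\<gamma> b - \<gamma> a - (b - a) *\<^sub>R vel \<gamma> a) \<le> norm (b - a) * (M * \<bar>b - a\<bar>)"
  proof (rule vector_differentiable_bound_linearization[where S = "closed_segment a b"])
    fix x assume x: "x \<in> closed_segment a b"
    show "(\<gamma> has_vector_derivative vel \<gamma> x) (at x within closed_segment a b)"
      by (rule closed_curve_has_vector_derivative[OF assms(1)])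
    have "\<bar>x - a\<bar> \<le> \<bar>b - a\<bar>" using x by (auto simp: closed_segment_eq_real_ivl split: if_splits)
    then show "norm (vel \<gamma> x - vel \<gamma> a) \<le> M * \<bar>b - a\<bar>"
      using lip[of x a] mult_left_mono[OF _ \<open>0 \<le> M\<close>] order_trans by blast
  qed auto
  then show ?thesis by (simp add: power2_eq_square mult.left_commute flip: abs_mult)
qed

text \<open>The chord-arc constant has two sources: the Taylor expansion for close parameters,
  compactness and injectivity for the others.\<close>

lemma c11_knot_constants:
  assumes "c11_knot \<gamma>" obtains m A M c where "c11_curve \<gamma> m A M c"
proof -
  have cl: "closed_curve \<gamma>" using assms by (simp add: c11_knot_def)
  obtain M where "M-lipschitz_on UNIV (vel \<gamma>)" using assms by (auto simp: c11_knot_def)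
  then have M: "0 \<le> M" "\<And>s t. norm (vel \<gamma> s - vel \<gamma> t) \<le> M * \<bar>s - t\<bar>"
    by (auto simp: lipschitz_on_def dist_norm)
  have fr: "vel \<gamma> t = vel \<gamma> (frac t)" for t
    using closed_curve_vel_period[OF cl, of "frac t" "\<lfloor>t\<rfloor>"] by (simp add: frac_def)
  have f01: "frac t \<in> {0..1}" for t :: real by (simp add: frac_lt_1 less_imp_le)
  have cn: "continuous_on {0..1} (\<lambda>t. norm (vel \<gamma> t))"
    by (intro continuous_on_norm closed_curve_continuous_vel[OF cl])
  obtain t0 where t0: "t0 \<in> {0..1::real}" "\<forall>t\<in>{0..1}. norm (vel \<gamma> t0) \<le> norm (vel \<gamma> t)"
    using continuous_attains_inf[OF _ _ cn] by fastforce
  obtain t1 where t1: "t1 \<in> {0..1::real}" "\<forall>t\<in>{0..1}. norm (vel \<gamma> t) \<le> norm (vel \<gamma> t1)"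
    using continuous_attains_sup[OF _ _ cn] by fastforce
  define m where "m = norm (vel \<gamma> t0)"
  define A where "A = norm (vel \<gamma> t1)"
  have m: "0 < m" using cl by (simp add: m_def closed_curve_def)
  have mA: "m \<le> norm (vel \<gamma> t)" "norm (vel \<gamma> t) \<le> A" for t
    using t0(2) t1(2) f01[of t] fr[of t] unfolding m_def A_def by auto
  \<comment> \<open>Up to this distance the quadratic remainder is at most half of the linear term;
    M + 1 keeps the quotient meaningful when M = 0.\<close>
  define \<eta> where "\<eta> = m / (2 * (M + 1))"
  have \<eta>: "0 < \<eta>" using m M by (simp add: \<eta>_def)
  have short: "m / 2 * \<bar>a - b\<bar> \<le> norm (\<gamma> a - \<gamma> b)" if "\<bar>a - b\<bar> \<le> \<eta>" for a b
  proof -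
    have "M * \<bar>b - a\<bar> \<le> M * \<eta>" using that M by (intro mult_left_mono) auto
    also have "\<dots> \<le> m / 2" using m M by (simp add: \<eta>_def field_simps)
    finally have 1: "M * \<bar>b - a\<bar> * \<bar>b - a\<bar> \<le> m / 2 * \<bar>b - a\<bar>" by (intro mult_right_mono) auto
    have "norm ((b - a) *\<^sub>R vel \<gamma> a) \<le> norm (\<gamma> b - \<gamma> a) + norm (\<gamma> b - \<gamma> a - (b - a) *\<^sub>R vel \<gamma> a)"
      using norm_triangle_ineq4[of "\<gamma> b - \<gamma> a" "\<gamma> b - \<gamma> a - (b - a) *\<^sub>R vel \<gamma> a"] by simp
    then have "\<bar>b - a\<bar> * norm (vel \<gamma> a) \<le> norm (\<gamma> b - \<gamma> a) + M * (b - a)\<^sup>2"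
      using c11_taylor[OF cl M(2,1), of b a] by simp
    moreover have "\<bar>b - a\<bar> * m \<le> \<bar>b - a\<bar> * norm (vel \<gamma> a)" using mA by (intro mult_left_mono) auto
    moreover have "M * (b - a)\<^sup>2 = M * \<bar>b - a\<bar> * \<bar>b - a\<bar>" by (simp add: power2_eq_square)
    ultimately show ?thesis using 1 by (simp add: norm_minus_commute abs_minus_commute algebra_simps)
  qed
  \<comment> \<open>Pairs of a start parameter and an offset between \<eta> and half a period, where
    the chord cannot vanish.\<close>
  define K :: "(real \<times> real) set" where "K = {0..1} \<times> ({-1/2..-\<eta>} \<union> {\<eta>..1/2})"
  have "compact K" unfolding K_def by (intro compact_Times compact_Un) auto
  obtain \<mu> where \<mu>: "0 < \<mu>" "\<And>z. z \<in> K \<Longrightarrow> \<mu> \<le> norm (\<gamma> (fst z) - \<gamma> (fst z + snd z))"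
  proof (cases "K = {}")
    case True then show ?thesis using that[of 1] by simp
  next
    case False
    have "continuous_on K (\<lambda>z. norm (\<gamma> (fst z) - \<gamma> (fst z + snd z)))"
      by (intro continuous_intros continuous_on_compose2[OF closed_curve_continuous[OF cl, of UNIV]]) auto
    then obtain z0 where z0: "z0 \<in> K" "\<And>z. z \<in> K \<Longrightarrow> norm (\<gamma> (fst z0) - \<gamma> (fst z0 + snd z0)) \<le> norm (\<gamma> (fst z) - \<gamma> (fst z + snd z))"
      using continuous_attains_inf[OF \<open>compact K\<close> False] by blast
    have "\<gamma> (fst z0) \<noteq> \<gamma> (fst z0 + snd z0)"
    proof
      assume "\<gamma> (fst z0) = \<gamma> (fst z0 + snd z0)"
      then have "- snd z0 \<in> \<int>" using closed_curve_eq_iff[OF cl] by force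
      then obtain k :: int where k: "- snd z0 = of_int k" by (elim Ints_cases)
      have "\<bar>snd z0\<bar> \<le> 1/2" "snd z0 \<noteq> 0" using z0(1) \<eta> by (auto simp: K_def)
      then have "\<bar>of_int k\<bar> \<le> (1/2::real)" "k \<noteq> 0" using k by auto
      then show False by linarith
    qed
    then show ?thesis using that[OF _ z0(2)] by simp
  qed
  \<comment> \<open>The factor 2 compensates for |a - b| being at most 1/2.\<close>
  have far: "2 * \<mu> * \<bar>a - b\<bar> \<le> norm (\<gamma> a - \<gamma> b)" if "\<eta> < \<bar>a - b\<bar>" "\<bar>a - b\<bar> \<le> 1/2" for a b
  proof -
    have "(frac a, b - a) \<in> K" using that f01[of a] unfolding K_def by (auto simp: abs_if split: if_splits)
    from \<mu>(2)[OF this] have "\<mu> \<le> norm (\<gamma> (frac a) - \<gamma> (frac a + (b - a)))" by simp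
    moreover have "\<gamma> (frac a) = \<gamma> a" "\<gamma> (frac a + (b - a)) = \<gamma> b"
      using closed_curve_period[OF cl, of "frac a" "\<lfloor>a\<rfloor>"] closed_curve_period[OF cl, of "frac a + (b - a)" "\<lfloor>a\<rfloor>"]
      by (simp_all add: frac_def algebra_simps)
    moreover have "2 * \<mu> * \<bar>a - b\<bar> \<le> 2 * \<mu> * (1/2)" using \<mu> that by (intro mult_left_mono) auto
    ultimately show ?thesis by simp
  qed
  have "c11_curve \<gamma> m A M (min (m / 2) (2 * \<mu>))"
  proof
    show "0 < min (m / 2) (2 * \<mu>)" using m \<mu> by simp
    fix a b :: real assume ab: "\<bar>a - b\<bar> \<le> 1 / 2"
    have "min (m / 2) (2 * \<mu>) * \<bar>a - b\<bar> \<le> m / 2 * \<bar>a - b\<bar>" "min (m / 2) (2 * \<mu>) * \<bar>a - b\<bar> \<le> 2 * \<mu> * \<bar>a - b\<bar>"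
      by (intro mult_right_mono; simp)+
    then show "min (m / 2) (2 * \<mu>) * \<bar>a - b\<bar> \<le> norm (\<gamma> a - \<gamma> b)"
      using short[of a b] far[of a b] ab by linarith
  qed (use cl m M mA in auto)
  then show ?thesis by (rule that)
qed

context c11_curve
begin

lemmas taylor = c11_taylor[OF closed vel_lipschitz M_nonneg]

lemma shift_near: fixes t s :: real obtains k :: int where "\<bar>t - (s + of_int k)\<bar> \<le> 1 / 2"
proof -
  have "\<bar>of_int (round (t - s)) - (t - s)\<bar> \<le> 1 / 2" by (rule of_int_round_abs_le)
  then have "\<bar>t - (s + of_int (round (t - s)))\<bar> \<le> 1 / 2" by linarith
  then show ?thesis by (rule that)
qed

text \<open>Makes the set in the definition of \<open>thickness\<close> nonempty, since a supremum
  over the empty set would carry no information. If two normal disks of small radius met at nearby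
  parameters, comparing tangential components would make the speed too small.\<close>

lemma embedded_tube_exists: "\<exists>r>0. embedded_tube \<gamma> r"
proof -
  \<comment> \<open>Chosen so that r (M + 2 M A / c) stays below the squared minimal speed, which is
    the contradiction at the end of \<open>key\<close>; the summand 1 keeps D positive when M =
    0.\<close>
  define D where "D = M + 2 * M * A / c + 1"
  define r where "r = m\<^sup>2 / (2 * D)"
  have den: "0 < D" using M_nonneg A_pos c_pos by (simp add: D_def add_nonneg_pos)
  have r: "0 < r" using den m_pos by (simp add: r_def)
  have rm: "r * (M + 2 * M * A / c) < m\<^sup>2"
  proof -
    have "r * (M + 2 * M * A / c) \<le> r * D" using r by (simp add: D_def)
    also have "\<dots> = m\<^sup>2 / 2" using den by (simp add: r_def)
    finally show ?thesis using m_pos by (smt (verit) field_sum_of_halves zero_less_power)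
  qed
  have key: "t = s" if eq: "\<gamma> t + v = \<gamma> s + w" and v: "v \<bullet> vel \<gamma> t = 0" "norm v < r"
    and w: "w \<bullet> vel \<gamma> s = 0" "norm w < r" and near: "\<bar>t - s\<bar> \<le> 1 / 2" for t s v w
  proof (rule ccontr)
    assume "t \<noteq> s"
    define \<tau> where "\<tau> = \<bar>t - s\<bar>"
    have \<tau>: "0 < \<tau>" using \<open>t \<noteq> s\<close> by (simp add: \<tau>_def)
    have \<Delta>: "\<gamma> s - \<gamma> t = v - w" using eq by (simp add: algebra_simps)
    have "c * \<tau> \<le> norm (\<gamma> s - \<gamma> t)" using chord[OF near] by (simp add: \<tau>_def norm_minus_commute)
    also have "\<dots> \<le> 2 * r" unfolding \<Delta> using norm_triangle_ineq4[of v w] v w by simp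
    finally have \<tau>r: "\<tau> \<le> 2 * r / c" using c_pos by (simp add: field_simps)
    define R where "R = \<gamma> s - \<gamma> t - (s - t) *\<^sub>R vel \<gamma> t"
    have R: "norm R \<le> M * \<tau>\<^sup>2" using taylor[of s t] by (simp add: R_def \<tau>_def power2_abs power2_commute)
    \<comment> \<open>Pairing with the velocity at t removes v, and w survives only through the
      change of the velocity between t and s, which is of first order in \<tau>.\<close>
    have "(v - w) \<bullet> vel \<gamma> t = (s - t) * (norm (vel \<gamma> t))\<^sup>2 + R \<bullet> vel \<gamma> t"
      unfolding \<Delta>[symmetric] R_def by (simp add: power2_norm_eq_inner inner_diff_left)
    moreover have "(v - w) \<bullet> vel \<gamma> t = - (w \<bullet> (vel \<gamma> t - vel \<gamma> s))"
      using v w by (simp add: inner_diff_left inner_diff_right)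
    ultimately have "- (w \<bullet> (vel \<gamma> t - vel \<gamma> s)) - R \<bullet> vel \<gamma> t = (s - t) * (norm (vel \<gamma> t))\<^sup>2" by simp
    then have "\<tau> * (norm (vel \<gamma> t))\<^sup>2 = \<bar>- (w \<bullet> (vel \<gamma> t - vel \<gamma> s)) - R \<bullet> vel \<gamma> t\<bar>"
      by (simp add: \<tau>_def abs_mult abs_minus_commute)
    also have "\<dots> \<le> norm w * norm (vel \<gamma> t - vel \<gamma> s) + norm R * norm (vel \<gamma> t)"
      using Cauchy_Schwarz_ineq2[of w "vel \<gamma> t - vel \<gamma> s"] Cauchy_Schwarz_ineq2[of R "vel \<gamma> t"] by linarith
    also have "\<dots> \<le> r * (M * \<tau>) + (M * \<tau>\<^sup>2) * A"
      using w R vel_lipschitz[of t s] vel_le[of t] M_nonneg r unfolding \<tau>_def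
      by (intro add_mono mult_mono) auto
    also have "\<dots> \<le> r * (M * \<tau>) + (M * (\<tau> * (2 * r / c))) * A"
      using \<tau> \<tau>r M_nonneg A_pos unfolding power2_eq_square
      by (intro add_left_mono mult_right_mono mult_left_mono) auto
    also have "\<dots> = \<tau> * (r * (M + 2 * M * A / c))" by (simp add: algebra_simps)
    also have "\<dots> < \<tau> * m\<^sup>2" using rm \<tau> by simp
    also have "\<dots> \<le> \<tau> * (norm (vel \<gamma> t))\<^sup>2"
      using \<tau> vel_ge[of t] m_pos by (intro mult_left_mono power_mono) auto
    finally show False by simp
  qed
  have "embedded_tube \<gamma> r"
    unfolding embedded_tube_def
  proof (rule inj_onI, clarify)
    fix t v s w assume 1: "0 \<le> t" "t < 1" "v \<bullet> vel \<gamma> t = 0" "norm v < r"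
      "0 \<le> s" "s < 1" "w \<bullet> vel \<gamma> s = 0" "norm w < r" "\<gamma> t + v = \<gamma> s + w"
    obtain k :: int where k: "\<bar>t - (s + of_int k)\<bar> \<le> 1 / 2" by (rule shift_near)
    have "t = s + of_int k"
      using 1 k by (intro key[of t v "s + of_int k" w]) (simp_all add: period vel_period)
    then have "k = 0" using 1 by linarith
    then have "t = s" using \<open>t = s + of_int k\<close> by simp
    then show "t = s \<and> v = w" using 1 by simp
  qed
  then show ?thesis using r by blast
qed

end


lemma (in c11_curve) first_order_nearest:
  assumes "\<And>s. norm (y - \<gamma> s0) \<le> norm (y - \<gamma> s)"
  shows "(y - \<gamma> s0) \<bullet> vel \<gamma> s0 = 0"
proof -
  define f where "f s = (y - \<gamma> s) \<bullet> (y - \<gamma> s)" for s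
  have "(\<gamma> has_derivative (\<lambda>h. h *\<^sub>R vel \<gamma> s0)) (at s0)"
    using vd[of s0 UNIV] by (simp add: has_vector_derivative_def)
  then have "(f has_derivative (\<lambda>h. (- 2 * ((y - \<gamma> s0) \<bullet> vel \<gamma> s0)) * h)) (at s0)"
    unfolding f_def by (auto intro!: derivative_eq_intros simp: inner_commute)
  then have "(f has_real_derivative (- 2 * ((y - \<gamma> s0) \<bullet> vel \<gamma> s0))) (at s0)"
    unfolding has_field_derivative_def .
  moreover have "f s0 \<le> f s" for s
    using assms[of s] by (simp add: f_def norm_le)
  ultimately have "- 2 * ((y - \<gamma> s0) \<bullet> vel \<gamma> s0) = 0"
    by (intro DERIV_local_min[of f _ s0 1]) auto
  then show ?thesis by simp
qed

lemma (in c11_curve) nearest_exists: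
  obtains s where "\<And>t. norm (y - \<gamma> s) \<le> norm (y - \<gamma> t)" "(y - \<gamma> s) \<bullet> vel \<gamma> s = 0"
proof -
  have "continuous_on {0..1} (\<lambda>t. norm (y - \<gamma> t))" by (intro continuous_intros cont)
  then obtain s where s: "\<forall>t\<in>{0..1}. norm (y - \<gamma> s) \<le> norm (y - \<gamma> t)"
    using continuous_attains_inf[of "{0..1::real}" "\<lambda>t. norm (y - \<gamma> t)"] by fastforce
  have "norm (y - \<gamma> s) \<le> norm (y - \<gamma> t)" for t
  proof -
    have "frac t \<in> {0..1}" by (simp add: frac_lt_1 less_imp_le)
    moreover have "\<gamma> (frac t) = \<gamma> t" using period[of "frac t" "\<lfloor>t\<rfloor>"] by (simp add: frac_def)
    ultimately show ?thesis using s by metis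
  qed
  then show ?thesis using that first_order_nearest by blast
qed

section \<open>Reach inequalities and the foot parameter in the tube of radius 1/2\<close>

locale thick_curve = c11_curve +
  assumes thick: "1 \<le> thickness \<gamma>"
begin

text \<open>The supremum need not be attained, so embeddedness is available for radii strictly below
  1 only.\<close>

lemma embedded_tube_below_1:
  assumes "r < 1" shows "embedded_tube \<gamma> r"
proof -
  define S where "S = {r. 0 < r \<and> embedded_tube \<gamma> r}"
  have "\<exists>r'\<in>S. r \<le> r'"
  proof (rule ccontr)
    assume "\<not> (\<exists>r'\<in>S. r \<le> r')"
    then have "Sup S \<le> r"
      using embedded_tube_exists by (intro cSup_least) (auto simp: S_def)
    then show False using thick assms by (simp add: thickness_def S_def)
  qed
  then obtain r' where "embedded_tube \<gamma> r'" "r \<le> r'" by (auto simp: S_def)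
  then show ?thesis unfolding embedded_tube_def by (elim inj_on_subset) auto
qed

lemma tube_unique:
  assumes eq: "\<gamma> t + v = \<gamma> s + w"
    and v: "v \<bullet> vel \<gamma> t = 0" "norm v < 1" and w: "w \<bullet> vel \<gamma> s = 0" "norm w < 1"
  shows "t - s \<in> \<int> \<and> v = w"
proof -
  obtain r where r: "max (norm v) (norm w) < r" "r < 1" using v w dense[of "max (norm v) (norm w)" 1] by auto
  have f: "\<gamma> (frac t) = \<gamma> t" "vel \<gamma> (frac t) = vel \<gamma> t" for t
    using period[of "frac t" "\<lfloor>t\<rfloor>"] vel_period[of "frac t" "\<lfloor>t\<rfloor>"] by (simp_all add: frac_def)
  have "(frac t, v) = (frac s, w)"
    by (rule inj_onD[OF embedded_tube_below_1[OF r(2), unfolded embedded_tube_def]])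
      (use assms r in \<open>auto simp: f frac_lt_1\<close>)
  then have "frac t = frac s" "v = w" by auto
  moreover from this have "t - s = of_int (\<lfloor>t\<rfloor> - \<lfloor>s\<rfloor>)" by (simp add: frac_def)
  ultimately show ?thesis by simp
qed

text \<open>The foot \<open>\<gamma> t\<close> of a normal vector shorter than 1 is a nearest point, as otherwise two normal disks
  would meet.\<close>

lemma normal_ball_empty:
  assumes v: "v \<bullet> vel \<gamma> t = 0" "norm v < 1"
  shows "norm v \<le> norm (\<gamma> t + v - \<gamma> s)"
proof -
  obtain s0 where s0: "\<And>s. norm (\<gamma> t + v - \<gamma> s0) \<le> norm (\<gamma> t + v - \<gamma> s)"
    "(\<gamma> t + v - \<gamma> s0) \<bullet> vel \<gamma> s0 = 0"
    using nearest_exists[of "\<gamma> t + v"] by blast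
  have "norm (\<gamma> t + v - \<gamma> s0) \<le> norm v" using s0(1)[of t] by simp
  then have "v = \<gamma> t + v - \<gamma> s0"
    using tube_unique[of t v s0 "\<gamma> t + v - \<gamma> s0"] v s0(2) by simp
  then show ?thesis using s0(1)[of s] by simp
qed

text \<open>Stretching v by 3/2 keeps it shorter than 1, so the open ball about the stretched tip
  that touches the curve at the foot contains no point of the curve; expanding the square gives the
  bound. The unstretched v would give the constant 1/2, and two such terms would consume all of the
  squared chord in the next lemma.\<close>

lemma normal_inner_le:
  assumes v: "v \<bullet> vel \<gamma> t = 0" "norm v \<le> 1 / 2"
  shows "v \<bullet> (\<gamma> s - \<gamma> t) \<le> (norm (\<gamma> s - \<gamma> t))\<^sup>2 / 3"
proof -
  define w where "w = (3/2) *\<^sub>R v"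
  have "norm w \<le> norm (\<gamma> t + w - \<gamma> s)"
    by (rule normal_ball_empty) (use v in \<open>auto simp: w_def\<close>)
  then have "w \<bullet> w \<le> (w - (\<gamma> s - \<gamma> t)) \<bullet> (w - (\<gamma> s - \<gamma> t))"
    unfolding norm_le by (simp add: algebra_simps)
  then have "2 * (w \<bullet> (\<gamma> s - \<gamma> t)) \<le> (\<gamma> s - \<gamma> t) \<bullet> (\<gamma> s - \<gamma> t)"
    by (simp add: inner_diff_left inner_diff_right inner_commute)
  then show ?thesis by (simp add: w_def power2_norm_eq_inner)
qed

text \<open>Federer's estimate for the nearest-point projection: pairing the difference of the two
  points with the chord D of their feet leaves |D|^2 minus two thirds of it.\<close>

lemma projection_lipschitz:
  assumes v: "v \<bullet> vel \<gamma> t = 0" "norm v \<le> 1 / 2" and w: "w \<bullet> vel \<gamma> s = 0" "norm w \<le> 1 / 2"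
  shows "norm (\<gamma> t - \<gamma> s) \<le> 3 * norm (\<gamma> t + v - (\<gamma> s + w))"
proof -
  define D where "D = \<gamma> t - \<gamma> s"
  have 1: "- (v \<bullet> D) \<le> (norm D)\<^sup>2 / 3"
    using normal_inner_le[OF v, of s] by (simp add: D_def norm_minus_commute flip: inner_minus_right)
  have 2: "w \<bullet> D \<le> (norm D)\<^sup>2 / 3" using normal_inner_le[OF w, of t] by (simp add: D_def)
  have "(\<gamma> t + v - (\<gamma> s + w)) \<bullet> D = (norm D)\<^sup>2 + v \<bullet> D - w \<bullet> D"
    by (simp add: D_def power2_norm_eq_inner inner_diff_left inner_add_left)
  then have "(norm D)\<^sup>2 / 3 \<le> (\<gamma> t + v - (\<gamma> s + w)) \<bullet> D" using 1 2 by simp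
  also have "\<dots> \<le> norm (\<gamma> t + v - (\<gamma> s + w)) * norm D" by (rule norm_cauchy_schwarz)
  finally have "norm D * norm D \<le> 3 * norm (\<gamma> t + v - (\<gamma> s + w)) * norm D"
    by (simp add: power2_eq_square)
  then show ?thesis unfolding D_def[symmetric]
    by (cases "D = 0") auto
qed

lemma tubeI: "v \<bullet> vel \<gamma> t = 0 \<Longrightarrow> norm v \<le> 1 / 2 \<Longrightarrow> \<gamma> t + v \<in> tube \<gamma>"
  by (auto simp: tube_def rho0_def)

lemma tubeE:
  assumes "x \<in> tube \<gamma>"
  obtains t v where "x = \<gamma> t + v" "v \<bullet> vel \<gamma> t = 0" "norm v \<le> 1 / 2"
  using assms by (auto simp: tube_def rho0_def)

text \<open>Describing the tube as a sublevel set of the distance shows that it is closed and puts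
  its frontier on the level 1/2.\<close>

lemma tube_eq_infdist: "tube \<gamma> = {x. infdist x (range \<gamma>) \<le> 1 / 2}"
proof (intro equalityI subsetI)
  fix x assume "x \<in> tube \<gamma>"
  then obtain t v where x: "x = \<gamma> t + v" "norm v \<le> 1 / 2" by (rule tubeE)
  have "infdist x (range \<gamma>) \<le> dist x (\<gamma> t)" by (rule infdist_le) simp
  then show "x \<in> {x. infdist x (range \<gamma>) \<le> 1 / 2}" using x by (simp add: dist_norm)
next
  fix x assume x: "x \<in> {x. infdist x (range \<gamma>) \<le> 1 / 2}"
  obtain s where s: "\<And>t. norm (x - \<gamma> s) \<le> norm (x - \<gamma> t)" "(x - \<gamma> s) \<bullet> vel \<gamma> s = 0"
    using nearest_exists[of x] by blast
  have "norm (x - \<gamma> s) \<le> infdist x (range \<gamma>)"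
    unfolding infdist_def using s(1) by (auto intro!: cINF_greatest simp: dist_norm)
  then show "x \<in> tube \<gamma>" using x s(2) tubeI[of "x - \<gamma> s" s] by simp
qed

lemma closed_tube: "closed (tube \<gamma>)"
proof -
  have "tube \<gamma> = (\<lambda>x. infdist x (range \<gamma>)) -` {..1/2}" by (auto simp: tube_eq_infdist)
  then show ?thesis
    by (simp only:) (intro continuous_closed_vimage continuous_infdist continuous_ident closed_atMost)
qed

lemma torus_subset_tube: "torus \<gamma> \<subseteq> tube \<gamma>"
  using closed_tube by (simp add: torus_def frontier_subset_closed)

text \<open>Points at distance less than 1/2 are interior to the tube, so the offset of a frontier
  point has full length.\<close>

lemma torusE:
  assumes "x \<in> torus \<gamma>"
  obtains t v where "x = \<gamma> t + v" "v \<bullet> vel \<gamma> t = 0" "norm v = 1 / 2"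
proof -
  obtain t v where x: "x = \<gamma> t + v" "v \<bullet> vel \<gamma> t = 0" "norm v \<le> 1 / 2"
    using assms torus_subset_tube tubeE by blast
  have "{x. infdist x (range \<gamma>) < 1 / 2} \<subseteq> interior (tube \<gamma>)"
    by (intro interior_maximal) (auto simp: tube_eq_infdist intro!: open_Collect_less continuous_on_infdist continuous_intros)
  then have "\<not> infdist x (range \<gamma>) < 1 / 2" using assms by (auto simp: torus_def frontier_def)
  moreover have "infdist x (range \<gamma>) \<le> dist x (\<gamma> t)" by (rule infdist_le) simp
  ultimately have "norm v = 1 / 2" using x by (simp add: dist_norm)
  then show ?thesis using that x by blast
qed

lemma off_axis:
  assumes "v \<bullet> vel \<gamma> t = 0" "norm v < 1" "v \<noteq> 0"
  shows "\<gamma> t + v \<notin> range \<gamma>"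
proof
  assume "\<gamma> t + v \<in> range \<gamma>"
  then obtain s where "\<gamma> t + v = \<gamma> s + 0" by auto
  then show False using tube_unique[of t v s 0] assms by simp
qed

lemma torus_off_axis: "torus \<gamma> \<subseteq> - range \<gamma>"
proof
  fix x assume "x \<in> torus \<gamma>"
  then show "x \<in> - range \<gamma>" by (rule torusE) (use off_axis in fastforce)
qed

text \<open>The parameter of the foot point is an arbitrary representative modulo 1; \<open>turn\<close> is the representative of the
  difference of two such parameters of absolute value at most \<open>1/2\<close>.\<close>

definition foot :: "E3 \<Rightarrow> real" where
  "foot x = (SOME t. \<exists>v. x = \<gamma> t + v \<and> v \<bullet> vel \<gamma> t = 0 \<and> norm v \<le> 1 / 2)"

definition turn :: "E3 \<Rightarrow> E3 \<Rightarrow> real" where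
  "turn x y = foot y - foot x - of_int (round (foot y - foot x))"

lemma foot:
  assumes "x \<in> tube \<gamma>"
  shows "(x - \<gamma> (foot x)) \<bullet> vel \<gamma> (foot x) = 0" "norm (x - \<gamma> (foot x)) \<le> 1 / 2"
proof -
  have "\<exists>t v. x = \<gamma> t + v \<and> v \<bullet> vel \<gamma> t = 0 \<and> norm v \<le> 1 / 2" using assms tubeE by blast
  then have "\<exists>v. x = \<gamma> (foot x) + v \<and> v \<bullet> vel \<gamma> (foot x) = 0 \<and> norm v \<le> 1 / 2"
    unfolding foot_def by (rule someI_ex)
  then obtain v where v: "x = \<gamma> (foot x) + v" "v \<bullet> vel \<gamma> (foot x) = 0" "norm v \<le> 1 / 2" by blast
  then have "x - \<gamma> (foot x) = v" by (metis add_diff_cancel_left')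
  with v show "(x - \<gamma> (foot x)) \<bullet> vel \<gamma> (foot x) = 0" "norm (x - \<gamma> (foot x)) \<le> 1 / 2"
    by (simp_all only:)
qed

lemma turn_Ints: "turn x y - (foot y - foot x) \<in> \<int>"
  by (simp add: turn_def)

lemma abs_turn_le: "\<bar>turn x y\<bar> \<le> 1 / 2"
  using of_int_round_abs_le[of "foot y - foot x"] by (simp add: turn_def abs_minus_commute)

text \<open>The projection has Lipschitz constant 3, and the chord-arc constant converts distances
  of feet into distances of parameters modulo 1.\<close>

lemma turn_lipschitz:
  assumes "x \<in> tube \<gamma>" "y \<in> tube \<gamma>"
  shows "\<bar>turn x y\<bar> \<le> 3 / c * norm (x - y)"
proof -
  have "\<gamma> (foot x + turn x y) = \<gamma> (foot y)"
    using period[of "foot y" "- round (foot y - foot x)"] by (simp add: turn_def)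
  then have "c * \<bar>turn x y\<bar> \<le> norm (\<gamma> (foot x) - \<gamma> (foot y))"
    using chord[of "foot x" "foot x + turn x y"] abs_turn_le[of x y] by simp
  also have "\<dots> \<le> 3 * norm (x - y)"
    using projection_lipschitz[OF foot[OF assms(1)] foot[OF assms(2)]] by simp
  finally show ?thesis using c_pos by (simp add: field_simps)
qed

text \<open>The failure of additivity is an integer, and three small turns leave no room for a
  nonzero one.\<close>

lemma cocycle_turn: "cocycle_on (tube \<gamma>) turn"
  unfolding cocycle_on_def
proof
  fix x assume x: "x \<in> tube \<gamma>"
  \<comment> \<open>Points of the ball of radius c/36 are at most c/18 apart, so the Lipschitz
    constant 3/c gives 1/6; three such terms make at most 1/2.\<close>
  have small: "\<bar>turn a b\<bar> \<le> 1 / 6"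
    if "a \<in> tube \<gamma> \<inter> ball x (c / 36)" "b \<in> tube \<gamma> \<inter> ball x (c / 36)" for a b
  proof -
    have "norm (a - b) \<le> c / 18"
      using that norm_triangle_ineq4[of "a - x" "b - x"] by (simp add: dist_norm norm_minus_commute)
    then have "3 / c * norm (a - b) \<le> 3 / c * (c / 18)" using c_pos by (intro mult_left_mono) auto
    moreover have "\<bar>turn a b\<bar> \<le> 3 / c * norm (a - b)" using that by (intro turn_lipschitz) auto
    moreover have "3 / c * (c / 18) = 1 / 6" using c_pos by simp
    ultimately show ?thesis by linarith
  qed
  have "turn a b + turn b d = turn a d"
    if "a \<in> tube \<gamma> \<inter> ball x (c / 36)" "b \<in> tube \<gamma> \<inter> ball x (c / 36)" "d \<in> tube \<gamma> \<inter> ball x (c / 36)" for a b d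
  proof -
    have "turn a b + turn b d - turn a d \<in> \<int>" by (simp add: turn_def)
    then obtain k :: int where k: "turn a b + turn b d - turn a d = of_int k" by (elim Ints_cases)
    have "\<bar>of_int k\<bar> \<le> (1 / 2 :: real)"
      using small[OF that(1,2)] small[OF that(2,3)] small[OF that(1,3)] k by linarith
    then have "k = 0" by linarith
    then show ?thesis using k by simp
  qed
  then show "\<exists>d>0. \<forall>a\<in>tube \<gamma> \<inter> ball x d. \<forall>b\<in>tube \<gamma> \<inter> ball x d. \<forall>e\<in>tube \<gamma> \<inter> ball x d.
      turn a b + turn b e = turn a e"
    using c_pos by (intro exI[of _ "c / 36"]) auto
qed

lemma cvar_turn_core: "cvar turn \<gamma> = 1"
proof -
  have "primitive_along turn \<gamma> {0..1} (\<lambda>t. t)"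
    unfolding primitive_along_def
  proof (intro ballI exI[of _ "1/4"] conjI)
    fix x y z :: real assume yz: "y \<in> {0..1} \<inter> ball x (1/4)" "z \<in> {0..1} \<inter> ball x (1/4)"
    have f: "foot (\<gamma> t) - t \<in> \<int>" for t
    proof -
      have "\<gamma> t \<in> tube \<gamma>" using tubeI[of 0 t] by simp
      from foot[OF this] tube_unique[of "foot (\<gamma> t)" "\<gamma> t - \<gamma> (foot (\<gamma> t))" t 0] show ?thesis by simp
    qed
    have "turn (\<gamma> y) (\<gamma> z) - (foot (\<gamma> z) - foot (\<gamma> y)) + (foot (\<gamma> z) - z) - (foot (\<gamma> y) - y) \<in> \<int>"
      by (intro Ints_add Ints_diff turn_Ints f)
    then have "turn (\<gamma> y) (\<gamma> z) - (z - y) \<in> \<int>" by (simp add: algebra_simps)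
    then obtain k :: int where k: "turn (\<gamma> y) (\<gamma> z) - (z - y) = of_int k" by (elim Ints_cases)
    \<comment> \<open>The radius 1/4 makes this strict; together with the bound 1/2 on
      \<open>turn\<close>, the integer difference is below 1.\<close>
    have "\<bar>z - y\<bar> < 1 / 2" using yz unfolding dist_real_def mem_ball Int_iff by linarith
    then have "\<bar>of_int k\<bar> < (1 :: real)" using abs_turn_le[of "\<gamma> y" "\<gamma> z"] k by linarith
    then have "k = 0" by linarith
    then show "z - y = turn (\<gamma> y) (\<gamma> z)" using k by simp
  qed simp
  from cvar_eq[OF this] show ?thesis by simp
qed

text \<open>\<open>foot\<close> may jump by integers, but increments of P agree with those of
  \<open>foot\<close> modulo 1 on short intervals, hence by bisection on the whole interval. So P is
  a continuous choice of foot parameter.\<close>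

lemma lift_foot:
  fixes a b :: real
  assumes P: "primitive_along turn \<beta> {a..b} P" and "a \<le> b" "P a = foot (\<beta> a)"
  shows "\<gamma> (P b) = \<gamma> (foot (\<beta> b))" "vel \<gamma> (P b) = vel \<gamma> (foot (\<beta> b))"
proof -
  have "{a..b} \<subseteq> {a..b} \<longrightarrow> (P b - foot (\<beta> b)) - (P a - foot (\<beta> a)) \<in> \<int>" using \<open>a \<le> b\<close>
  proof (induction rule: Bolzano[where P = "\<lambda>s t. {s..t} \<subseteq> {a..b} \<longrightarrow> (P t - foot (\<beta> t)) - (P s - foot (\<beta> s)) \<in> \<int>"])
    case (trans r s t)
    show ?case
    proof
      assume "{r..t} \<subseteq> {a..b}"
      then have "{r..s} \<subseteq> {a..b}" "{s..t} \<subseteq> {a..b}" using trans(3,4) by auto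
      then have "(P s - foot (\<beta> s)) - (P r - foot (\<beta> r)) \<in> \<int>" "(P t - foot (\<beta> t)) - (P s - foot (\<beta> s)) \<in> \<int>"
        using trans by auto
      from Ints_add[OF this] show "(P t - foot (\<beta> t)) - (P r - foot (\<beta> r)) \<in> \<int>"
        by (simp add: algebra_simps)
    qed
  next
    case (local x)
    then obtain d where d: "0 < d" "\<forall>y\<in>{a..b} \<inter> ball x d. \<forall>z\<in>{a..b} \<inter> ball x d. P z - P y = turn (\<beta> y) (\<beta> z)"
      using P unfolding primitive_along_def by (meson atLeastAtMost_iff)
    show ?case
    proof (intro exI[of _ d] conjI allI impI)
      fix s t assume st: "s \<le> x \<and> x \<le> t \<and> t - s < d" "{s..t} \<subseteq> {a..b}"
      then have "s \<in> {a..b} \<inter> ball x d" "t \<in> {a..b} \<inter> ball x d" by (auto simp: dist_real_def)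
      then have "P t - P s = turn (\<beta> s) (\<beta> t)" using d(2) by blast
      then have eq: "(P t - foot (\<beta> t)) - (P s - foot (\<beta> s)) = turn (\<beta> s) (\<beta> t) - (foot (\<beta> t) - foot (\<beta> s))" by simp
      show "(P t - foot (\<beta> t)) - (P s - foot (\<beta> s)) \<in> \<int>" unfolding eq by (rule turn_Ints)
    qed (rule d)
  qed
  then have "P b - foot (\<beta> b) \<in> \<int>" using assms(3) by simp
  then obtain k :: int where "P b - foot (\<beta> b) = of_int k" by (elim Ints_cases)
  then have "P b = foot (\<beta> b) + of_int k" by simp
  then show "\<gamma> (P b) = \<gamma> (foot (\<beta> b))" "vel \<gamma> (P b) = vel \<gamma> (foot (\<beta> b))"
    using period vel_period by simp_all
qed

text \<open>Near each point the increment of P is a \<open>turn\<close>, for which the bound is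
  known; the bound is additive over adjacent intervals, so bisection extends it.\<close>

lemma lift_lipschitz:
  assumes P: "primitive_along turn \<beta> {a..b} P" and "\<beta> ` {a..b} \<subseteq> tube \<gamma>"
    and B: "\<And>s t. norm (\<beta> s - \<beta> t) \<le> B * \<bar>s - t\<bar>" and st: "s \<le> t" "a \<le> s" "t \<le> b"
  shows "\<bar>P t - P s\<bar> \<le> 3 / c * B * (t - s)"
proof -
  have "{s..t} \<subseteq> {a..b} \<longrightarrow> \<bar>P t - P s\<bar> \<le> 3 / c * B * (t - s)" using \<open>s \<le> t\<close>
  proof (induction rule: Bolzano[where P = "\<lambda>s t. {s..t} \<subseteq> {a..b} \<longrightarrow> \<bar>P t - P s\<bar> \<le> 3 / c * B * (t - s)"])
    case (trans r s t)
    show ?case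
    proof
      assume "{r..t} \<subseteq> {a..b}"
      then have "{r..s} \<subseteq> {a..b}" "{s..t} \<subseteq> {a..b}" using trans(3,4) by auto
      then have "\<bar>P s - P r\<bar> \<le> 3 / c * B * (s - r)" "\<bar>P t - P s\<bar> \<le> 3 / c * B * (t - s)" using trans by auto
      then have "\<bar>P t - P r\<bar> \<le> 3 / c * B * (s - r) + 3 / c * B * (t - s)" by linarith
      then show "\<bar>P t - P r\<bar> \<le> 3 / c * B * (t - r)" unfolding distrib_left[symmetric] by simp
    qed
  next
    case (local x)
    then have "x \<in> {a..b}" using st by simp
    then obtain d where d: "0 < d" "\<forall>y\<in>{a..b} \<inter> ball x d. \<forall>z\<in>{a..b} \<inter> ball x d. P z - P y = turn (\<beta> y) (\<beta> z)"
      using P unfolding primitive_along_def by blast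
    show ?case
    proof (intro exI[of _ d] conjI allI impI)
      fix s t assume st: "s \<le> x \<and> x \<le> t \<and> t - s < d" "{s..t} \<subseteq> {a..b}"
      then have *: "s \<in> {a..b} \<inter> ball x d" "t \<in> {a..b} \<inter> ball x d" by (auto simp: dist_real_def)
      then have "P t - P s = turn (\<beta> s) (\<beta> t)" using d(2) by blast
      also have "\<bar>\<dots>\<bar> \<le> 3 / c * norm (\<beta> s - \<beta> t)" using * assms(2) by (intro turn_lipschitz) auto
      also have "\<dots> \<le> 3 / c * (B * \<bar>s - t\<bar>)" using B c_pos by (intro mult_left_mono) auto
      also have "\<dots> = 3 / c * B * (t - s)" using st(1) by (simp add: abs_if)
      finally show "\<bar>P t - P s\<bar> \<le> 3 / c * B * (t - s)" .
    qed (rule d)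
  qed
  then show ?thesis using st by simp
qed

end

section \<open>The Biot--Savart field of a closed curve\<close>

lemma bounded_bilinear_cross3: "bounded_bilinear cross3"
  using bilinear_cross by (simp add: bilinear_conv_bounded_bilinear)

lemma norm_cross3_le: "norm (cross3 x y) \<le> norm x * norm y"
proof -
  have "(norm (cross3 x y))\<^sup>2 \<le> (norm x * norm y)\<^sup>2" using norm_cross_dot[of x y] by (metis le_add_same_cancel1 zero_le_power2)
  then show ?thesis by (rule power2_le_imp_le) simp
qed

lemma inverse_norm_cubed_has_derivative:
  fixes r :: "real \<Rightarrow> E3"
  assumes r: "(r has_vector_derivative r') (at s within S)" and "r s \<noteq> 0"
  shows "((\<lambda>s. inverse (norm (r s) ^ 3)) has_real_derivative (- 3 * (r s \<bullet> r') / norm (r s) ^ 5)) (at s within S)"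
proof -
  have "(r has_derivative (\<lambda>h. h *\<^sub>R r')) (at s within S)"
    using r by (simp add: has_vector_derivative_def)
  then have "((\<lambda>s. norm (r s)) has_derivative (\<lambda>h. (h *\<^sub>R r') \<bullet> sgn (r s))) (at s within S)"
    using has_derivative_compose has_derivative_norm[OF \<open>r s \<noteq> 0\<close>] by blast
  then have n: "((\<lambda>s. norm (r s)) has_real_derivative (r s \<bullet> r') / norm (r s)) (at s within S)"
    unfolding has_field_derivative_def
    by (rule has_derivative_eq_rhs) (auto simp: sgn_div_norm inner_commute divide_inverse mult_ac)
  have n0: "norm (r s) \<noteq> 0" using \<open>r s \<noteq> 0\<close> by simp
  have "- (inverse (norm (r s) ^ 3) * (of_nat 3 * ((r s \<bullet> r') / norm (r s) * norm (r s) ^ (3 - Suc 0))) * inverse (norm (r s) ^ 3))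
      = - 3 * (r s \<bullet> r') / norm (r s) ^ 5"
    using n0 by (simp add: field_simps eval_nat_numeral)
  then show ?thesis using DERIV_inverse'[OF DERIV_power[OF n, of 3] power_not_zero[OF n0]] by (simp only:)
qed

context c11_curve
begin

text \<open>The Biot--Savart integrand without the factor 1 / (4 pi), so that circulations are 4 pi
  times linking numbers.\<close>

definition bs :: "E3 \<Rightarrow> real \<Rightarrow> E3" where
  "bs x t = inverse (norm (x - \<gamma> t) ^ 3) *\<^sub>R cross3 (vel \<gamma> t) (x - \<gamma> t)"

text \<open>The derivative of \<open>bs\<close> with respect to the point x in the direction
  e.\<close>

definition bs' :: "E3 \<Rightarrow> E3 \<Rightarrow> real \<Rightarrow> E3" where
  "bs' x e t = inverse (norm (x - \<gamma> t) ^ 3) *\<^sub>R cross3 (vel \<gamma> t) e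
     - (3 * ((x - \<gamma> t) \<bullet> e) / norm (x - \<gamma> t) ^ 5) *\<^sub>R cross3 (vel \<gamma> t) (x - \<gamma> t)"

definition biot :: "E3 \<Rightarrow> E3" where "biot x = integral {0..1} (bs x)"

definition biot' :: "E3 \<Rightarrow> E3 \<Rightarrow> E3" where "biot' x e = integral {0..1} (bs' x e)"

text \<open>Circulation of the field along the straight segment from x to y; it becomes additive
  where the segments stay in a convex set off the curve.\<close>

definition seg :: "E3 \<Rightarrow> E3 \<Rightarrow> real" where
  "seg x y = integral {0..1} (\<lambda>t. biot (x + t *\<^sub>R (y - x)) \<bullet> (y - x))"

lemma open_off: "open (- range \<gamma>)"
proof -
  have "range \<gamma> = \<gamma> ` {0..1}"
  proof
    show "range \<gamma> \<subseteq> \<gamma> ` {0..1}"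
    proof clarify
      fix t
      have "\<gamma> t = \<gamma> (frac t)" using period[of "frac t" "\<lfloor>t\<rfloor>"] by (simp add: frac_def)
      then show "\<gamma> t \<in> \<gamma> ` {0..1}" by (auto intro!: image_eqI[of _ _ "frac t"] simp: frac_lt_1 less_imp_le)
    qed
  qed auto
  moreover have "compact (\<gamma> ` {0..1})" by (intro compact_continuous_image cont) auto
  ultimately show ?thesis by (simp add: compact_imp_closed open_Compl)
qed

lemma off_ne: "x \<in> - range \<gamma> \<Longrightarrow> x - \<gamma> t \<noteq> 0" by auto

lemma continuous_on_bs:
  assumes "continuous_on S f" "continuous_on S g" "f ` S \<subseteq> - range \<gamma>"
  shows "continuous_on S (\<lambda>s. bs (f s) (g s))"
proof -
  have "continuous_on S (\<lambda>s. \<gamma> (g s))" "continuous_on S (\<lambda>s. vel \<gamma> (g s))"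
    using continuous_on_compose2[OF cont[of UNIV] assms(2)] continuous_on_compose2[OF cont_vel[of UNIV] assms(2)] by auto
  moreover have "f s \<noteq> \<gamma> (g s)" if "s \<in> S" for s using assms(3) that by blast
  ultimately show ?thesis
    unfolding bs_def by (intro continuous_intros bounded_bilinear.continuous_on[OF bounded_bilinear_cross3] assms) auto
qed

lemma continuous_on_bs':
  assumes "continuous_on S f" "continuous_on S g" "f ` S \<subseteq> - range \<gamma>"
  shows "continuous_on S (\<lambda>s. bs' (f s) e (g s))"
proof -
  have "continuous_on S (\<lambda>s. \<gamma> (g s))" "continuous_on S (\<lambda>s. vel \<gamma> (g s))"
    using continuous_on_compose2[OF cont[of UNIV] assms(2)] continuous_on_compose2[OF cont_vel[of UNIV] assms(2)] by auto
  moreover have "f s \<noteq> \<gamma> (g s)" if "s \<in> S" for s using assms(3) that by blast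
  ultimately show ?thesis
    unfolding bs'_def by (intro continuous_intros bounded_bilinear.continuous_on[OF bounded_bilinear_cross3] assms) auto
qed

lemma bs_integrable: "x \<in> - range \<gamma> \<Longrightarrow> bs x integrable_on {a..b}"
  using continuous_on_bs[of "{a..b}" "\<lambda>_. x" "\<lambda>t. t"] by (auto intro!: integrable_continuous_real continuous_intros)

lemma bs'_integrable: "x \<in> - range \<gamma> \<Longrightarrow> bs' x e integrable_on {a..b}"
  using continuous_on_bs'[of "{a..b}" "\<lambda>_. x" "\<lambda>t. t"] by (auto intro!: integrable_continuous_real continuous_intros)

lemma continuous_on_biot: "continuous_on (- range \<gamma>) biot"
proof -
  have "continuous_on (- range \<gamma>) (\<lambda>x. integral (cbox 0 1) (bs x))"
    by (rule integral_continuous_on_param, unfold split_beta, rule continuous_on_bs) (auto intro!: continuous_intros)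
  then show ?thesis by (simp add: biot_def[abs_def])
qed

lemma continuous_on_biot_compose:
  assumes "continuous_on S f" "\<And>s. s \<in> S \<Longrightarrow> f s \<in> - range \<gamma>"
  shows "continuous_on S (\<lambda>s. biot (f s))"
  by (rule continuous_on_compose2[OF continuous_on_biot assms(1)]) (intro image_subsetI assms(2))

lemma continuous_on_biot': "continuous_on (- range \<gamma>) (\<lambda>x. biot' x e)"
proof -
  have "continuous_on (- range \<gamma>) (\<lambda>x. integral (cbox 0 1) (bs' x e))"
    by (rule integral_continuous_on_param, unfold split_beta, rule continuous_on_bs') (auto intro!: continuous_intros)
  then show ?thesis by (simp add: biot'_def)
qed

lemma biot'_scaleR: "biot' x (a *\<^sub>R e) = a *\<^sub>R biot' x e"
proof -
  have "bs' x (a *\<^sub>R e) = (\<lambda>t. a *\<^sub>R bs' x e t)"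
    by (simp add: bs'_def fun_eq_iff cross_mult_right algebra_simps)
  then show ?thesis by (simp add: biot'_def)
qed

text \<open>The field is curl-free because the antisymmetric part of the derivative of the integrand is the
  \<open>t\<close>-derivative of a periodic function.\<close>

lemma biot'_symmetric:
  assumes x: "x \<in> - range \<gamma>"
  shows "biot' x e \<bullet> w = biot' x w \<bullet> e"
proof -
  define k where "k t = inverse (norm (x - \<gamma> t) ^ 3) * ((x - \<gamma> t) \<bullet> cross3 e w)" for t
  have der: "(k has_real_derivative (bs' x e t \<bullet> w - bs' x w t \<bullet> e)) (at t within {0..1})" for t
  proof -
    define r where "r = x - \<gamma> t"
    define T where "T = vel \<gamma> t"
    have r0: "norm r \<noteq> 0" using off_ne[OF x] by (simp add: r_def)
    have rd: "((\<lambda>t. x - \<gamma> t) has_vector_derivative (- T)) (at t within {0..1})"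
      unfolding T_def by (auto intro!: derivative_eq_intros vd)
    have 1: "((\<lambda>t. (x - \<gamma> t) \<bullet> cross3 e w) has_real_derivative (- T \<bullet> cross3 e w)) (at t within {0..1})"
      unfolding has_real_derivative_iff_has_vector_derivative
      by (rule bounded_linear.has_vector_derivative[OF bounded_linear_inner_left rd])
    \<comment> \<open>The linear dependence of the four vectors r, T, e, w of three-space (Cramer's
      rule), paired with r. It trades the antisymmetric part for the triple products in the
      derivative of \<open>k\<close>.\<close>
    have id: "(norm r)\<^sup>2 * (T \<bullet> cross3 e w) = (r \<bullet> e) * (cross3 T r \<bullet> w) - (r \<bullet> w) * (cross3 T r \<bullet> e) + (r \<bullet> T) * (r \<bullet> cross3 e w)"
      unfolding power2_norm_eq_inner by (simp add: cross3_simps)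
    have sw: "cross3 T e \<bullet> w = T \<bullet> cross3 e w" "cross3 T w \<bullet> e = - (T \<bullet> cross3 e w)"
      by (simp_all add: cross3_simps)
    have "bs' x e t \<bullet> w - bs' x w t \<bullet> e = 2 * (T \<bullet> cross3 e w) / norm r ^ 3
        - 3 / norm r ^ 5 * ((r \<bullet> e) * (cross3 T r \<bullet> w) - (r \<bullet> w) * (cross3 T r \<bullet> e))"
      by (simp add: bs'_def r_def[symmetric] T_def[symmetric] inner_diff_left sw divide_inverse algebra_simps)
    also have "\<dots> = 2 * (T \<bullet> cross3 e w) / norm r ^ 3
        - 3 / norm r ^ 5 * ((norm r)\<^sup>2 * (T \<bullet> cross3 e w) - (r \<bullet> T) * (r \<bullet> cross3 e w))"
      using id by simp
    also have "\<dots> = inverse (norm r ^ 3) * (- T \<bullet> cross3 e w) + (- 3 * (r \<bullet> - T) / norm r ^ 5) * (r \<bullet> cross3 e w)"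
      using r0 by (simp add: field_simps power2_eq_square eval_nat_numeral)
    finally have eq: "bs' x e t \<bullet> w - bs' x w t \<bullet> e
       = (- 3 * (r \<bullet> - T) / norm r ^ 5) * (r \<bullet> cross3 e w) + (- T \<bullet> cross3 e w) * inverse (norm r ^ 3)" by simp
    show ?thesis
      unfolding k_def eq r_def
      by (rule DERIV_mult[OF inverse_norm_cubed_has_derivative[OF rd off_ne[OF x]] 1])
  qed
  have "((\<lambda>t. bs' x e t \<bullet> w - bs' x w t \<bullet> e) has_integral (k 1 - k 0)) {0..1}"
    by (rule fundamental_theorem_of_calculus) (use der in \<open>auto simp: has_real_derivative_iff_has_vector_derivative\<close>)
  moreover have "k 1 = k 0" using period[of 0 1] by (simp add: k_def)
  moreover have "((\<lambda>t. bs' x e t \<bullet> w - bs' x w t \<bullet> e) has_integral (biot' x e \<bullet> w - biot' x w \<bullet> e)) {0..1}"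
  proof -
    have "((\<lambda>t. bs' x e t \<bullet> w) has_integral (biot' x e \<bullet> w)) {0..1}" for e w
      using has_integral_linear[OF integrable_integral[OF bs'_integrable[OF x]] bounded_linear_inner_left]
      by (simp add: biot'_def o_def)
    from has_integral_diff[OF this this] show ?thesis .
  qed
  ultimately have "k 1 - k 0 = biot' x e \<bullet> w - biot' x w \<bullet> e" "k 1 = k 0"
    by (simp_all add: has_integral_unique)
  then show ?thesis by simp
qed

lemma biot_line:
  assumes "\<And>u. u \<in> {0..1} \<Longrightarrow> p + u *\<^sub>R e \<in> - range \<gamma>" "u \<in> {0..1}"
  shows "((\<lambda>u. biot (p + u *\<^sub>R e)) has_vector_derivative biot' (p + u *\<^sub>R e) e) (at u within {0..1})"
proof -
  have "((\<lambda>u. integral (cbox 0 1) (bs (p + u *\<^sub>R e))) has_vector_derivative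
      integral (cbox 0 1) (bs' (p + u *\<^sub>R e) e)) (at u within {0..1})"
  proof (rule leibniz_rule_vector_derivative)
    fix u t :: real assume u: "u \<in> {0..1}" "t \<in> cbox 0 1"
    have rd: "((\<lambda>u. p + u *\<^sub>R e - \<gamma> t) has_vector_derivative e) (at u within {0..1})"
      by (auto intro!: derivative_eq_intros)
    show "((\<lambda>u. bs (p + u *\<^sub>R e) t) has_vector_derivative bs' (p + u *\<^sub>R e) e t) (at u within {0..1})"
      unfolding bs_def
      by (rule has_vector_derivative_eq_rhs[OF has_vector_derivative_scaleR[OF
            inverse_norm_cubed_has_derivative[OF rd off_ne[OF assms(1)[OF u(1)]]]
            bounded_linear.has_vector_derivative[OF bounded_bilinear.bounded_linear_right[OF bounded_bilinear_cross3] rd]]])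
        (simp add: bs'_def)
  next
    show "bs (p + u *\<^sub>R e) integrable_on cbox 0 1" if "u \<in> {0..1}" for u
      using bs_integrable assms(1) that by simp
    show "continuous_on ({0..1} \<times> cbox 0 1) (\<lambda>(u, t). bs' (p + u *\<^sub>R e) e t)"
      unfolding split_beta
    proof (rule continuous_on_bs')
      show "(\<lambda>z. p + fst z *\<^sub>R e) ` ({0..1} \<times> cbox 0 1) \<subseteq> - range \<gamma>"
        by (intro image_subsetI assms(1)) auto
    qed (intro continuous_intros)+
  qed (use assms in auto)
  then show ?thesis by (simp add: biot_def[abs_def] biot'_def)
qed

text \<open>The Poincare lemma on a triangle: as the far end of a segment from x moves from y to z,
  the circulation along the segment changes at the rate given by the field at the moving
  end.\<close>

lemma seg_triangle:
  assumes V: "convex V" "V \<subseteq> - range \<gamma>" and xyz: "x \<in> V" "y \<in> V" "z \<in> V"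
  shows "seg x y + seg y z = seg x z"
proof -
  define e where "e = z - y"
  \<comment> \<open>For fixed u this is the segment from x to the point y + u e of the opposite
    side.\<close>
  define Y where "Y u l = x + l *\<^sub>R (y - x) + (u * l) *\<^sub>R e" for u l
  have Y: "Y u l \<in> - range \<gamma>" if "u \<in> {0..1}" "l \<in> {0..1}" for u l
  proof -
    have "(1 - u) *\<^sub>R y + u *\<^sub>R z \<in> V" using that xyz by (intro convexD[OF V(1)]) auto
    then have "(1 - l) *\<^sub>R x + l *\<^sub>R ((1 - u) *\<^sub>R y + u *\<^sub>R z) \<in> V" using that xyz by (intro convexD[OF V(1)]) auto
    moreover have "(1 - l) *\<^sub>R x + l *\<^sub>R ((1 - u) *\<^sub>R y + u *\<^sub>R z) = Y u l"
      by (simp add: Y_def e_def algebra_simps)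
    ultimately show ?thesis using V(2) by auto
  qed
  have contY: "continuous_on S (\<lambda>w. Y (g w) (h w))" if "continuous_on S g" "continuous_on S h" for S :: "'b::topological_space set" and g h
    unfolding Y_def by (intro continuous_intros that)
  define f where "f u l = biot (Y u l) \<bullet> (y - x + u *\<^sub>R e)" for u l
  define f' where "f' u l = l * (biot' (Y u l) e \<bullet> (y - x + u *\<^sub>R e)) + biot (Y u l) \<bullet> e" for u l
  have du: "((\<lambda>u. f u l) has_vector_derivative f' u l) (at u within {0..1})"
    if "u \<in> {0..1}" "l \<in> {0..1}" for u l
  proof -
    define p where "p = x + l *\<^sub>R (y - x)"
    have Ye: "Y u l = p + u *\<^sub>R (l *\<^sub>R e)" for u by (simp add: Y_def p_def)
    have "((\<lambda>u. biot (p + u *\<^sub>R (l *\<^sub>R e))) has_vector_derivative biot' (p + u *\<^sub>R (l *\<^sub>R e)) (l *\<^sub>R e)) (at u within {0..1})"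
    proof (rule biot_line[OF _ that(1)])
      fix u :: real assume "u \<in> {0..1}"
      then show "p + u *\<^sub>R (l *\<^sub>R e) \<in> - range \<gamma>" using Y[OF _ that(2), of u] by (simp only: Ye)
    qed
    then have "((\<lambda>u. biot (Y u l)) has_vector_derivative l *\<^sub>R biot' (Y u l) e) (at u within {0..1})"
      by (simp only: Ye biot'_scaleR)
    moreover have "((\<lambda>u. y - x + u *\<^sub>R e) has_vector_derivative e) (at u within {0..1})"
      by (auto intro!: derivative_eq_intros)
    ultimately show ?thesis
      unfolding f_def
      by (rule has_vector_derivative_eq_rhs[OF bounded_bilinear.has_vector_derivative[OF bounded_bilinear_inner]])
        (simp add: f'_def)
  qed
  have G: "((\<lambda>u. integral (cbox 0 1) (f u)) has_vector_derivative integral (cbox 0 1) (f' u)) (at u within {0..1})"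
    if "u \<in> {0..1}" for u
  proof (rule leibniz_rule_vector_derivative[OF du _ _ that])
    have img: "(\<lambda>w. Y (fst w) (snd w)) ` ({0..1} \<times> cbox 0 1) \<subseteq> - range \<gamma>"
      by (intro image_subsetI Y) auto
    have cf: "continuous_on ({0..1} \<times> cbox 0 1) (\<lambda>w. biot (Y (fst w) (snd w)))"
      "continuous_on ({0..1} \<times> cbox 0 1) (\<lambda>w. biot' (Y (fst w) (snd w)) e)"
      by (rule continuous_on_compose2[OF continuous_on_biot _ img] continuous_on_compose2[OF continuous_on_biot' _ img],
          intro contY continuous_intros)+
    then show "continuous_on ({0..1} \<times> cbox 0 1) (\<lambda>(u, l). f' u l)"
      unfolding f'_def split_beta by (intro continuous_intros)
    show "f u integrable_on cbox 0 1" if u: "u \<in> {0..1}" for u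
    proof (rule integrable_continuous)
      have "continuous_on (cbox 0 1) (\<lambda>l. biot (Y u l))"
        by (rule continuous_on_biot_compose) (intro contY continuous_intros, intro Y u, simp)
      then show "continuous_on (cbox 0 1) (f u)" unfolding f_def by (intro continuous_intros)
    qed
  qed auto
  \<comment> \<open>Symmetry of the derivative of the field makes \<open>f' u\<close> a total
    derivative in l, namely that of l times the component of the field along e; only its value at l
    = 1 remains.\<close>
  have inner: "integral {0..1} (f' u) = biot (y + u *\<^sub>R e) \<bullet> e" if u: "u \<in> {0..1}" for u
  proof -
    define w where "w = y - x + u *\<^sub>R e"
    have Yw: "Y u l = x + l *\<^sub>R w" for l by (simp add: Y_def w_def algebra_simps)
    have "((\<lambda>l. l * (biot (Y u l) \<bullet> e)) has_vector_derivative f' u l) (at l within {0..1})" if l: "l \<in> {0..1}" for l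
    proof -
      have "((\<lambda>l. biot (x + l *\<^sub>R w)) has_vector_derivative biot' (x + l *\<^sub>R w) w) (at l within {0..1})"
      proof (rule biot_line[OF _ l])
        fix l :: real assume "l \<in> {0..1}"
        then show "x + l *\<^sub>R w \<in> - range \<gamma>" using Y[OF u, of l] by (simp only: Yw)
      qed
      then have "((\<lambda>l. biot (Y u l)) has_vector_derivative biot' (Y u l) w) (at l within {0..1})"
        by (simp only: Yw)
      then have 1: "((\<lambda>l. biot (Y u l) \<bullet> e) has_real_derivative biot' (Y u l) w \<bullet> e) (at l within {0..1})"
        unfolding has_real_derivative_iff_has_vector_derivative
        by (rule bounded_linear.has_vector_derivative[OF bounded_linear_inner_left])
      have "f' u l = 1 * (biot (Y u l) \<bullet> e) + (biot' (Y u l) w \<bullet> e) * l"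
        by (simp add: f'_def w_def[symmetric] biot'_symmetric[OF Y[OF u l], of e w])
      then show ?thesis
        unfolding has_real_derivative_iff_has_vector_derivative[symmetric]
        using DERIV_mult[OF DERIV_ident 1] by simp
    qed
    then have "(f' u has_integral (1 * (biot (Y u 1) \<bullet> e) - 0 * (biot (Y u 0) \<bullet> e))) {0..1}"
      by (intro fundamental_theorem_of_calculus) auto
    moreover have "Y u 1 = y + u *\<^sub>R e" by (simp add: Y_def)
    ultimately show ?thesis by (simp add: integral_unique)
  qed
  have "((\<lambda>u. biot (y + u *\<^sub>R e) \<bullet> e) has_integral (integral {0..1} (f 1) - integral {0..1} (f 0))) {0..1}"
    by (rule fundamental_theorem_of_calculus) (use G inner in auto)
  then have "seg y z = integral {0..1} (f 1) - integral {0..1} (f 0)"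
    by (simp add: seg_def e_def integral_unique)
  moreover have "f 0 = (\<lambda>l. biot (x + l *\<^sub>R (y - x)) \<bullet> (y - x))" "f 1 = (\<lambda>l. biot (x + l *\<^sub>R (z - x)) \<bullet> (z - x))"
    by (simp_all add: f_def Y_def e_def fun_eq_iff algebra_simps)
  ultimately show ?thesis by (simp add: seg_def)
qed

lemma cocycle_seg: "cocycle_on (- range \<gamma>) seg"
  unfolding cocycle_on_def
proof
  fix x assume "x \<in> - range \<gamma>"
  then obtain d where d: "0 < d" "ball x d \<subseteq> - range \<gamma>" using open_off open_contains_ball by blast
  then show "\<exists>d>0. \<forall>a\<in>- range \<gamma> \<inter> ball x d. \<forall>b\<in>- range \<gamma> \<inter> ball x d. \<forall>c\<in>- range \<gamma> \<inter> ball x d. seg a b + seg b c = seg a c"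
    using seg_triangle[OF convex_ball d(2)] by (intro exI[of _ d]) auto
qed

lemma seg_first_order:
  assumes x: "x \<in> - range \<gamma>" and "0 < e"
  obtains d where "0 < d" "\<And>y. norm (y - x) < d \<Longrightarrow> norm (seg x y - biot x \<bullet> (y - x)) \<le> e * norm (y - x)"
proof -
  obtain d0 where d0: "0 < d0" "ball x d0 \<subseteq> - range \<gamma>" using x open_off open_contains_ball by blast
  have "isCont biot x" using continuous_on_biot x open_off by (simp add: continuous_on_eq_continuous_at)
  then obtain d1 where d1: "0 < d1" "\<And>y. dist y x < d1 \<Longrightarrow> dist (biot y) (biot x) < e"
    using \<open>0 < e\<close> unfolding continuous_at_eps_delta by metis
  show ?thesis
  proof (rule that[of "min d0 d1"])
    fix y assume y: "norm (y - x) < min d0 d1"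
    have near: "norm (t *\<^sub>R (y - x)) < min d0 d1" if "t \<in> {0..1}" for t
    proof -
      have "norm (t *\<^sub>R (y - x)) \<le> 1 * norm (y - x)" unfolding norm_scaleR using that by (intro mult_right_mono) auto
      then show ?thesis using y by simp
    qed
    have inU: "x + t *\<^sub>R (y - x) \<in> - range \<gamma>" if "t \<in> {0..1}" for t
    proof -
      have "x + t *\<^sub>R (y - x) \<in> ball x d0" using near[OF that] by (simp add: dist_norm)
      then show ?thesis using d0(2) by blast
    qed
    have c: "continuous_on {0..1} (\<lambda>t. biot (x + t *\<^sub>R (y - x)))"
      by (rule continuous_on_biot_compose) (intro continuous_intros, rule inU)
    have "((\<lambda>t. biot (x + t *\<^sub>R (y - x)) \<bullet> (y - x) - biot x \<bullet> (y - x)) has_integral (seg x y - biot x \<bullet> (y - x))) {0..1}"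
    proof -
      have "(\<lambda>t. biot (x + t *\<^sub>R (y - x)) \<bullet> (y - x)) integrable_on {0..1}"
        by (intro integrable_continuous_real continuous_on_inner c continuous_on_const)
      from has_integral_diff[OF integrable_integral[OF this] has_integral_const_real[of "biot x \<bullet> (y - x)" 0 1]]
      show ?thesis by (simp add: seg_def)
    qed
    moreover have "norm (biot (x + t *\<^sub>R (y - x)) \<bullet> (y - x) - biot x \<bullet> (y - x)) \<le> e * norm (y - x)" if "t \<in> {0..1}" for t
    proof -
      have "dist (biot (x + t *\<^sub>R (y - x))) (biot x) < e" using near[OF that] by (intro d1(2)) (simp add: dist_norm)
      then have "norm (biot (x + t *\<^sub>R (y - x)) - biot x) * norm (y - x) \<le> e * norm (y - x)"
        by (intro mult_right_mono) (auto simp: dist_norm)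
      then show ?thesis unfolding inner_diff_left[symmetric] real_norm_def
        using Cauchy_Schwarz_ineq2 order_trans by blast
    qed
    ultimately have "norm (seg x y - biot x \<bullet> (y - x)) \<le> (e * norm (y - x)) * measure lborel {0..1::real}"
      using \<open>0 < e\<close> by (intro has_integral_bound_real[of _ "{}"]) auto
    then show "norm (seg x y - biot x \<bullet> (y - x)) \<le> e * norm (y - x)" by simp
  qed (use d0 d1 in auto)
qed

text \<open>On a convex set the triangle relation reduces an increment of \<open>seg a\<close> to
  the circulation along a short segment, so \<open>seg a\<close> is a potential of the
  field.\<close>

lemma seg_has_derivative:
  assumes V: "convex V" "open V" "V \<subseteq> - range \<gamma>" and "a \<in> V" "x \<in> V"
  shows "(seg a has_derivative (\<lambda>h. biot x \<bullet> h)) (at x)"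
  unfolding has_derivative_at_alt
proof (intro conjI allI impI)
  show "bounded_linear (\<lambda>h. biot x \<bullet> h)" by (rule bounded_linear_inner_right)
  fix e :: real assume "0 < e"
  obtain d where d: "0 < d" "\<And>y. norm (y - x) < d \<Longrightarrow> norm (seg x y - biot x \<bullet> (y - x)) \<le> e * norm (y - x)"
    using seg_first_order[of x e] assms \<open>0 < e\<close> by blast
  obtain d' where d': "0 < d'" "ball x d' \<subseteq> V" using assms open_contains_ball by blast
  show "\<exists>d>0. \<forall>y. norm (y - x) < d \<longrightarrow> norm (seg a y - seg a x - biot x \<bullet> (y - x)) \<le> e * norm (y - x)"
  proof (intro exI[of _ "min d d'"] conjI allI impI)
    fix y assume y: "norm (y - x) < min d d'"
    then have "y \<in> ball x d'" by (simp add: dist_norm norm_minus_commute)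
    then have "y \<in> V" using d'(2) by blast
    then have "seg a y - seg a x = seg x y" using seg_triangle[OF V(1,3) assms(4,5), of y] by simp
    then show "norm (seg a y - seg a x - biot x \<bullet> (y - x)) \<le> e * norm (y - x)" using d(2) y by simp
  qed (use d d' in auto)
qed

text \<open>Near each point \<open>seg\<close> from a fixed point is a potential, so by the chain
  rule the indefinite line integral has the increments of the cocycle.\<close>

lemma cvar_seg:
  assumes der: "\<And>s. s \<in> {0..1} \<Longrightarrow> (\<alpha> has_vector_derivative \<alpha>' s) (at s within {0..1})"
    and c: "continuous_on {0..1} \<alpha>'" and off: "\<And>s. s \<in> {0..1} \<Longrightarrow> \<alpha> s \<in> - range \<gamma>"
  shows "cvar seg \<alpha> = integral {0..1} (\<lambda>s. biot (\<alpha> s) \<bullet> \<alpha>' s)"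
proof -
  define w where "w s = biot (\<alpha> s) \<bullet> \<alpha>' s" for s
  have c\<alpha>: "continuous_on {0..1} \<alpha>"
    using der has_vector_derivative_continuous unfolding continuous_on_eq_continuous_within by blast
  have cw: "continuous_on {0..1} w"
    unfolding w_def by (intro continuous_on_inner c continuous_on_biot_compose[OF c\<alpha>] off)
  have "primitive_along seg \<alpha> {0..1} (\<lambda>s. integral {0..s} w)"
    unfolding primitive_along_def
  proof
    fix s :: real assume s: "s \<in> {0..1}"
    obtain e where e: "0 < e" "ball (\<alpha> s) e \<subseteq> - range \<gamma>" using off[OF s] open_off open_contains_ball by blast
    obtain d where d: "0 < d" "\<And>t. t \<in> {0..1} \<Longrightarrow> dist t s < d \<Longrightarrow> dist (\<alpha> t) (\<alpha> s) < e"
      using c\<alpha> s e(1) unfolding continuous_on_iff by metis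
    have inB: "\<alpha> t \<in> ball (\<alpha> s) e" if "t \<in> {0..1} \<inter> ball s d" for t
      using d(2)[of t] that by (simp add: dist_commute)
    have le: "integral {0..z} w - integral {0..y} w = seg (\<alpha> y) (\<alpha> z)"
      if yz: "y \<in> {0..1} \<inter> ball s d" "z \<in> {0..1} \<inter> ball s d" "y \<le> z" for y z
    proof -
      have sub: "{y..z} \<subseteq> {0..1} \<inter> ball s d"
        using yz by (auto simp: dist_real_def)
      have "(w has_integral (seg (\<alpha> y) (\<alpha> z) - seg (\<alpha> y) (\<alpha> y))) {y..z}"
      proof (rule fundamental_theorem_of_calculus[OF yz(3)])
        fix t assume t: "t \<in> {y..z}"
        then have t01: "t \<in> {0..1}" using sub by auto
        have "(\<alpha> has_derivative (\<lambda>h. h *\<^sub>R \<alpha>' t)) (at t within {y..z})"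
          using der[OF t01] has_vector_derivative_within_subset sub unfolding has_vector_derivative_def[symmetric] by blast
        moreover have "(seg (\<alpha> y) has_derivative (\<lambda>h. biot (\<alpha> t) \<bullet> h)) (at (\<alpha> t))"
          using seg_has_derivative[OF convex_ball open_ball e(2)] inB yz(1) t sub by blast
        ultimately have "((\<lambda>t. seg (\<alpha> y) (\<alpha> t)) has_derivative (\<lambda>h. biot (\<alpha> t) \<bullet> (h *\<^sub>R \<alpha>' t))) (at t within {y..z})"
          by (rule has_derivative_compose)
        then show "((\<lambda>t. seg (\<alpha> y) (\<alpha> t)) has_vector_derivative w t) (at t within {y..z})"
          by (simp add: has_vector_derivative_def w_def)
      qed
      moreover have "seg (\<alpha> y) (\<alpha> y) = 0" by (simp add: seg_def)
      moreover have "integral {0..y} w + integral {y..z} w = integral {0..z} w"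
        using yz cw by (intro Henstock_Kurzweil_Integration.integral_combine integrable_continuous_real continuous_on_subset[OF cw]) auto
      ultimately show ?thesis by (simp add: integral_unique)
    qed
    have "integral {0..z} w - integral {0..y} w = seg (\<alpha> y) (\<alpha> z)"
      if yz: "y \<in> {0..1} \<inter> ball s d" "z \<in> {0..1} \<inter> ball s d" for y z
    proof (cases "y \<le> z")
      case False
      have "seg (\<alpha> y) (\<alpha> z) + seg (\<alpha> z) (\<alpha> y) = seg (\<alpha> y) (\<alpha> y)"
        by (rule seg_triangle[OF convex_ball e(2)]) (use inB yz in auto)
      moreover have "seg (\<alpha> y) (\<alpha> y) = 0" by (simp add: seg_def)
      ultimately show ?thesis using le[OF yz(2,1)] False by simp
    qed (use le yz in auto)
    then show "\<exists>d>0. \<forall>y\<in>{0..1} \<inter> ball s d. \<forall>z\<in>{0..1} \<inter> ball s d.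
        integral {0..z} w - integral {0..y} w = seg (\<alpha> y) (\<alpha> z)"
      using d(1) by blast
  qed
  from cvar_eq[OF this] show ?thesis by (simp add: w_def[abs_def])
qed

lemma cvar_seg_lk:
  assumes "closed_curve \<beta>" "range \<beta> \<subseteq> - range \<gamma>"
  shows "cvar seg \<beta> = 4 * pi * lk \<beta> \<gamma>"
proof -
  define k where "k z = ((\<beta> (fst z) - \<gamma> (snd z)) \<bullet> cross3 (vel \<beta> (fst z)) (vel \<gamma> (snd z))) / norm (\<beta> (fst z) - \<gamma> (snd z)) ^ 3" for z
  \<comment> \<open>A cyclic permutation of the triple product identifies the Gauss integrand with
    the field integrand paired with the velocity of \<beta>.\<close>
  have kbs: "k (s, t) = bs (\<beta> s) t \<bullet> vel \<beta> s" for s t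
    by (simp add: k_def bs_def divide_inverse cross3_simps)
  have off: "\<beta> s \<in> - range \<gamma>" for s using assms(2) by auto
  have cb: "continuous_on S (\<lambda>z. \<beta> (fst z))" "continuous_on S (\<lambda>z. vel \<beta> (fst z))" for S :: "(real \<times> real) set"
    using continuous_on_compose2[OF closed_curve_continuous[OF assms(1), of UNIV], of S fst]
      continuous_on_compose2[OF closed_curve_continuous_vel[OF assms(1), of UNIV], of S fst]
      continuous_on_fst[OF continuous_on_id, of S] by auto
  have "continuous_on (cbox (0,0) (1,1)) (\<lambda>z. bs (\<beta> (fst z)) (snd z) \<bullet> vel \<beta> (fst z))"
    by (intro continuous_intros continuous_on_bs cb) (use off in auto)
  then have ck: "continuous_on (cbox (0,0) (1,1)) k" by (simp add: kbs[symmetric])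
  have "{0..1} \<times> {0..1} = cbox (0 :: real, 0 :: real) (1, 1)" by (auto simp: cbox_Pair_eq)
  then have "4 * pi * lk \<beta> \<gamma> = integral (cbox (0,0) (1,1)) k"
    by (simp add: lk_def gauss_integral_def k_def[abs_def] case_prod_unfold)
  also have "\<dots> = integral (cbox 0 1) (\<lambda>s. integral (cbox 0 1) (\<lambda>t. k (s, t)))"
    by (rule integral_prod_continuous[OF ck])
  also have "\<dots> = integral {0..1} (\<lambda>s. biot (\<beta> s) \<bullet> vel \<beta> s)"
  proof -
    have "integral {0..1} (\<lambda>t. bs (\<beta> s) t \<bullet> vel \<beta> s) = biot (\<beta> s) \<bullet> vel \<beta> s" for s
      unfolding biot_def
      by (rule integral_linear[OF bs_integrable[OF off] bounded_linear_inner_left, unfolded o_def])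
    then show ?thesis by (simp add: kbs)
  qed
  also have "\<dots> = cvar seg \<beta>"
    by (rule cvar_seg[symmetric])
      (use assms off closed_curve_has_vector_derivative closed_curve_continuous_vel in auto)
  finally show ?thesis by simp
qed

end

section \<open>The Gauss kernel of a push-off\<close>

lemma inverse_cube_diff:
  fixes r s :: real assumes "0 < r" "0 < s"
  shows "\<bar>1 / r ^ 3 - 1 / s ^ 3\<bar> \<le> \<bar>r - s\<bar> * (r + s)\<^sup>2 / (r ^ 3 * s ^ 3)"
proof -
  have "1 / r ^ 3 - 1 / s ^ 3 = (s - r) * (s\<^sup>2 + s * r + r\<^sup>2) / (r ^ 3 * s ^ 3)"
    using assms by (simp add: field_simps power2_eq_square power3_eq_cube)
  then have "\<bar>1 / r ^ 3 - 1 / s ^ 3\<bar> = \<bar>r - s\<bar> * (s\<^sup>2 + s * r + r\<^sup>2) / (r ^ 3 * s ^ 3)"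
    using assms by (simp add: abs_mult abs_minus_commute)
  also have "\<dots> \<le> \<bar>r - s\<bar> * (r + s)\<^sup>2 / (r ^ 3 * s ^ 3)"
    using assms by (intro divide_right_mono mult_left_mono) (auto simp: power2_sum)
  finally show ?thesis .
qed

text \<open>The squared distances are polynomials in the data, so it is their difference that can be
  estimated; one factor r + s is spent on forming it.\<close>

lemma inverse_cube_diff_lower:
  fixes r s K :: real assumes "0 < K" "K \<le> r" "K \<le> s"
  shows "\<bar>1 / r ^ 3 - 1 / s ^ 3\<bar> \<le> 2 * \<bar>r\<^sup>2 - s\<^sup>2\<bar> / K ^ 5"
proof -
  have pos: "0 < r" "0 < s" using assms by auto
  have "\<bar>1 / r ^ 3 - 1 / s ^ 3\<bar> \<le> \<bar>r - s\<bar> * (r + s)\<^sup>2 / (r ^ 3 * s ^ 3)"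
    by (rule inverse_cube_diff[OF pos])
  also have "\<bar>r - s\<bar> * (r + s)\<^sup>2 = \<bar>r\<^sup>2 - s\<^sup>2\<bar> * (r + s)"
    using pos by (simp add: power2_eq_square square_diff_square_factored abs_mult)
  also have "\<bar>r\<^sup>2 - s\<^sup>2\<bar> * (r + s) / (r ^ 3 * s ^ 3) = \<bar>r\<^sup>2 - s\<^sup>2\<bar> * (1 / (r\<^sup>2 * s ^ 3) + 1 / (r ^ 3 * s\<^sup>2))"
    using pos by (simp add: field_simps power2_eq_square power3_eq_cube)
  also have "\<dots> \<le> \<bar>r\<^sup>2 - s\<^sup>2\<bar> * (1 / (K\<^sup>2 * K ^ 3) + 1 / (K ^ 3 * K\<^sup>2))"
    using assms pos by (intro mult_left_mono add_mono divide_left_mono mult_mono power_mono) auto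
  also have "\<dots> = 2 * \<bar>r\<^sup>2 - s\<^sup>2\<bar> / K ^ 5" by (simp flip: power_add)
  finally show ?thesis .
qed

text \<open>Here b, the chord of the curve itself, may tend to 0 with w while r stays above k D. The
  weight w^3, which the Gauss numerator supplies, compensates for the singularity of 1 /
  b^3.\<close>

lemma cube_times_inverse_cube_diff:
  fixes r b w D k e :: real
  assumes "0 < D" "0 < k" "0 \<le> w" "w \<le> D" "k * D \<le> r" "k * w \<le> b" "\<bar>r - b\<bar> \<le> 2 * e"
  shows "w ^ 3 * \<bar>1 / r ^ 3 - 1 / b ^ 3\<bar> \<le> 8 / k ^ 4 * (e / D)"
proof (cases "w = 0")
  case True
  then show ?thesis using assms by auto
next
  case False
  then have w: "0 < w" using assms by simp
  have pos: "0 < k * D" "0 < k * w" "0 < r" "0 < b" using assms w by (auto intro: less_le_trans[of _ "k * D"] less_le_trans[of _ "k * w"])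
  have "\<bar>1 / r ^ 3 - 1 / b ^ 3\<bar> \<le> \<bar>r - b\<bar> * (r + b)\<^sup>2 / (r ^ 3 * b ^ 3)"
    by (rule inverse_cube_diff) (use pos in auto)
  also have "\<dots> \<le> 2 * e * (2 * (r\<^sup>2 + b\<^sup>2)) / (r ^ 3 * b ^ 3)"
    using pos assms sum_squares_ge_zero[of "r - b" 0]
    by (intro divide_right_mono mult_mono) (auto simp: power2_eq_square algebra_simps)
  also have "\<dots> = 4 * e * (1 / (r * b ^ 3) + 1 / (r ^ 3 * b))"
    using pos by (simp add: field_simps power2_eq_square power3_eq_cube)
  also have "\<dots> \<le> 4 * e * (1 / (k * D * (k * w) ^ 3) + 1 / ((k * D) ^ 3 * (k * w)))"
    using pos assms by (intro mult_left_mono add_mono divide_left_mono mult_mono power_mono) auto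
  finally have "w ^ 3 * \<bar>1 / r ^ 3 - 1 / b ^ 3\<bar>
      \<le> w ^ 3 * (4 * e * (1 / (k * D * (k * w) ^ 3) + 1 / ((k * D) ^ 3 * (k * w))))"
    using w by (intro mult_left_mono) auto
  also have "\<dots> = 4 * e / k ^ 4 * (1 / D + w\<^sup>2 / D ^ 3)"
    using w assms by (simp add: field_simps power2_eq_square eval_nat_numeral)
  also have "\<dots> \<le> 4 * e / k ^ 4 * (1 / D + D\<^sup>2 / D ^ 3)"
    using w assms by (intro mult_left_mono add_left_mono divide_right_mono power_mono) auto
  also have "\<dots> = 8 / k ^ 4 * (e / D)" using assms by (simp add: field_simps power2_eq_square power3_eq_cube)
  finally show ?thesis .
qed

lemma triple_le: "\<bar>x \<bullet> cross3 y z\<bar> \<le> norm x * (norm y * norm z)"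
proof -
  have "\<bar>x \<bullet> cross3 y z\<bar> \<le> norm x * norm (cross3 y z)" by (rule Cauchy_Schwarz_ineq2)
  also have "\<dots> \<le> norm x * (norm y * norm z)" by (intro mult_left_mono norm_cross3_le) simp
  finally show ?thesis .
qed

context c11_curve
begin

text \<open>The chord is nearly tangent and V nearly normal, so their cross term is small and is
  absorbed, by 2 \<epsilon> |u| \<le> \<epsilon>^2 + u^2, into parts of c^2 u^2 and of \<epsilon>^2
  |V|^2. Both signs of \<epsilon> are covered.\<close>

lemma push_off_norm:
  assumes u: "\<bar>u\<bar> \<le> 1 / 2" and V: "\<bar>V \<bullet> vel \<gamma> a\<bar> \<le> \<delta>" "\<bar>(norm V)\<^sup>2 - 1\<bar> \<le> \<delta>"
    and d: "0 < \<epsilon>" "4 * M * \<epsilon> \<le> c\<^sup>2 / 4" "0 \<le> \<delta>" "\<delta> \<le> c\<^sup>2 / 4" "\<delta> \<le> 1 / 4"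
  shows "\<bar>(\<gamma> a - \<gamma> (a + u)) \<bullet> V\<bar> \<le> \<delta> * \<bar>u\<bar> + 2 * M * u\<^sup>2"
    and "c\<^sup>2 / 2 * u\<^sup>2 + \<epsilon>\<^sup>2 / 4 \<le> (norm (\<gamma> a - \<gamma> (a + u) + \<epsilon> *\<^sub>R V))\<^sup>2"
    and "c\<^sup>2 / 2 * u\<^sup>2 + \<epsilon>\<^sup>2 / 4 \<le> (norm (\<gamma> a - \<gamma> (a + u) - \<epsilon> *\<^sub>R V))\<^sup>2"
    and "norm V \<le> 2"
proof -
  define \<Delta> where "\<Delta> = \<gamma> a - \<gamma> (a + u)"
  have "(norm V)\<^sup>2 \<le> 2\<^sup>2" using V(2) d by (simp add: abs_le_iff)
  then show nV: "norm V \<le> 2" by (rule power2_le_imp_le) simp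
  have "norm (\<Delta> + u *\<^sub>R vel \<gamma> a) \<le> M * u\<^sup>2"
    using taylor[of "a + u" a] by (simp add: \<Delta>_def norm_minus_commute algebra_simps)
  then have "\<bar>(\<Delta> + u *\<^sub>R vel \<gamma> a) \<bullet> V\<bar> \<le> M * u\<^sup>2 * 2"
    using nV M_nonneg by (intro order_trans[OF Cauchy_Schwarz_ineq2] mult_mono) auto
  moreover have "\<Delta> \<bullet> V = (\<Delta> + u *\<^sub>R vel \<gamma> a) \<bullet> V - u * (V \<bullet> vel \<gamma> a)"
    by (simp add: inner_add_left inner_commute[of "vel \<gamma> a" V])
  moreover have "\<bar>u * (V \<bullet> vel \<gamma> a)\<bar> \<le> \<delta> * \<bar>u\<bar>"
    using V(1) unfolding abs_mult mult.commute[of "\<bar>u\<bar>"] by (intro mult_right_mono) auto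
  ultimately have dV: "\<bar>\<Delta> \<bullet> V\<bar> \<le> \<delta> * \<bar>u\<bar> + 2 * M * u\<^sup>2" by linarith
  then show "\<bar>(\<gamma> a - \<gamma> (a + u)) \<bullet> V\<bar> \<le> \<delta> * \<bar>u\<bar> + 2 * M * u\<^sup>2" by (simp add: \<Delta>_def)
  have "c * \<bar>u\<bar> \<le> norm \<Delta>" using chord[of a "a + u"] u by (simp add: \<Delta>_def)
  then have "(c * \<bar>u\<bar>)\<^sup>2 \<le> (norm \<Delta>)\<^sup>2" using c_pos by (intro power_mono) auto
  then have D2: "c\<^sup>2 * u\<^sup>2 \<le> \<Delta> \<bullet> \<Delta>" by (simp add: power_mult_distrib power2_norm_eq_inner)
  have "2 * \<epsilon> * \<bar>\<Delta> \<bullet> V\<bar> \<le> 2 * \<epsilon> * (\<delta> * \<bar>u\<bar> + 2 * M * u\<^sup>2)" using dV d by (intro mult_left_mono) auto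
  also have "\<dots> = \<delta> * (2 * \<epsilon> * \<bar>u\<bar>) + 4 * M * \<epsilon> * u\<^sup>2" by (simp add: algebra_simps)
  also have "\<dots> \<le> \<delta> * (\<epsilon>\<^sup>2 + u\<^sup>2) + c\<^sup>2 / 4 * u\<^sup>2"
  proof (intro add_mono mult_left_mono mult_right_mono)
    have "0 \<le> (\<epsilon> - \<bar>u\<bar>)\<^sup>2" by simp
    then show "2 * \<epsilon> * \<bar>u\<bar> \<le> \<epsilon>\<^sup>2 + u\<^sup>2" by (simp add: power2_diff)
  qed (use d in auto)
  also have "\<dots> \<le> \<epsilon>\<^sup>2 / 4 + c\<^sup>2 / 4 * u\<^sup>2 + c\<^sup>2 / 4 * u\<^sup>2"
    using mult_right_mono[OF d(4), of "u\<^sup>2"] mult_right_mono[OF d(5), of "\<epsilon>\<^sup>2"] by (simp add: algebra_simps)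
  finally have cr: "2 * \<epsilon> * \<bar>\<Delta> \<bullet> V\<bar> \<le> \<epsilon>\<^sup>2 / 4 + c\<^sup>2 / 2 * u\<^sup>2" by simp
  have "3 / 4 \<le> V \<bullet> V" using V(2) d by (simp add: power2_norm_eq_inner abs_le_iff)
  then have V2: "3 / 4 * \<epsilon>\<^sup>2 \<le> \<epsilon>\<^sup>2 * (V \<bullet> V)" using mult_right_mono[of "3/4" "V \<bullet> V" "\<epsilon>\<^sup>2"] by (simp add: mult.commute)
  have exp: "(norm (\<Delta> + \<epsilon> *\<^sub>R V))\<^sup>2 = \<Delta> \<bullet> \<Delta> + 2 * \<epsilon> * (\<Delta> \<bullet> V) + \<epsilon>\<^sup>2 * (V \<bullet> V)"
    "(norm (\<Delta> - \<epsilon> *\<^sub>R V))\<^sup>2 = \<Delta> \<bullet> \<Delta> - 2 * \<epsilon> * (\<Delta> \<bullet> V) + \<epsilon>\<^sup>2 * (V \<bullet> V)"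
    unfolding power2_norm_eq_inner
    by (simp_all add: inner_add_left inner_add_right inner_diff_left inner_diff_right inner_commute[of V \<Delta>]
        power2_eq_square algebra_simps)
  have ab: "- (2 * \<epsilon> * \<bar>\<Delta> \<bullet> V\<bar>) \<le> 2 * \<epsilon> * (\<Delta> \<bullet> V)" "2 * \<epsilon> * (\<Delta> \<bullet> V) \<le> 2 * \<epsilon> * \<bar>\<Delta> \<bullet> V\<bar>"
    using d(1) by (auto simp: abs_if)
  have "c\<^sup>2 * u\<^sup>2 = c\<^sup>2 / 2 * u\<^sup>2 + c\<^sup>2 / 2 * u\<^sup>2" by simp
  then have "c\<^sup>2 / 2 * u\<^sup>2 + \<epsilon>\<^sup>2 / 4 \<le> (norm (\<Delta> + \<epsilon> *\<^sub>R V))\<^sup>2 \<and> c\<^sup>2 / 2 * u\<^sup>2 + \<epsilon>\<^sup>2 / 4 \<le> (norm (\<Delta> - \<epsilon> *\<^sub>R V))\<^sup>2"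
    unfolding exp using D2 cr V2 ab zero_le_power2[of \<epsilon>] by (intro conjI) linarith+
  then show "c\<^sup>2 / 2 * u\<^sup>2 + \<epsilon>\<^sup>2 / 4 \<le> (norm (\<gamma> a - \<gamma> (a + u) + \<epsilon> *\<^sub>R V))\<^sup>2"
    "c\<^sup>2 / 2 * u\<^sup>2 + \<epsilon>\<^sup>2 / 4 \<le> (norm (\<gamma> a - \<gamma> (a + u) - \<epsilon> *\<^sub>R V))\<^sup>2"
    by (simp_all add: \<Delta>_def)
qed


text \<open>Homogeneity bookkeeping: as \<epsilon> and w are at most D, surplus powers of them are
  paid for by equal powers of D.\<close>

lemma (in -) power_ratio_le:
  fixes e w D :: real
  assumes "0 < D" "0 \<le> w" "w \<le> D" "0 \<le> e" "e \<le> D"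
  shows "e ^ (k + i) * w ^ j / D ^ (l + i + j) \<le> e ^ k / D ^ l"
proof -
  have "e ^ i * w ^ j \<le> D ^ i * D ^ j" using assms by (intro mult_mono power_mono) auto
  then have "e ^ k * (e ^ i * w ^ j) \<le> e ^ k * (D ^ i * D ^ j)" using assms by (intro mult_left_mono) auto
  then have "e ^ k * (e ^ i * w ^ j) / (D ^ l * (D ^ i * D ^ j)) \<le> e ^ k * (D ^ i * D ^ j) / (D ^ l * (D ^ i * D ^ j))"
    using assms by (intro divide_right_mono) auto
  then show ?thesis using assms by (simp add: power_add mult.assoc)
qed

definition gauss_kernel :: "real \<Rightarrow> real \<Rightarrow> real" where
  "gauss_kernel a u = (\<gamma> a - \<gamma> (a + u)) \<bullet> cross3 (vel \<gamma> a) (vel \<gamma> (a + u)) / norm (\<gamma> a - \<gamma> (a + u)) ^ 3"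

text \<open>The mean of the field integrands of the push-offs by \<epsilon> V and -\<epsilon> V; p
  stands for the speed of the parameter and W for the derivative of V.\<close>

definition averaged_kernel :: "real \<Rightarrow> real \<Rightarrow> real \<Rightarrow> E3 \<Rightarrow> E3 \<Rightarrow> real \<Rightarrow> real" where
  "averaged_kernel \<epsilon> p a V W u =
     (bs (\<gamma> a + \<epsilon> *\<^sub>R V) (a + u) \<bullet> (p *\<^sub>R vel \<gamma> a + \<epsilon> *\<^sub>R W)
      + bs (\<gamma> a - \<epsilon> *\<^sub>R V) (a + u) \<bullet> (p *\<^sub>R vel \<gamma> a - \<epsilon> *\<^sub>R W)) / 2"

text \<open>Gives 4 (M + 1) \<open>eps_max\<close> = c^2 / 4, the smallness that
  \<open>push_off_norm\<close> asks for; M + 1 covers the case M = 0.\<close>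

definition eps_max :: real where "eps_max = c\<^sup>2 / (16 * (M + 1))"

definition del_max :: real where "del_max = min (c\<^sup>2 / 4) (1 / 4)"

lemma eps_del_max:
  shows "0 < eps_max" "0 < del_max"
    and "\<epsilon> \<le> eps_max \<Longrightarrow> 4 * M * \<epsilon> \<le> c\<^sup>2 / 4"
    and "\<delta> \<le> del_max \<Longrightarrow> \<delta> \<le> c\<^sup>2 / 4" "\<delta> \<le> del_max \<Longrightarrow> \<delta> \<le> 1 / 4"
proof -
  show "0 < eps_max" "0 < del_max" using c_pos M_nonneg by (auto simp: eps_max_def del_max_def)
  assume "\<epsilon> \<le> eps_max"
  then have "4 * M * \<epsilon> \<le> 4 * M * eps_max" using M_nonneg by (intro mult_left_mono) auto
  also have "\<dots> \<le> c\<^sup>2 / 4" using M_nonneg by (simp add: eps_max_def field_simps)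
  finally show "4 * M * \<epsilon> \<le> c\<^sup>2 / 4" .
qed (auto simp: del_max_def)

lemma push_off_off:
  assumes V: "\<bar>V \<bullet> vel \<gamma> a\<bar> \<le> \<delta>" "\<bar>(norm V)\<^sup>2 - 1\<bar> \<le> \<delta>"
    and d: "0 < \<epsilon>" "\<epsilon> \<le> eps_max" "0 \<le> \<delta>" "\<delta> \<le> del_max"
  shows "\<gamma> a + \<epsilon> *\<^sub>R V \<in> - range \<gamma>" "\<gamma> a - \<epsilon> *\<^sub>R V \<in> - range \<gamma>"
proof -
  have "\<gamma> a + \<epsilon> *\<^sub>R V \<noteq> \<gamma> t \<and> \<gamma> a - \<epsilon> *\<^sub>R V \<noteq> \<gamma> t" for t
  proof -
    obtain k :: int where k: "\<bar>a - (t + of_int k)\<bar> \<le> 1 / 2" by (rule shift_near)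
    define u where "u = t + of_int k - a"
    have u: "\<bar>u\<bar> \<le> 1 / 2" "\<gamma> (a + u) = \<gamma> t"
      using k period[of t k] unfolding u_def by (linarith, simp)
    note po = push_off_norm[OF u(1) V d(1) eps_del_max(3)[OF d(2)] d(3) eps_del_max(4,5)[OF d(4)]]
    have "0 < c\<^sup>2 / 2 * u\<^sup>2 + \<epsilon>\<^sup>2 / 4" using d(1) by (simp add: add_nonneg_pos)
    then have "0 < (norm (\<gamma> a - \<gamma> t + \<epsilon> *\<^sub>R V))\<^sup>2" "0 < (norm (\<gamma> a - \<gamma> t - \<epsilon> *\<^sub>R V))\<^sup>2"
      using po(2,3) unfolding u(2) by linarith+
    then show ?thesis by (auto simp: algebra_simps)
  qed
  then show "\<gamma> a + \<epsilon> *\<^sub>R V \<in> - range \<gamma>" "\<gamma> a - \<epsilon> *\<^sub>R V \<in> - range \<gamma>" by blast+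
qed

text \<open>Adding multiples of the tangent to the chord and to the second velocity does not change
  the triple product; what is left has factors of order u^2, 1 and u. Hence the Gauss kernel is
  bounded.\<close>

lemma gauss_numerator_le:
  "\<bar>(\<gamma> a - \<gamma> (a + u)) \<bullet> cross3 (vel \<gamma> a) (vel \<gamma> (a + u))\<bar> \<le> A * M\<^sup>2 * \<bar>u\<bar> ^ 3"
proof -
  define \<Delta> where "\<Delta> = \<gamma> a - \<gamma> (a + u)"
  have D0: "norm (\<Delta> + u *\<^sub>R vel \<gamma> a) \<le> M * u\<^sup>2"
    using taylor[of "a + u" a] by (simp add: \<Delta>_def norm_minus_commute algebra_simps)
  have "\<Delta> \<bullet> cross3 (vel \<gamma> a) (vel \<gamma> (a + u)) = (\<Delta> + u *\<^sub>R vel \<gamma> a) \<bullet> cross3 (vel \<gamma> a) (vel \<gamma> (a + u) - vel \<gamma> a)"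
    by (simp add: inner_add_left dot_cross_self Cross3.right_diff_distrib)
  also have "\<bar>\<dots>\<bar> \<le> norm (\<Delta> + u *\<^sub>R vel \<gamma> a) * (norm (vel \<gamma> a) * norm (vel \<gamma> (a + u) - vel \<gamma> a))"
    by (rule triple_le)
  also have "\<dots> \<le> (M * u\<^sup>2) * (A * (M * \<bar>u\<bar>))"
    using D0 vel_le[of a] vel_lipschitz[of "a + u" a] M_nonneg A_pos by (intro mult_mono) auto
  also have "\<dots> = A * M\<^sup>2 * \<bar>u\<bar> ^ 3" by (simp add: power2_eq_square power3_eq_cube)
  finally show ?thesis by (simp add: \<Delta>_def)
qed

text \<open>The term \<open>n2\<close> in the proof is the one that cancels to leading order only in the average of the two push-offs:
  alone it is of order \<open>\<epsilon>\<bar>u\<bar> / D ^ 3\<close>, with an integral that does not tend to 0.\<close>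

lemma averaged_kernel_pointwise:
  assumes N: "0 \<le> N"
  obtains C where "0 \<le> C"
    "\<And>\<epsilon> \<delta> a u V W p. \<lbrakk>0 < \<epsilon>; \<epsilon> \<le> eps_max; 0 \<le> \<delta>; \<delta> \<le> del_max; \<bar>u\<bar> \<le> 1 / 2; \<bar>V \<bullet> vel \<gamma> a\<bar> \<le> \<delta>;
      \<bar>(norm V)\<^sup>2 - 1\<bar> \<le> \<delta>; norm W \<le> N; \<bar>p\<bar> \<le> N\<rbrakk> \<Longrightarrow>
      \<bar>averaged_kernel \<epsilon> p a V W u - p * gauss_kernel a u\<bar>
        \<le> \<bar>V \<bullet> cross3 W (vel \<gamma> a)\<bar> * (\<epsilon>\<^sup>2 / sqrt ((norm (vel \<gamma> a))\<^sup>2 * u\<^sup>2 + \<epsilon>\<^sup>2) ^ 3)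
          + C * (\<epsilon> / sqrt (u\<^sup>2 + \<epsilon>\<^sup>2) + \<delta> * (\<epsilon>\<^sup>2 / sqrt (u\<^sup>2 + \<epsilon>\<^sup>2) ^ 3))"
proof -
  \<comment> \<open>One constant below all the lower bounds in use: r, s and Q are at least k D, and
    b is at least k w.\<close>
  define k where "k = min (min m 1) (min (c / 2) (1 / 2))"
  have k: "0 < k" "k \<le> m" "k \<le> 1" "k \<le> c / 2" "k \<le> 1 / 2" using m_pos c_pos by (auto simp: k_def)
  have k2: "k\<^sup>2 \<le> m\<^sup>2" "k\<^sup>2 \<le> c\<^sup>2 / 2" "k\<^sup>2 \<le> 1 / 4" "k\<^sup>2 \<le> 1"
  proof -
    show "k\<^sup>2 \<le> m\<^sup>2" using k by (intro power_mono) auto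
    have "k\<^sup>2 \<le> (c / 2)\<^sup>2" "k\<^sup>2 \<le> (1 / 2)\<^sup>2" using k by (intro power_mono; simp)+
    then have "k\<^sup>2 \<le> c\<^sup>2 / 4" "k\<^sup>2 \<le> 1 / 4" by (simp_all add: power_divide)
    moreover have "0 \<le> c\<^sup>2" by simp
    ultimately show "k\<^sup>2 \<le> c\<^sup>2 / 2" "k\<^sup>2 \<le> 1 / 4" "k\<^sup>2 \<le> 1" by linarith+
  qed
  define C1 where "C1 = N * (A * M\<^sup>2 * (8 / k ^ 4))"
  define C2 where "C2 = 8 * N * A * M / k ^ 5"
  define C3 where "C3 = M * N * A / k ^ 3"
  define C4 where "C4 = 2 * N * M / k ^ 3"
  define C5 where "C5 = M * (2 * A + M)"
  define C6 where "C6 = 4 * N * A / k ^ 5"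
  define C where "C = C1 + C2 * (1 + 2 * M) + C3 + C4 + C6 * (C5 + 4 * M + 3)"
  note AM = A_pos M_nonneg
  have Cpos: "0 \<le> C1" "0 \<le> C2" "0 \<le> C3" "0 \<le> C4" "0 \<le> C5" "0 \<le> C6"
    using N AM k(1) by (auto simp: C1_def C2_def C3_def C4_def C5_def C6_def)

  show ?thesis
  proof (rule that)
    show "0 \<le> C" using Cpos AM by (simp add: C_def)

    fix \<epsilon> \<delta> a u p :: real and V W :: E3
    assume eps: "0 < \<epsilon>" "\<epsilon> \<le> eps_max" and del: "0 \<le> \<delta>" "\<delta> \<le> del_max" and u: "\<bar>u\<bar> \<le> 1 / 2"
      and V: "\<bar>V \<bullet> vel \<gamma> a\<bar> \<le> \<delta>" "\<bar>(norm V)\<^sup>2 - 1\<bar> \<le> \<delta>" and W: "norm W \<le> N" and p: "\<bar>p\<bar> \<le> N"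
    note po = push_off_norm[OF u V eps(1) eps_del_max(3)[OF eps(2)] del(1) eps_del_max(4,5)[OF del(2)]]
    define \<Delta> where "\<Delta> = \<gamma> a - \<gamma> (a + u)"
    define T where "T = vel \<gamma> a"
    define Tu where "Tu = vel \<gamma> (a + u)"
    define D where "D = sqrt (u\<^sup>2 + \<epsilon>\<^sup>2)"
    define w where "w = \<bar>u\<bar>"
    define r where "r = norm (\<Delta> + \<epsilon> *\<^sub>R V)"
    define s where "s = norm (\<Delta> - \<epsilon> *\<^sub>R V)"
    define b where "b = norm \<Delta>"
    \<comment> \<open>The model distance for a straight line of speed |T| and an orthogonal offset
      \<epsilon>; with it the twist term can be integrated in closed form.\<close>
    define Q where "Q = sqrt ((norm T)\<^sup>2 * u\<^sup>2 + \<epsilon>\<^sup>2)"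
    have w2: "w\<^sup>2 = u\<^sup>2" and w0: "0 \<le> w" by (auto simp: w_def)
    have D2: "D\<^sup>2 = u\<^sup>2 + \<epsilon>\<^sup>2" by (simp add: D_def)
    have D: "0 < D" "w \<le> D" "\<epsilon> \<le> D"
      using eps(1) by (auto simp: D_def w_def intro!: real_le_rsqrt add_nonneg_pos)
    have kD: "0 < k * D" using k D by simp
    have rs: "k * D \<le> r" "k * D \<le> s" "k * D \<le> Q"
    proof -
      have *: "(k * D)\<^sup>2 \<le> c\<^sup>2 / 2 * u\<^sup>2 + \<epsilon>\<^sup>2 / 4"
        using mult_right_mono[OF k2(2), of "u\<^sup>2"] mult_right_mono[OF k2(3), of "\<epsilon>\<^sup>2"]
        by (simp add: power_mult_distrib D2 distrib_left)
      then have "(k * D)\<^sup>2 \<le> r\<^sup>2" "(k * D)\<^sup>2 \<le> s\<^sup>2"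
        using po(2,3) by (simp_all add: r_def s_def \<Delta>_def)
      then show "k * D \<le> r" "k * D \<le> s" by (auto intro: power2_le_imp_le simp: r_def s_def)
      have "m\<^sup>2 \<le> (norm T)\<^sup>2" using m_pos vel_ge[of a] by (intro power_mono) (auto simp: T_def)
      then have "(k * D)\<^sup>2 \<le> (norm T)\<^sup>2 * u\<^sup>2 + \<epsilon>\<^sup>2"
        using mult_right_mono[of "k\<^sup>2" "(norm T)\<^sup>2" "u\<^sup>2"] mult_right_mono[OF k2(4), of "\<epsilon>\<^sup>2"] k2(1)
        by (simp add: power_mult_distrib D2 distrib_left)
      then show "k * D \<le> Q" unfolding Q_def by (rule real_le_rsqrt)
    qed
    have pos: "0 < r" "0 < s" "0 < Q" using rs kD by auto
    have b: "k * w \<le> b"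
    proof -
      have "c * w \<le> b" using chord[of a "a + u"] u by (simp add: b_def \<Delta>_def w_def)
      moreover have "k * w \<le> c * w" using k c_pos w0 by (intro mult_right_mono) auto
      ultimately show ?thesis by simp
    qed
    have T: "norm T \<le> A" "norm Tu \<le> A" "norm (Tu - T) \<le> M * w"
      using vel_le vel_lipschitz[of "a + u" a] by (auto simp: T_def Tu_def w_def)
    have \<Delta>T: "norm (\<Delta> + u *\<^sub>R T) \<le> M * w\<^sup>2" "norm (\<Delta> + u *\<^sub>R Tu) \<le> M * w\<^sup>2"
      using taylor[of "a + u" a] taylor[of a "a + u"]
      by (simp_all add: \<Delta>_def T_def Tu_def w_def norm_minus_commute algebra_simps)
    define E where "E = \<epsilon> / D"
    define J where "J = \<epsilon>\<^sup>2 / D ^ 3"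
    have EJ: "0 \<le> E" "0 \<le> J" using eps D by (auto simp: E_def J_def)
    have f: "\<epsilon>\<^sup>2 * w\<^sup>2 / D ^ 5 \<le> J" "\<epsilon>\<^sup>2 * w ^ 3 / D ^ 5 \<le> E" "\<epsilon> * w\<^sup>2 / D ^ 3 \<le> E" "\<epsilon>\<^sup>2 * w / D ^ 3 \<le> E"
      "\<epsilon> ^ 3 * w / D ^ 5 \<le> J" "\<epsilon> ^ 3 * w\<^sup>2 / D ^ 5 \<le> E" "\<epsilon> ^ 4 / D ^ 5 \<le> J"
    proof -
      note pr = power_ratio_le[OF D(1) w0 D(2) less_imp_le[OF eps(1)] D(3)]
      show "\<epsilon>\<^sup>2 * w\<^sup>2 / D ^ 5 \<le> J" "\<epsilon>\<^sup>2 * w ^ 3 / D ^ 5 \<le> E" "\<epsilon> * w\<^sup>2 / D ^ 3 \<le> E" "\<epsilon>\<^sup>2 * w / D ^ 3 \<le> E"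
        "\<epsilon> ^ 3 * w / D ^ 5 \<le> J" "\<epsilon> ^ 3 * w\<^sup>2 / D ^ 5 \<le> E" "\<epsilon> ^ 4 / D ^ 5 \<le> J"
        using pr[of 2 0 2 3] pr[of 1 1 3 1] pr[of 1 0 2 1] pr[of 1 1 1 1] pr[of 2 1 1 3] pr[of 1 2 2 1] pr[of 2 2 0 3]
        by (simp_all add: E_def J_def eval_nat_numeral)
    qed
    define n1 where "n1 = \<Delta> \<bullet> cross3 T Tu"
    define n2 where "n2 = V \<bullet> cross3 T Tu"
    define n3 where "n3 = \<Delta> \<bullet> cross3 W Tu"
    define n4 where "n4 = V \<bullet> cross3 W Tu"
    define n5 where "n5 = V \<bullet> cross3 W T"
    define X where "X = 1 / r ^ 3 - 1 / b ^ 3"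
    define Y where "Y = 1 / s ^ 3 - 1 / b ^ 3"
    define Z where "Z = 1 / r ^ 3 - 1 / s ^ 3"
    define X' where "X' = 1 / r ^ 3 - 1 / Q ^ 3"
    define Y' where "Y' = 1 / s ^ 3 - 1 / Q ^ 3"
    define S where "S = 1 / r ^ 3 + 1 / s ^ 3"
    have Kr: "bs (\<gamma> a + \<epsilon> *\<^sub>R V) (a + u) \<bullet> (p *\<^sub>R T + \<epsilon> *\<^sub>R W) = (p * n1 + \<epsilon> * p * n2 + \<epsilon> * n3 + \<epsilon>\<^sup>2 * n4) * (1 / r ^ 3)"
    proof -
      have x: "\<gamma> a + \<epsilon> *\<^sub>R V - \<gamma> (a + u) = \<Delta> + \<epsilon> *\<^sub>R V" by (simp add: \<Delta>_def)
      have "cross3 Tu (\<Delta> + \<epsilon> *\<^sub>R V) \<bullet> (p *\<^sub>R T + \<epsilon> *\<^sub>R W) = p * n1 + \<epsilon> * p * n2 + \<epsilon> * n3 + \<epsilon>\<^sup>2 * n4"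
        by (simp add: n1_def n2_def n3_def n4_def cross3_simps power2_eq_square)
      then show ?thesis
        unfolding bs_def x Tu_def[symmetric] r_def[symmetric] by (simp add: divide_inverse mult.commute)
    qed
    have Ks: "bs (\<gamma> a - \<epsilon> *\<^sub>R V) (a + u) \<bullet> (p *\<^sub>R T - \<epsilon> *\<^sub>R W) = (p * n1 - \<epsilon> * p * n2 - \<epsilon> * n3 + \<epsilon>\<^sup>2 * n4) * (1 / s ^ 3)"
    proof -
      have x: "\<gamma> a - \<epsilon> *\<^sub>R V - \<gamma> (a + u) = \<Delta> - \<epsilon> *\<^sub>R V" by (simp add: \<Delta>_def)
      have "cross3 Tu (\<Delta> - \<epsilon> *\<^sub>R V) \<bullet> (p *\<^sub>R T - \<epsilon> *\<^sub>R W) = p * n1 - \<epsilon> * p * n2 - \<epsilon> * n3 + \<epsilon>\<^sup>2 * n4"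
        by (simp add: n1_def n2_def n3_def n4_def cross3_simps power2_eq_square)
      then show ?thesis
        unfolding bs_def x Tu_def[symmetric] s_def[symmetric] by (simp add: divide_inverse mult.commute)
    qed
    have G: "gauss_kernel a u = n1 * (1 / b ^ 3)"
      by (simp add: gauss_kernel_def n1_def \<Delta>_def T_def Tu_def b_def)
    \<comment> \<open>Only the last summand survives in the limit; the others are bounded by
      multiples of E and of \<delta> J. The factor of \<open>n5\<close> is compared with the model
      \<open>Q\<close>.\<close>
    have split: "averaged_kernel \<epsilon> p a V W u - p * gauss_kernel a u = p * n1 * ((X + Y) / 2) + \<epsilon> * p * n2 * (Z / 2)
        + \<epsilon> * n3 * (Z / 2) + \<epsilon>\<^sup>2 * (n4 - n5) * (S / 2) + \<epsilon>\<^sup>2 * n5 * ((X' + Y') / 2) + n5 * (\<epsilon>\<^sup>2 / Q ^ 3)"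
      unfolding averaged_kernel_def T_def[symmetric] Kr Ks G X_def Y_def Z_def X'_def Y'_def S_def
      by (simp add: algebra_simps add_divide_distrib diff_divide_distrib)
    have inv: "1 / r ^ 3 \<le> 1 / (k * D) ^ 3" "1 / s ^ 3 \<le> 1 / (k * D) ^ 3" "0 \<le> 1 / r ^ 3" "0 \<le> 1 / s ^ 3"
      using rs kD pos by (auto intro!: divide_left_mono power_mono)
    have n1: "\<bar>n1\<bar> \<le> A * M\<^sup>2 * w ^ 3"
      using gauss_numerator_le[of a u] by (simp add: n1_def \<Delta>_def T_def Tu_def w_def)
    have n2: "\<bar>n2\<bar> \<le> 2 * (A * (M * w))"
    proof -
      have "n2 = V \<bullet> cross3 T (Tu - T)" by (simp add: n2_def Cross3.right_diff_distrib)
      also have "\<bar>\<dots>\<bar> \<le> norm V * (norm T * norm (Tu - T))" by (rule triple_le)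
      also have "\<dots> \<le> 2 * (A * (M * w))" using po(4) T AM by (intro mult_mono) auto
      finally show ?thesis .
    qed
    have n3: "\<bar>n3\<bar> \<le> M * w\<^sup>2 * (N * A)"
    proof -
      have "n3 = (\<Delta> + u *\<^sub>R Tu) \<bullet> cross3 W Tu" by (simp add: n3_def inner_add_left dot_cross_self)
      also have "\<bar>\<dots>\<bar> \<le> norm (\<Delta> + u *\<^sub>R Tu) * (norm W * norm Tu)" by (rule triple_le)
      also have "\<dots> \<le> M * w\<^sup>2 * (N * A)" using \<Delta>T W T AM N by (intro mult_mono) auto
      finally show ?thesis .
    qed
    have n45: "\<bar>n4 - n5\<bar> \<le> 2 * (N * (M * w))"
    proof -
      have "n4 - n5 = V \<bullet> cross3 W (Tu - T)" by (simp add: n4_def n5_def Cross3.right_diff_distrib inner_diff_right)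
      also have "\<bar>\<dots>\<bar> \<le> norm V * (norm W * norm (Tu - T))" by (rule triple_le)
      also have "\<dots> \<le> 2 * (N * (M * w))" using po(4) T W AM N by (intro mult_mono) auto
      finally show ?thesis .
    qed
    have n5: "\<bar>n5\<bar> \<le> 2 * (N * A)"
    proof -
      have "\<bar>n5\<bar> \<le> norm V * (norm W * norm T)" unfolding n5_def by (rule triple_le)
      also have "\<dots> \<le> 2 * (N * A)" using po(4) T W AM N by (intro mult_mono) auto
      finally show ?thesis .
    qed
    have dV: "\<bar>\<Delta> \<bullet> V\<bar> \<le> \<delta> * w + 2 * M * w\<^sup>2" using po(1) by (simp add: \<Delta>_def w_def)
    have rb: "\<bar>r - b\<bar> \<le> 2 * \<epsilon>" "\<bar>s - b\<bar> \<le> 2 * \<epsilon>"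
    proof -
      have "\<bar>r - b\<bar> \<le> norm (\<epsilon> *\<^sub>R V)" "\<bar>s - b\<bar> \<le> norm (\<epsilon> *\<^sub>R V)"
        using norm_triangle_ineq3[of "\<Delta> + \<epsilon> *\<^sub>R V" \<Delta>] norm_triangle_ineq3[of "\<Delta> - \<epsilon> *\<^sub>R V" \<Delta>]
        by (simp_all add: r_def s_def b_def)
      moreover have "norm (\<epsilon> *\<^sub>R V) \<le> 2 * \<epsilon>" using po(4) eps by simp
      ultimately show "\<bar>r - b\<bar> \<le> 2 * \<epsilon>" "\<bar>s - b\<bar> \<le> 2 * \<epsilon>" by auto
    qed
    have r2: "r\<^sup>2 = \<Delta> \<bullet> \<Delta> + 2 * \<epsilon> * (\<Delta> \<bullet> V) + \<epsilon>\<^sup>2 * (V \<bullet> V)"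
      unfolding r_def power2_norm_eq_inner
      by (simp add: inner_add_left inner_add_right inner_commute[of V \<Delta>] power2_eq_square algebra_simps)
    have s2: "s\<^sup>2 = \<Delta> \<bullet> \<Delta> - 2 * \<epsilon> * (\<Delta> \<bullet> V) + \<epsilon>\<^sup>2 * (V \<bullet> V)"
      unfolding s_def power2_norm_eq_inner
      by (simp add: inner_diff_left inner_diff_right inner_commute[of V \<Delta>] power2_eq_square algebra_simps)
    have Q2: "Q\<^sup>2 = u\<^sup>2 * (T \<bullet> T) + \<epsilon>\<^sup>2" by (simp add: Q_def power2_norm_eq_inner mult.commute)
    have t1: "\<bar>p * n1 * ((X + Y) / 2)\<bar> \<le> C1 * E"
    proof -
      have x: "w ^ 3 * \<bar>X\<bar> \<le> 8 / k ^ 4 * E" "w ^ 3 * \<bar>Y\<bar> \<le> 8 / k ^ 4 * E"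
        unfolding X_def Y_def E_def
        by (rule cube_times_inverse_cube_diff[OF D(1) k(1) w0 D(2) rs(1) b rb(1)]
            cube_times_inverse_cube_diff[OF D(1) k(1) w0 D(2) rs(2) b rb(2)])+
      have "\<bar>p * n1 * ((X + Y) / 2)\<bar> \<le> N * (A * M\<^sup>2 * w ^ 3) * ((\<bar>X\<bar> + \<bar>Y\<bar>) / 2)"
        unfolding abs_mult using p n1 N AM w0 by (intro mult_mono) auto
      also have "\<dots> = N * (A * M\<^sup>2 * ((w ^ 3 * \<bar>X\<bar> + w ^ 3 * \<bar>Y\<bar>) / 2))" by (simp add: algebra_simps)
      also have "\<dots> \<le> N * (A * M\<^sup>2 * (8 / k ^ 4 * E))"
        using x N AM by (intro mult_left_mono) auto
      finally show ?thesis by (simp add: C1_def mult.assoc)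
    qed
    have kDn: "(k * D) ^ 5 = k ^ 5 * D ^ 5" "(k * D) ^ 3 = k ^ 3 * D ^ 3" by (simp_all add: power_mult_distrib)
    \<comment> \<open>The gain from averaging: r^2 and s^2 differ only by 4 \<epsilon> times the
      inner product of the chord with V, which is of order \<delta> w + w^2.\<close>
    have t2: "\<bar>\<epsilon> * p * n2 * (Z / 2)\<bar> \<le> C2 * (\<delta> * J + 2 * M * E)"
    proof -
      have "\<bar>Z\<bar> \<le> 2 * \<bar>r\<^sup>2 - s\<^sup>2\<bar> / (k * D) ^ 5"
        unfolding Z_def by (rule inverse_cube_diff_lower[OF kD rs(1,2)])
      also have "\<bar>r\<^sup>2 - s\<^sup>2\<bar> = 4 * \<epsilon> * \<bar>\<Delta> \<bullet> V\<bar>" using eps(1) by (simp add: r2 s2 abs_mult)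
      also have "2 * (4 * \<epsilon> * \<bar>\<Delta> \<bullet> V\<bar>) / (k * D) ^ 5 \<le> 2 * (4 * \<epsilon> * (\<delta> * w + 2 * M * w\<^sup>2)) / (k * D) ^ 5"
        using dV eps(1) kD by (intro divide_right_mono mult_left_mono) auto
      finally have Z: "\<bar>Z / 2\<bar> \<le> 4 * \<epsilon> * (\<delta> * w + 2 * M * w\<^sup>2) / (k * D) ^ 5" by simp
      have "\<bar>\<epsilon> * p * n2 * (Z / 2)\<bar> \<le> \<epsilon> * N * (2 * (A * (M * w))) * (4 * \<epsilon> * (\<delta> * w + 2 * M * w\<^sup>2) / (k * D) ^ 5)"
        unfolding abs_mult[of _ "Z / 2"] abs_mult[of _ n2] abs_mult[of _ p]
        using p n2 N AM w0 eps Z by (intro mult_mono) auto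
      also have "\<dots> = C2 * (\<delta> * (\<epsilon>\<^sup>2 * w\<^sup>2 / D ^ 5) + 2 * M * (\<epsilon>\<^sup>2 * w ^ 3 / D ^ 5))"
        unfolding C2_def kDn using k D by (simp add: field_simps power2_eq_square power3_eq_cube)
      also have "\<dots> \<le> C2 * (\<delta> * J + 2 * M * E)"
        using f Cpos del AM by (intro mult_left_mono add_mono) auto
      finally show ?thesis .
    qed
    \<comment> \<open>\<open>n3\<close> is of second order in w, so the crude bound for the
      reciprocals is enough here.\<close>
    have t3: "\<bar>\<epsilon> * n3 * (Z / 2)\<bar> \<le> C3 * E"
    proof -
      have "\<bar>(x - y) / 2\<bar> \<le> z" if "x \<le> z" "y \<le> z" "0 \<le> x" "0 \<le> y" for x y z :: real
      proof -
        have "x - y \<le> 2 * z" "y - x \<le> 2 * z" using that by linarith+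
        then show ?thesis by (simp add: abs_le_iff)
      qed
      from this[OF inv] have "\<bar>Z / 2\<bar> \<le> 1 / (k * D) ^ 3" by (simp only: Z_def)
      then have "\<bar>\<epsilon> * n3 * (Z / 2)\<bar> \<le> \<epsilon> * (M * w\<^sup>2 * (N * A)) * (1 / (k * D) ^ 3)"
        unfolding abs_mult[of _ "Z / 2"] abs_mult[of _ n3] using n3 N AM eps by (intro mult_mono) auto
      also have "\<dots> = C3 * (\<epsilon> * w\<^sup>2 / D ^ 3)"
        unfolding C3_def kDn by simp
      also have "\<dots> \<le> C3 * E" using f Cpos by (intro mult_left_mono) auto
      finally show ?thesis .
    qed
    have t4: "\<bar>\<epsilon>\<^sup>2 * (n4 - n5) * (S / 2)\<bar> \<le> C4 * E"
    proof -
      have "\<bar>S / 2\<bar> \<le> 1 / (k * D) ^ 3" using inv unfolding S_def by (simp add: abs_le_iff)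
      then have "\<bar>\<epsilon>\<^sup>2 * (n4 - n5) * (S / 2)\<bar> \<le> \<epsilon>\<^sup>2 * (2 * (N * (M * w))) * (1 / (k * D) ^ 3)"
        unfolding abs_mult[of _ "S / 2"] abs_mult[of _ "n4 - n5"] using n45 N AM w0 eps by (intro mult_mono) auto
      also have "\<dots> = C4 * (\<epsilon>\<^sup>2 * w / D ^ 3)"
        unfolding C4_def kDn by simp
      also have "\<dots> \<le> C4 * E" using f Cpos by (intro mult_left_mono) auto
      finally show ?thesis .
    qed
    have t5: "\<bar>\<epsilon>\<^sup>2 * n5 * ((X' + Y') / 2)\<bar> \<le> C6 * (C5 * E + 2 * \<delta> * J + 4 * M * E + \<delta> * J)"
    proof -
      \<comment> \<open>The three errors of replacing r or s by Q: the chord is not exactly |u| |T|,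
        the cross term does not vanish, and V is not exactly unit.\<close>
      define R where "R = C5 * w ^ 3 + 2 * \<epsilon> * (\<delta> * w + 2 * M * w\<^sup>2) + \<epsilon>\<^sup>2 * \<delta>"
      have sq: "\<bar>\<Delta> \<bullet> \<Delta> - u\<^sup>2 * (T \<bullet> T)\<bar> \<le> C5 * w ^ 3"
      proof -
        have "norm (\<Delta> - u *\<^sub>R T) \<le> norm (\<Delta> + u *\<^sub>R T) + norm ((2 * u) *\<^sub>R T)"
        proof -
          have "\<Delta> - u *\<^sub>R T = (\<Delta> + u *\<^sub>R T) - (2 * u) *\<^sub>R T"
            by (simp add: scaleR_left_distrib[symmetric] algebra_simps)
          then show ?thesis using norm_triangle_ineq4[of "\<Delta> + u *\<^sub>R T" "(2 * u) *\<^sub>R T"] by (simp only:)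
        qed
        also have "\<dots> \<le> M * w\<^sup>2 + 2 * w * A"
        proof (rule add_mono[OF \<Delta>T(1)])
          have "norm ((2 * u) *\<^sub>R T) = 2 * w * norm T" by (simp add: w_def abs_mult)
          moreover have "2 * w * norm T \<le> 2 * w * A" using T(1) w0 by (intro mult_left_mono) auto
          ultimately show "norm ((2 * u) *\<^sub>R T) \<le> 2 * w * A" by linarith
        qed
        \<comment> \<open>As w is at most 1/2, its square is at most w.\<close>
        also have "\<dots> \<le> M * w + 2 * w * A"
          using AM w0 u unfolding power2_eq_square by (intro add_right_mono mult_left_mono mult_left_le) (auto simp: w_def)
        finally have m: "norm (\<Delta> - u *\<^sub>R T) \<le> (2 * A + M) * w" by (simp add: algebra_simps)
        have "\<Delta> \<bullet> \<Delta> - u\<^sup>2 * (T \<bullet> T) = (\<Delta> + u *\<^sub>R T) \<bullet> (\<Delta> - u *\<^sub>R T)"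
          by (simp add: inner_add_left inner_diff_right inner_commute[of T \<Delta>] power2_eq_square algebra_simps)
        also have "\<bar>\<dots>\<bar> \<le> norm (\<Delta> + u *\<^sub>R T) * norm (\<Delta> - u *\<^sub>R T)" by (rule Cauchy_Schwarz_ineq2)
        also have "\<dots> \<le> M * w\<^sup>2 * ((2 * A + M) * w)" using \<Delta>T(1) m AM w0 by (intro mult_mono) auto
        also have "\<dots> = C5 * w ^ 3" by (simp add: C5_def power2_eq_square power3_eq_cube)
        finally show ?thesis .
      qed
      have e2: "\<bar>2 * \<epsilon> * (\<Delta> \<bullet> V)\<bar> \<le> 2 * \<epsilon> * (\<delta> * w + 2 * M * w\<^sup>2)"
        unfolding abs_mult using dV eps by (intro mult_mono) auto
      have e3: "\<bar>\<epsilon>\<^sup>2 * (V \<bullet> V) - \<epsilon>\<^sup>2\<bar> \<le> \<epsilon>\<^sup>2 * \<delta>"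
      proof -
        have "\<epsilon>\<^sup>2 * (V \<bullet> V) - \<epsilon>\<^sup>2 = \<epsilon>\<^sup>2 * ((norm V)\<^sup>2 - 1)" by (simp add: power2_norm_eq_inner algebra_simps)
        then show ?thesis using V(2) by (simp add: abs_mult mult_left_mono)
      qed
      have R: "\<bar>r\<^sup>2 - Q\<^sup>2\<bar> \<le> R" "\<bar>s\<^sup>2 - Q\<^sup>2\<bar> \<le> R"
        unfolding r2 s2 Q2 R_def using sq e2 e3 by linarith+
      have xr: "\<bar>X'\<bar> \<le> 2 * R / (k * D) ^ 5"
        unfolding X'_def using inverse_cube_diff_lower[OF kD rs(1,3)] R(1) kD
        by (elim order_trans) (intro divide_right_mono mult_left_mono; simp)
      have yr: "\<bar>Y'\<bar> \<le> 2 * R / (k * D) ^ 5"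
        unfolding Y'_def using inverse_cube_diff_lower[OF kD rs(2,3)] R(2) kD
        by (elim order_trans) (intro divide_right_mono mult_left_mono; simp)
      have "\<bar>(X' + Y') / 2\<bar> \<le> 2 * R / (k * D) ^ 5" using xr yr by (simp add: abs_le_iff)
      then have "\<bar>\<epsilon>\<^sup>2 * n5 * ((X' + Y') / 2)\<bar> \<le> \<epsilon>\<^sup>2 * (2 * (N * A)) * (2 * R / (k * D) ^ 5)"
        unfolding abs_mult[of _ "(X' + Y') / 2"] abs_mult[of _ n5] using n5 N AM eps by (intro mult_mono) auto
      also have "\<dots> = C6 * (C5 * (\<epsilon>\<^sup>2 * w ^ 3 / D ^ 5) + 2 * \<delta> * (\<epsilon> ^ 3 * w / D ^ 5) + 4 * M * (\<epsilon> ^ 3 * w\<^sup>2 / D ^ 5) + \<delta> * (\<epsilon> ^ 4 / D ^ 5))"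
        unfolding C6_def kDn R_def using k D by (simp add: field_simps eval_nat_numeral)
      also have "\<dots> \<le> C6 * (C5 * E + 2 * \<delta> * J + 4 * M * E + \<delta> * J)"
        using f Cpos del AM by (intro mult_left_mono add_mono) auto
      finally show ?thesis .
    qed
    have t6: "\<bar>n5 * (\<epsilon>\<^sup>2 / Q ^ 3)\<bar> = \<bar>n5\<bar> * (\<epsilon>\<^sup>2 / Q ^ 3)" using pos by (simp add: abs_mult)
    have "C1 + C2 * (2 * M) + C3 + C4 + C6 * (C5 + 4 * M) \<le> C"
      using Cpos AM by (simp add: C_def distrib_left)
    then have cE: "(C1 + C2 * (2 * M) + C3 + C4 + C6 * (C5 + 4 * M)) * E \<le> C * E" using EJ by (intro mult_right_mono)
    have "C2 + C6 * 3 \<le> C"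
      using Cpos AM by (simp add: C_def distrib_left)
    then have cJ: "(C2 + C6 * 3) * (\<delta> * J) \<le> C * (\<delta> * J)" using EJ del by (intro mult_right_mono) auto
    have "\<bar>averaged_kernel \<epsilon> p a V W u - p * gauss_kernel a u\<bar>
        \<le> C1 * E + C2 * (\<delta> * J + 2 * M * E) + C3 * E + C4 * E + C6 * (C5 * E + 2 * \<delta> * J + 4 * M * E + \<delta> * J) + \<bar>n5\<bar> * (\<epsilon>\<^sup>2 / Q ^ 3)"
      unfolding split using t6 by (intro order_trans[OF abs_triangle_ineq] add_mono t1 t2 t3 t4 t5) simp
    also have "\<dots> = \<bar>n5\<bar> * (\<epsilon>\<^sup>2 / Q ^ 3) + ((C1 + C2 * (2 * M) + C3 + C4 + C6 * (C5 + 4 * M)) * E + (C2 + C6 * 3) * (\<delta> * J))"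
      by (simp add: algebra_simps)
    also have "\<dots> \<le> \<bar>n5\<bar> * (\<epsilon>\<^sup>2 / Q ^ 3) + C * (E + \<delta> * J)" using cE cJ by (simp add: distrib_left)
    finally show "\<bar>averaged_kernel \<epsilon> p a V W u - p * gauss_kernel a u\<bar>
        \<le> \<bar>V \<bullet> cross3 W (vel \<gamma> a)\<bar> * (\<epsilon>\<^sup>2 / sqrt ((norm (vel \<gamma> a))\<^sup>2 * u\<^sup>2 + \<epsilon>\<^sup>2) ^ 3)
          + C * (\<epsilon> / sqrt (u\<^sup>2 + \<epsilon>\<^sup>2) + \<delta> * (\<epsilon>\<^sup>2 / sqrt (u\<^sup>2 + \<epsilon>\<^sup>2) ^ 3))"
      by (simp only: n5_def Q_def E_def J_def D_def T_def)
  qed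
qed

end

section \<open>Gauss density and writhe\<close>

lemma integral_shift_period:
  fixes f :: "real \<Rightarrow> 'a::euclidean_space"
  assumes per: "\<And>t. f (t + 1) = f t" and int: "\<And>a b. f integrable_on {a..b}"
  shows "integral {a..a + 1} f = integral {0..1} f"
proof -
  have fn: "f (t + of_int n) = f t" for t n
  proof (induction n rule: int_induct[of _ 0])
    case (step1 i)
    then show ?case using per[of "t + of_int i"] by (simp add: algebra_simps)
  next
    case (step2 i)
    then show ?case using per[of "t + of_int (i - 1)"] by (simp add: algebra_simps)
  qed simp
  define x where "x = frac a"
  have x: "0 \<le> x" "x \<le> 1" by (auto simp: x_def frac_lt_1 less_imp_le)
  have "integral {a..a + 1} f = integral {a - of_int \<lfloor>a\<rfloor>..a + 1 - of_int \<lfloor>a\<rfloor>} (\<lambda>t. f (t + of_int \<lfloor>a\<rfloor>))"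
    by (rule integral_shift_real_ivl[symmetric])
  also have "\<dots> = integral {x..x + 1} f" by (simp add: fn x_def frac_def algebra_simps)
  also have "\<dots> = integral {x..1} f + integral {1..x + 1} f"
    using x by (intro Henstock_Kurzweil_Integration.integral_combine[symmetric] int) auto
  also have "integral {1..x + 1} f = integral {1 - 1..x + 1 - 1} (\<lambda>t. f (t + 1))"
    by (rule integral_shift_real_ivl[symmetric])
  also have "\<dots> = integral {0..x} f" by (simp add: per)
  also have "integral {x..1} f + integral {0..x} f = integral {0..1} f"
    using x Henstock_Kurzweil_Integration.integral_combine[of 0 x 1 f] int by (simp add: add.commute)
  finally show ?thesis .
qed

lemma set_integrable_bounded_Icc:
  fixes f :: "'a::euclidean_space \<Rightarrow> real"
  assumes "f \<in> borel_measurable borel" "\<And>x. \<bar>f x\<bar> \<le> B"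
  shows "set_integrable lborel (cbox a b) f"
  unfolding set_integrable_def
  using assms emeasure_bounded_finite[OF bounded_cbox, of a b]
  by (intro integrableI_bounded_set_indicator) auto

text \<open>The antiderivative is u / sqrt (k^2 u^2 + e^2). Over the whole line the integral would
  be 2 / k, which bounds it uniformly in e.\<close>

lemma has_integral_inverse_cube:
  fixes k e :: real assumes "0 < e"
  shows "((\<lambda>u. e\<^sup>2 / sqrt (k\<^sup>2 * u\<^sup>2 + e\<^sup>2) ^ 3) has_integral (1 / sqrt (k\<^sup>2 / 4 + e\<^sup>2))) {-1/2..1/2}"
proof -
  have pos: "0 < k\<^sup>2 * u\<^sup>2 + e\<^sup>2" for u using assms by (simp add: add_nonneg_pos)
  have "((\<lambda>u. u / sqrt (k\<^sup>2 * u\<^sup>2 + e\<^sup>2)) has_real_derivative e\<^sup>2 / sqrt (k\<^sup>2 * u\<^sup>2 + e\<^sup>2) ^ 3) (at u within {-1/2..1/2})" for u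
  proof -
    define s where "s = sqrt (k\<^sup>2 * u\<^sup>2 + e\<^sup>2)"
    have s: "0 < s" "s * s = k\<^sup>2 * u\<^sup>2 + e\<^sup>2" using pos[of u] by (auto simp: s_def)
    have "((\<lambda>u. k\<^sup>2 * u\<^sup>2 + e\<^sup>2) has_real_derivative (2 * k\<^sup>2 * u)) (at u within {-1/2..1/2})"
      by (auto intro!: derivative_eq_intros)
    from DERIV_chain2[OF DERIV_real_sqrt[OF pos[of u]] this]
    have "((\<lambda>u. sqrt (k\<^sup>2 * u\<^sup>2 + e\<^sup>2)) has_real_derivative (inverse s / 2 * (2 * k\<^sup>2 * u))) (at u within {-1/2..1/2})"
      by (simp add: s_def)
    then have "((\<lambda>u. u / sqrt (k\<^sup>2 * u\<^sup>2 + e\<^sup>2)) has_real_derivative (1 * s - u * (inverse s / 2 * (2 * k\<^sup>2 * u))) / (s * s)) (at u within {-1/2..1/2})"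
      using s(1) unfolding s_def by (intro DERIV_divide DERIV_ident) auto
    moreover have "(1 * s - u * (inverse s / 2 * (2 * k\<^sup>2 * u))) / (s * s) = (s * s - k\<^sup>2 * u\<^sup>2) / s ^ 3"
      using s(1) by (simp add: field_simps power2_eq_square power3_eq_cube)
    ultimately show ?thesis using s(2) by (simp add: s_def)
  qed
  then have "((\<lambda>u. e\<^sup>2 / sqrt (k\<^sup>2 * u\<^sup>2 + e\<^sup>2) ^ 3) has_integral ((1/2) / sqrt (k\<^sup>2 * (1/2)\<^sup>2 + e\<^sup>2) - (-1/2) / sqrt (k\<^sup>2 * (-1/2)\<^sup>2 + e\<^sup>2))) {-1/2..1/2}"
    by (intro fundamental_theorem_of_calculus) (auto simp: has_real_derivative_iff_has_vector_derivative)
  then show ?thesis by (simp add: power2_eq_square)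
qed

lemma integral_inverse_cube_le:
  fixes k e :: real assumes "0 < e" "0 < k"
  shows "1 / sqrt (k\<^sup>2 / 4 + e\<^sup>2) \<le> 2 / k"
proof -
  have "k / 2 \<le> sqrt (k\<^sup>2 / 4 + e\<^sup>2)" by (rule real_le_rsqrt) (simp add: power_divide)
  then have "1 / sqrt (k\<^sup>2 / 4 + e\<^sup>2) \<le> 1 / (k / 2)"
    using assms by (intro divide_left_mono) (auto intro!: mult_pos_pos add_pos_pos)
  then show ?thesis by simp
qed

context c11_curve
begin

text \<open>The inner integral of the writhe over a period centred at a, since the kernel estimates
  hold for offsets of absolute value at most 1/2.\<close>

definition gauss_density :: "real \<Rightarrow> real" where
  "gauss_density a = integral {-1/2..1/2} (gauss_kernel a)"

lemma continuous_on_curve: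
  fixes g :: "'b::topological_space \<Rightarrow> real"
  assumes "continuous_on S g"
  shows "continuous_on S (\<lambda>x. \<gamma> (g x))" "continuous_on S (\<lambda>x. vel \<gamma> (g x))"
  using continuous_on_compose2[OF cont[of UNIV] assms] continuous_on_compose2[OF cont_vel[of UNIV] assms] by auto

lemma gauss_kernel_period: "gauss_kernel a (u + of_int k) = gauss_kernel a u"
  using period[of "a + u" k] vel_period[of "a + u" k] by (simp add: gauss_kernel_def add.assoc)

lemma gauss_kernel_bound: "\<bar>gauss_kernel a u\<bar> \<le> A * M\<^sup>2 / c ^ 3"
proof -
  have near: "\<bar>gauss_kernel a u\<bar> \<le> A * M\<^sup>2 / c ^ 3" if u: "\<bar>u\<bar> \<le> 1 / 2" for u
  proof (cases "u = 0")
    \<comment> \<open>On the diagonal the quotient is 0 / 0, which is 0 by convention.\<close>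
    case True then show ?thesis using A_pos c_pos by (simp add: gauss_kernel_def)
  next
    case False
    define b where "b = norm (\<gamma> a - \<gamma> (a + u))"
    have b: "c * \<bar>u\<bar> \<le> b" using chord[of a "a + u"] u by (simp add: b_def)
    have cu: "0 < c * \<bar>u\<bar>" using c_pos False by simp
    have "\<bar>gauss_kernel a u\<bar> \<le> A * M\<^sup>2 * \<bar>u\<bar> ^ 3 / b ^ 3"
      unfolding gauss_kernel_def b_def[symmetric] abs_divide
      using gauss_numerator_le[of a u] b cu by (intro frac_le) auto
    also have "\<dots> \<le> A * M\<^sup>2 * \<bar>u\<bar> ^ 3 / (c * \<bar>u\<bar>) ^ 3"
      using b cu A_pos c_pos False less_le_trans[OF cu b] by (intro divide_left_mono power_mono mult_pos_pos zero_less_power) auto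
    also have "\<dots> = A * M\<^sup>2 / c ^ 3" using False c_pos by (simp add: power_mult_distrib)
    finally show ?thesis .
  qed
  obtain k :: int where "\<bar>0 - (u + of_int k)\<bar> \<le> 1 / 2" by (rule shift_near)
  then have "\<bar>u + of_int k\<bar> \<le> 1 / 2" by linarith
  then show ?thesis using near[of "u + of_int k"] gauss_kernel_period by simp
qed

lemma gauss_kernel_borel:
  fixes f g :: "'b::euclidean_space \<Rightarrow> real"
  assumes "continuous_on UNIV f" "continuous_on UNIV g"
  shows "(\<lambda>x. gauss_kernel (f x) (g x)) \<in> borel_measurable borel"
  unfolding gauss_kernel_def
  by (intro borel_measurable_divide borel_measurable_continuous_onI continuous_intros
      bounded_bilinear.continuous_on[OF bounded_bilinear_cross3] continuous_on_curve assms)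

lemma gauss_kernel_integrable: "gauss_kernel a integrable_on {x..y}"
  using set_borel_integral_eq_integral(1)[OF set_integrable_bounded_Icc[OF
        gauss_kernel_borel[OF continuous_on_const continuous_on_id] gauss_kernel_bound], of a x y] by simp

lemma gauss_density_eq: "gauss_density a = integral {x..x + 1} (gauss_kernel a)"
proof -
  have "integral {y..y + 1} (gauss_kernel a) = integral {0..1} (gauss_kernel a)" for y
    using gauss_kernel_period[of a _ 1] gauss_kernel_integrable by (intro integral_shift_period) auto
  from this[of x] this[of "-1/2"] show ?thesis by (simp add: gauss_density_def)
qed

lemma gauss_density_period: "gauss_density (a + 1) = gauss_density a"
proof -
  have "\<gamma> (a + 1 + u) = \<gamma> (a + u)" "vel \<gamma> (a + 1 + u) = vel \<gamma> (a + u)" for u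
    using period[of "a + u" 1] vel_period[of "a + u" 1] by (simp_all add: ac_simps)
  then have "gauss_kernel (a + 1) = gauss_kernel a"
    using period[of a 1] vel_period[of a 1] by (simp add: gauss_kernel_def fun_eq_iff)
  then show ?thesis by (simp add: gauss_density_def)
qed

text \<open>The kernel of a C^{1,1} curve need not have a limit on the diagonal, but it is bounded
  and, for each u off the diagonal, continuous in a; dominated convergence does the rest.\<close>

lemma continuous_on_gauss_density: "continuous_on S gauss_density"
proof -
  have "continuous_on UNIV gauss_density"
    unfolding continuous_on_sequentially
  proof (intro allI ballI impI)
    fix x :: "nat \<Rightarrow> real" and a assume xa: "(\<forall>n. x n \<in> UNIV) \<and> x \<longlonglongrightarrow> a"
    have "(\<lambda>n. integral {-1/2..1/2} (gauss_kernel (x n))) \<longlonglongrightarrow> integral {-1/2..1/2} (gauss_kernel a)"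
    proof (rule dominated_convergence(2))
      fix u :: real assume u: "u \<in> {-1/2..1/2}"
      show "(\<lambda>n. gauss_kernel (x n) u) \<longlonglongrightarrow> gauss_kernel a u"
      proof (cases "u = 0")
        case False
        have "\<bar>a - (a + u)\<bar> \<le> 1 / 2" using u by auto
        moreover have "0 < c * \<bar>a - (a + u)\<bar>" using False c_pos by simp
        ultimately have "norm (\<gamma> a - \<gamma> (a + u)) \<noteq> 0" using chord[of a "a + u"] by linarith
        then have "isCont (\<lambda>a. gauss_kernel a u) a"
          unfolding gauss_kernel_def
          using cont[of UNIV] cont_vel[of UNIV]
          by (intro continuous_intros bounded_bilinear.continuous[OF bounded_bilinear_cross3]
              continuous_on_interior[of UNIV, OF continuous_on_curve(1)] continuous_on_interior[of UNIV, OF continuous_on_curve(2)]) auto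
        then show ?thesis using xa by (auto simp: continuous_at_sequentially o_def)
      qed (simp add: gauss_kernel_def)
    qed (use gauss_kernel_integrable gauss_kernel_bound in auto)
    then show "(gauss_density \<circ> x) \<longlonglongrightarrow> gauss_density a" by (simp add: o_def gauss_density_def)
  qed
  then show ?thesis using continuous_on_subset by blast
qed

text \<open>The integrand is bounded and Borel but may be discontinuous on the diagonal, so Fubini
  is used for the Lebesgue integral and the result is carried back. A shear turns the second
  variable into the offset.\<close>

lemma writhe_eq: "4 * pi * Wr \<gamma> = integral {0..1} gauss_density"
proof -
  define g where "g z = gauss_kernel (fst z) (snd z - fst z)" for z
  have gm: "g \<in> borel_measurable borel"
    unfolding g_def by (intro gauss_kernel_borel continuous_intros)
  have gI: "set_integrable lborel (cbox (0,0) (1,1)) g"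
    by (rule set_integrable_bounded_Icc[OF gm, of "A * M\<^sup>2 / c ^ 3"]) (simp add: g_def gauss_kernel_bound)
  have sq: "{0..1} \<times> {0..1} = cbox (0 :: real, 0 :: real) (1, 1)" by (auto simp: cbox_Pair_eq)
  have inner: "(LINT t:{0..1}|lborel. g (s, t)) = gauss_density s" for s
  proof -
    have "set_integrable lborel (cbox 0 1) (\<lambda>t. g (s, t))"
      by (rule set_integrable_bounded_Icc[of _ "A * M\<^sup>2 / c ^ 3"])
        (auto simp: g_def gauss_kernel_bound intro!: gauss_kernel_borel continuous_intros)
    then have "(LINT t:{0..1}|lborel. g (s, t)) = integral {0..1} (\<lambda>t. gauss_kernel s (t - s))"
      using set_borel_integral_eq_integral(2)[of "{0..1}" "\<lambda>t. g (s, t)"] by (simp add: g_def)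
    also have "\<dots> = integral {0 - s..1 - s} (\<lambda>t. gauss_kernel s (t + s - s))"
      by (rule integral_shift_real_ivl[symmetric])
    also have "\<dots> = gauss_density s" using gauss_density_eq[of s "- s"] by simp
    finally show ?thesis .
  qed
  have "4 * pi * Wr \<gamma> = integral (cbox (0,0) (1,1)) g"
    by (simp add: Wr_def gauss_integral_def g_def[abs_def] gauss_kernel_def case_prod_unfold sq)
  also have "\<dots> = (LINT z:cbox (0,0) (1,1)|lborel. g z)"
    by (rule set_borel_integral_eq_integral(2)[OF gI, symmetric])
  also have "\<dots> = (LINT s|lborel. (LINT t|lborel. indicator (cbox (0,0) (1,1)) (s, t) *\<^sub>R g (s, t)))"
    using lborel_pair.integral_fst'[of "\<lambda>z. indicator (cbox (0,0) (1,1)) z *\<^sub>R g z"] gI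
    unfolding set_lebesgue_integral_def set_integrable_def lborel_prod by simp
  also have "\<dots> = (LINT s:{0..1}|lborel. gauss_density s)"
  proof -
    have eq: "indicator (cbox (0,0) (1,1)) (s, t) *\<^sub>R g (s, t) = indicator {0..1} s *\<^sub>R (indicator {0..1} t *\<^sub>R g (s, t))" for s t
      unfolding sq[symmetric] by (auto simp: indicator_def)
    have "(LINT t|lborel. indicator (cbox (0,0) (1,1)) (s, t) *\<^sub>R g (s, t)) = indicator {0..1} s *\<^sub>R gauss_density s" for s
      unfolding eq inner[symmetric] set_lebesgue_integral_def by simp
    then show ?thesis unfolding set_lebesgue_integral_def by simp
  qed
  also have "\<dots> = integral {0..1} gauss_density"
    by (intro set_borel_integral_eq_integral(2) borel_integrable_atLeastAtMost' continuous_on_gauss_density)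
  finally show ?thesis .
qed

lemma integral_gauss_density:
  "integral {a..a + of_nat n} gauss_density = of_nat n * (4 * pi * Wr \<gamma>)"
proof (induction n)
  case (Suc n)
  have int: "gauss_density integrable_on {x..y}" for x y
    by (intro integrable_continuous_real continuous_on_gauss_density)
  have "integral {a..a + of_nat n} gauss_density + integral {a + of_nat n..a + of_nat n + 1} gauss_density
      = integral {a..a + of_nat n + 1} gauss_density"
    by (intro Henstock_Kurzweil_Integration.integral_combine int) auto
  moreover have "integral {a + of_nat n..a + of_nat n + 1} gauss_density = 4 * pi * Wr \<gamma>"
    unfolding writhe_eq by (intro integral_shift_period int gauss_density_period)
  ultimately show ?case using Suc by (simp add: algebra_simps)
qed simp

lemma biot_eq:
  assumes "x \<in> - range \<gamma>"
  shows "biot x \<bullet> w = integral {-1/2..1/2} (\<lambda>u. bs x (a + u) \<bullet> w)"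
proof -
  have int: "(\<lambda>t. bs x t \<bullet> w) integrable_on {y..z}" for y z
    using integrable_linear[OF bs_integrable[OF assms] bounded_linear_inner_left] by (simp add: o_def)
  have "biot x \<bullet> w = integral {0..1} (\<lambda>t. bs x t \<bullet> w)"
    unfolding biot_def using integral_linear[OF bs_integrable[OF assms] bounded_linear_inner_left] by (simp add: o_def)
  also have "\<dots> = integral {a - 1/2..a - 1/2 + 1} (\<lambda>t. bs x t \<bullet> w)"
    using period[of _ 1] vel_period[of _ 1] by (intro integral_shift_period[symmetric] int) (simp add: bs_def)
  also have "\<dots> = integral {a - 1/2 - a..a - 1/2 + 1 - a} (\<lambda>t. bs x (t + a) \<bullet> w)"
    by (rule integral_shift_real_ivl[symmetric])
  finally show ?thesis by (simp add: add.commute)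
qed

end

section \<open>Integrated estimates for a pair of push-offs\<close>

context c11_curve
begin

text \<open>The first term on the right, with W the derivative of V, is 4 pi times the absolute
  twist density. The error \<epsilon> / D is not integrated directly: a threshold \<eta> lets the
  closed-form integral serve for it as well.\<close>

lemma averaged_biot_estimate:
  assumes N: "0 \<le> N"
  obtains C where "0 \<le> C"
    "\<And>\<epsilon> \<delta> \<eta> a V W p. \<lbrakk>0 < \<epsilon>; \<epsilon> \<le> eps_max; 0 \<le> \<delta>; \<delta> \<le> del_max; 0 < \<eta>; \<bar>V \<bullet> vel \<gamma> a\<bar> \<le> \<delta>;
      \<bar>(norm V)\<^sup>2 - 1\<bar> \<le> \<delta>; norm W \<le> N; \<bar>p\<bar> \<le> N\<rbrakk> \<Longrightarrow>
      \<bar>(biot (\<gamma> a + \<epsilon> *\<^sub>R V) \<bullet> (p *\<^sub>R vel \<gamma> a + \<epsilon> *\<^sub>R W) + biot (\<gamma> a - \<epsilon> *\<^sub>R V) \<bullet> (p *\<^sub>R vel \<gamma> a - \<epsilon> *\<^sub>R W)) / 2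
         - p * gauss_density a\<bar>
        \<le> 2 * \<bar>V \<bullet> cross3 W (vel \<gamma> a)\<bar> / norm (vel \<gamma> a) + C * (\<eta> + 2 * \<epsilon> / \<eta>\<^sup>2 + 2 * \<delta>)"
proof -
  obtain C where C: "0 \<le> C"
    "\<And>\<epsilon> \<delta> a u V W p. \<lbrakk>0 < \<epsilon>; \<epsilon> \<le> eps_max; 0 \<le> \<delta>; \<delta> \<le> del_max; \<bar>u\<bar> \<le> 1 / 2; \<bar>V \<bullet> vel \<gamma> a\<bar> \<le> \<delta>;
      \<bar>(norm V)\<^sup>2 - 1\<bar> \<le> \<delta>; norm W \<le> N; \<bar>p\<bar> \<le> N\<rbrakk> \<Longrightarrow>
      \<bar>averaged_kernel \<epsilon> p a V W u - p * gauss_kernel a u\<bar>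
        \<le> \<bar>V \<bullet> cross3 W (vel \<gamma> a)\<bar> * (\<epsilon>\<^sup>2 / sqrt ((norm (vel \<gamma> a))\<^sup>2 * u\<^sup>2 + \<epsilon>\<^sup>2) ^ 3)
          + C * (\<epsilon> / sqrt (u\<^sup>2 + \<epsilon>\<^sup>2) + \<delta> * (\<epsilon>\<^sup>2 / sqrt (u\<^sup>2 + \<epsilon>\<^sup>2) ^ 3))"
    using averaged_kernel_pointwise[OF N] by blast
  show ?thesis
  proof (rule that[OF C(1)])
    fix \<epsilon> \<delta> \<eta> a p :: real and V W :: E3
    assume h: "0 < \<epsilon>" "\<epsilon> \<le> eps_max" "0 \<le> \<delta>" "\<delta> \<le> del_max" "0 < \<eta>" "\<bar>V \<bullet> vel \<gamma> a\<bar> \<le> \<delta>"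
      "\<bar>(norm V)\<^sup>2 - 1\<bar> \<le> \<delta>" "norm W \<le> N" "\<bar>p\<bar> \<le> N"
    define T where "T = norm (vel \<gamma> a)"
    define X where "X = \<bar>V \<bullet> cross3 W (vel \<gamma> a)\<bar>"
    have T: "0 < T" unfolding T_def by (rule less_le_trans[OF m_pos vel_ge])
    define I where "I = (biot (\<gamma> a + \<epsilon> *\<^sub>R V) \<bullet> (p *\<^sub>R vel \<gamma> a + \<epsilon> *\<^sub>R W) + biot (\<gamma> a - \<epsilon> *\<^sub>R V) \<bullet> (p *\<^sub>R vel \<gamma> a - \<epsilon> *\<^sub>R W)) / 2"
    note off = push_off_off[OF h(6,7,1-4)]
    have int: "((\<lambda>u. bs x (a + u) \<bullet> w) has_integral (biot x \<bullet> w)) {-1/2..1/2}" if "x \<in> - range \<gamma>" for x w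
    proof -
      have "continuous_on {-1/2..1/2} (\<lambda>u. bs x (a + u))"
        by (rule continuous_on_bs) (use that in \<open>auto intro!: continuous_intros\<close>)
      then have "(\<lambda>u. bs x (a + u) \<bullet> w) integrable_on {-1/2..1/2}"
        by (intro integrable_continuous_real continuous_on_inner continuous_on_const)
      then show ?thesis unfolding biot_eq[OF that, of w a] by (rule integrable_integral)
    qed
    have "(averaged_kernel \<epsilon> p a V W has_integral I) {-1/2..1/2}"
      unfolding averaged_kernel_def[abs_def] I_def
      by (intro has_integral_divide has_integral_add int off)
    then have L: "((\<lambda>u. averaged_kernel \<epsilon> p a V W u - p * gauss_kernel a u) has_integral (I - p * gauss_density a)) {-1/2..1/2}"
      unfolding gauss_density_def
      by (intro has_integral_diff has_integral_mult_right integrable_integral gauss_kernel_integrable)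
    define J where "J u = \<epsilon>\<^sup>2 / sqrt (1\<^sup>2 * u\<^sup>2 + \<epsilon>\<^sup>2) ^ 3" for u
    define R where "R u = X * (\<epsilon>\<^sup>2 / sqrt (T\<^sup>2 * u\<^sup>2 + \<epsilon>\<^sup>2) ^ 3) + C * (\<eta> + (\<epsilon> / \<eta>\<^sup>2 + \<delta>) * J u)" for u
    have "((\<lambda>u::real. \<eta>) has_integral \<eta>) {-1/2..1/2}" using has_integral_const_real[of \<eta> "-1/2" "1/2"] by simp
    then have R: "(R has_integral (X * (1 / sqrt (T\<^sup>2 / 4 + \<epsilon>\<^sup>2)) + C * (\<eta> + (\<epsilon> / \<eta>\<^sup>2 + \<delta>) * (1 / sqrt (1\<^sup>2 / 4 + \<epsilon>\<^sup>2))))) {-1/2..1/2}"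
      unfolding R_def[abs_def] J_def
      by (intro has_integral_add has_integral_mult_right has_integral_inverse_cube h(1))
    have le: "\<bar>averaged_kernel \<epsilon> p a V W u - p * gauss_kernel a u\<bar> \<le> R u" if u: "u \<in> {-1/2..1/2}" for u
    proof -
      define D where "D = sqrt (u\<^sup>2 + \<epsilon>\<^sup>2)"
      have D: "0 < D" using h(1) by (simp add: D_def add_nonneg_pos)
      have JD: "J u = \<epsilon>\<^sup>2 / D ^ 3" by (simp add: J_def D_def)
      \<comment> \<open>If \<epsilon> / D exceeds \<eta>, then multiplying it by \<eta>^2 gives at
        most its cube, which is \<epsilon> \<open>J u\<close>.\<close>
      have "\<epsilon> / D \<le> \<eta> + \<epsilon> / \<eta>\<^sup>2 * J u"
      proof (cases "\<epsilon> / D \<le> \<eta>")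
        case True
        moreover have "0 \<le> \<epsilon> / \<eta>\<^sup>2 * J u" using h D by (simp add: JD)
        ultimately show ?thesis by linarith
      next
        case False
        then have "\<eta>\<^sup>2 \<le> (\<epsilon> / D)\<^sup>2" using h by (intro power_mono) auto
        then have "\<epsilon> / D * \<eta>\<^sup>2 \<le> \<epsilon> / D * (\<epsilon> / D)\<^sup>2" using h D by (intro mult_left_mono) auto
        also have "\<dots> = \<epsilon> * J u" by (simp add: JD power2_eq_square power3_eq_cube)
        finally have "\<epsilon> / D \<le> \<epsilon> * J u / \<eta>\<^sup>2" using h by (simp add: pos_le_divide_eq)
        then show ?thesis using h by simp
      qed
      then have "C * (\<epsilon> / D + \<delta> * J u) \<le> C * (\<eta> + (\<epsilon> / \<eta>\<^sup>2 + \<delta>) * J u)"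
        using C(1) by (intro mult_left_mono) (auto simp: algebra_simps)
      moreover have "\<bar>u\<bar> \<le> 1 / 2" using u by auto
      ultimately show ?thesis
        using C(2)[OF h(1-4) _ h(6-9), of u] unfolding R_def X_def T_def D_def[symmetric] JD by linarith
    qed
    have "\<bar>I - p * gauss_density a\<bar> \<le> X * (1 / sqrt (T\<^sup>2 / 4 + \<epsilon>\<^sup>2)) + C * (\<eta> + (\<epsilon> / \<eta>\<^sup>2 + \<delta>) * (1 / sqrt (1\<^sup>2 / 4 + \<epsilon>\<^sup>2)))"
      using integral_norm_bound_integral[OF has_integral_integrable[OF L] has_integral_integrable[OF R]] le
      unfolding integral_unique[OF L] integral_unique[OF R] by simp
    also have "\<dots> \<le> X * (2 / T) + C * (\<eta> + (\<epsilon> / \<eta>\<^sup>2 + \<delta>) * (2 / 1))"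
      using integral_inverse_cube_le[OF h(1) T] integral_inverse_cube_le[OF h(1), of 1] h C(1)
      by (intro add_mono mult_left_mono) (auto simp: X_def)
    also have "\<dots> = 2 * X / T + C * (\<eta> + 2 * \<epsilon> / \<eta>\<^sup>2 + 2 * \<delta>)" by (simp add: algebra_simps)
    finally show "\<bar>(biot (\<gamma> a + \<epsilon> *\<^sub>R V) \<bullet> (p *\<^sub>R vel \<gamma> a + \<epsilon> *\<^sub>R W) + biot (\<gamma> a - \<epsilon> *\<^sub>R V) \<bullet> (p *\<^sub>R vel \<gamma> a - \<epsilon> *\<^sub>R W)) / 2
         - p * gauss_density a\<bar>
        \<le> 2 * \<bar>V \<bullet> cross3 W (vel \<gamma> a)\<bar> / norm (vel \<gamma> a) + C * (\<eta> + 2 * \<epsilon> / \<eta>\<^sup>2 + 2 * \<delta>)"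
      by (simp only: I_def X_def T_def)
  qed
qed

text \<open>F is any integrable bound for the twist density. Since both push-offs have the same
  circulation L, so has their mean, and the pointwise estimate can be integrated along the
  curve.\<close>

lemma push_off_variation:
  assumes N: "0 \<le> N"
  obtains C where "0 \<le> C"
    "\<And>\<epsilon> \<delta> \<eta> \<theta> \<theta>' V V' F n L. \<lbrakk>0 < \<epsilon>; \<epsilon> \<le> eps_max; 0 \<le> \<delta>; \<delta> \<le> del_max; 0 < \<eta>;
      \<And>s. s \<in> {0..1} \<Longrightarrow> (\<theta> has_real_derivative \<theta>' s) (at s within {0..1});
      \<And>s. s \<in> {0..1} \<Longrightarrow> (V has_vector_derivative V' s) (at s within {0..1});
      continuous_on {0..1} \<theta>'; continuous_on {0..1} V'; \<theta> 1 = \<theta> 0 + of_nat n;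
      \<And>s. s \<in> {0..1} \<Longrightarrow> \<bar>V s \<bullet> vel \<gamma> (\<theta> s)\<bar> \<le> \<delta>; \<And>s. s \<in> {0..1} \<Longrightarrow> \<bar>(norm (V s))\<^sup>2 - 1\<bar> \<le> \<delta>;
      \<And>s. s \<in> {0..1} \<Longrightarrow> norm (V' s) \<le> N; \<And>s. s \<in> {0..1} \<Longrightarrow> \<bar>\<theta>' s\<bar> \<le> N;
      F integrable_on {0..1};
      \<And>s. s \<in> {0..1} \<Longrightarrow> 2 * \<bar>V s \<bullet> cross3 (V' s) (vel \<gamma> (\<theta> s))\<bar> / norm (vel \<gamma> (\<theta> s)) \<le> F s;
      cvar seg (\<lambda>s. \<gamma> (\<theta> s) + \<epsilon> *\<^sub>R V s) = L; cvar seg (\<lambda>s. \<gamma> (\<theta> s) - \<epsilon> *\<^sub>R V s) = L\<rbrakk> \<Longrightarrow>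
      \<bar>L - of_nat n * (4 * pi * Wr \<gamma>)\<bar> \<le> integral {0..1} F + C * (\<eta> + 2 * \<epsilon> / \<eta>\<^sup>2 + 2 * \<delta>)"
proof -
  obtain C where C: "0 \<le> C"
    "\<And>\<epsilon> \<delta> \<eta> a V W p. \<lbrakk>0 < \<epsilon>; \<epsilon> \<le> eps_max; 0 \<le> \<delta>; \<delta> \<le> del_max; 0 < \<eta>; \<bar>V \<bullet> vel \<gamma> a\<bar> \<le> \<delta>;
      \<bar>(norm V)\<^sup>2 - 1\<bar> \<le> \<delta>; norm W \<le> N; \<bar>p\<bar> \<le> N\<rbrakk> \<Longrightarrow>
      \<bar>(biot (\<gamma> a + \<epsilon> *\<^sub>R V) \<bullet> (p *\<^sub>R vel \<gamma> a + \<epsilon> *\<^sub>R W) + biot (\<gamma> a - \<epsilon> *\<^sub>R V) \<bullet> (p *\<^sub>R vel \<gamma> a - \<epsilon> *\<^sub>R W)) / 2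
         - p * gauss_density a\<bar>
        \<le> 2 * \<bar>V \<bullet> cross3 W (vel \<gamma> a)\<bar> / norm (vel \<gamma> a) + C * (\<eta> + 2 * \<epsilon> / \<eta>\<^sup>2 + 2 * \<delta>)"
    using averaged_biot_estimate[OF N] by blast
  show ?thesis
  proof (rule that[OF C(1)])
    fix \<epsilon> \<delta> \<eta> L :: real and \<theta> \<theta>' F :: "real \<Rightarrow> real" and V V' :: "real \<Rightarrow> E3" and n :: nat
    assume e: "0 < \<epsilon>" "\<epsilon> \<le> eps_max" "0 \<le> \<delta>" "\<delta> \<le> del_max" "0 < \<eta>"
      and d\<theta>: "\<And>s. s \<in> {0..1} \<Longrightarrow> (\<theta> has_real_derivative \<theta>' s) (at s within {0..1})"
      and dV: "\<And>s. s \<in> {0..1} \<Longrightarrow> (V has_vector_derivative V' s) (at s within {0..1})"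
      and c\<theta>': "continuous_on {0..1} \<theta>'" and cV': "continuous_on {0..1} V'" and per: "\<theta> 1 = \<theta> 0 + of_nat n"
      and V: "\<And>s. s \<in> {0..1} \<Longrightarrow> \<bar>V s \<bullet> vel \<gamma> (\<theta> s)\<bar> \<le> \<delta>" "\<And>s. s \<in> {0..1} \<Longrightarrow> \<bar>(norm (V s))\<^sup>2 - 1\<bar> \<le> \<delta>"
      and bd: "\<And>s. s \<in> {0..1} \<Longrightarrow> norm (V' s) \<le> N" "\<And>s. s \<in> {0..1} \<Longrightarrow> \<bar>\<theta>' s\<bar> \<le> N"
      and F: "F integrable_on {0..1}"
        "\<And>s. s \<in> {0..1} \<Longrightarrow> 2 * \<bar>V s \<bullet> cross3 (V' s) (vel \<gamma> (\<theta> s))\<bar> / norm (vel \<gamma> (\<theta> s)) \<le> F s"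
      and L: "cvar seg (\<lambda>s. \<gamma> (\<theta> s) + \<epsilon> *\<^sub>R V s) = L" "cvar seg (\<lambda>s. \<gamma> (\<theta> s) - \<epsilon> *\<^sub>R V s) = L"
    have c\<theta>: "continuous_on {0..1} \<theta>" using d\<theta> DERIV_continuous_on by blast
    have cV: "continuous_on {0..1} V" using dV has_vector_derivative_continuous
      unfolding continuous_on_eq_continuous_within by blast
    define T where "T s = vel \<gamma> (\<theta> s)" for s
    note cc = continuous_on_curve[OF c\<theta>]
    have d\<gamma>: "((\<lambda>s. \<gamma> (\<theta> s)) has_vector_derivative (\<theta>' s *\<^sub>R T s)) (at s within {0..1})" if "s \<in> {0..1}" for s
      using vector_diff_chain_within[OF d\<theta>[OF that, unfolded has_real_derivative_iff_has_vector_derivative] vd]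
      by (simp add: o_def T_def)
    have dp: "((\<lambda>s. \<gamma> (\<theta> s) + \<epsilon> *\<^sub>R V s) has_vector_derivative (\<theta>' s *\<^sub>R T s + \<epsilon> *\<^sub>R V' s)) (at s within {0..1})"
      "((\<lambda>s. \<gamma> (\<theta> s) - \<epsilon> *\<^sub>R V s) has_vector_derivative (\<theta>' s *\<^sub>R T s - \<epsilon> *\<^sub>R V' s)) (at s within {0..1})"
      if "s \<in> {0..1}" for s
      using bounded_linear.has_vector_derivative[OF bounded_linear_scaleR_right dV[OF that], of \<epsilon>] d\<gamma>[OF that]
      by (auto intro: has_vector_derivative_add has_vector_derivative_diff)
    have off: "\<gamma> (\<theta> s) + \<epsilon> *\<^sub>R V s \<in> - range \<gamma>" "\<gamma> (\<theta> s) - \<epsilon> *\<^sub>R V s \<in> - range \<gamma>" if "s \<in> {0..1}" for s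
      using push_off_off[OF V[OF that] e(1-4)] by auto
    define P where "P s = biot (\<gamma> (\<theta> s) + \<epsilon> *\<^sub>R V s) \<bullet> (\<theta>' s *\<^sub>R T s + \<epsilon> *\<^sub>R V' s)" for s
    define Q where "Q s = biot (\<gamma> (\<theta> s) - \<epsilon> *\<^sub>R V s) \<bullet> (\<theta>' s *\<^sub>R T s - \<epsilon> *\<^sub>R V' s)" for s
    have cT: "continuous_on {0..1} T" unfolding T_def by (rule cc(2))
    have cP: "continuous_on {0..1} P" "continuous_on {0..1} Q"
      unfolding P_def Q_def
      by (intro continuous_on_inner continuous_on_biot_compose continuous_on_add continuous_on_diff
          continuous_on_scaleR continuous_on_const cc cV cV' c\<theta>' cT off; assumption)+
    have LP: "integral {0..1} P = L"
      unfolding P_def L(1)[symmetric]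
      by (rule cvar_seg[symmetric, OF dp(1) _ off(1)])
        (intro continuous_intros c\<theta>' cT cV' | assumption)+
    have LQ: "integral {0..1} Q = L"
      unfolding Q_def L(2)[symmetric]
      by (rule cvar_seg[symmetric, OF dp(2) _ off(2)])
        (intro continuous_intros c\<theta>' cT cV' | assumption)+
    have W: "((\<lambda>s. \<theta>' s * gauss_density (\<theta> s)) has_integral (of_nat n * (4 * pi * Wr \<gamma>))) {0..1}"
    proof -
      have "bounded (\<theta> ` {0..1})" by (intro compact_imp_bounded compact_continuous_image c\<theta>) auto
      then obtain B where "\<forall>x\<in>\<theta> ` {0..1}. norm x \<le> B" unfolding bounded_iff by blast
      then have B: "\<And>s. s \<in> {0..1} \<Longrightarrow> \<bar>\<theta> s\<bar> \<le> B" by simp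
      \<comment> \<open>\<theta> may run back and forth: the substitution asks only that its range
        lie in an interval on which \<open>gauss_density\<close> is continuous. From its ends it
        sees n full periods.\<close>
      have "((\<lambda>s. \<theta>' s *\<^sub>R gauss_density (\<theta> s)) has_integral (integral {\<theta> 0..\<theta> 1} gauss_density)) {0..1}"
        by (rule has_integral_substitution[where c = "- B" and d = B])
          (use per d\<theta> B continuous_on_gauss_density in \<open>auto simp: abs_le_iff minus_le_iff\<close>)
      then show ?thesis unfolding per integral_gauss_density by simp
    qed
    have D: "((\<lambda>s. (P s + Q s) / 2 - \<theta>' s * gauss_density (\<theta> s)) has_integral ((L + L) / 2 - of_nat n * (4 * pi * Wr \<gamma>))) {0..1}"
      using integrable_integral[OF integrable_continuous_real[OF cP(1)]] integrable_integral[OF integrable_continuous_real[OF cP(2)]]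
      unfolding LP LQ by (intro has_integral_diff has_integral_divide has_integral_add W)
    define k where "k = C * (\<eta> + 2 * \<epsilon> / \<eta>\<^sup>2 + 2 * \<delta>)"
    have R: "((\<lambda>s. F s + k) has_integral (integral {0..1} F + k)) {0..1}"
      using has_integral_add[OF integrable_integral[OF F(1)] has_integral_const_real[of k 0 1]] by simp
    have "\<bar>(P s + Q s) / 2 - \<theta>' s * gauss_density (\<theta> s)\<bar> \<le> F s + k" if s: "s \<in> {0..1}" for s
      using C(2)[OF e V[OF s] bd[OF s]] F(2)[OF s] unfolding P_def Q_def T_def k_def by linarith
    then have "\<bar>(L + L) / 2 - of_nat n * (4 * pi * Wr \<gamma>)\<bar> \<le> integral {0..1} F + k"
      using integral_norm_bound_integral[OF has_integral_integrable[OF D] has_integral_integrable[OF R]]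
      unfolding integral_unique[OF D] integral_unique[OF R] by simp
    then show "\<bar>L - of_nat n * (4 * pi * Wr \<gamma>)\<bar> \<le> integral {0..1} F + C * (\<eta> + 2 * \<epsilon> / \<eta>\<^sup>2 + 2 * \<delta>)"
      by (simp add: k_def)
  qed
qed

end

section \<open>Push-offs of curves on the tube\<close>

lemma cvar_free_homotopy:
  fixes H :: "real \<times> real \<Rightarrow> 'a::metric_space"
  assumes w: "cocycle_on U w" and H: "continuous_on ({0..1} \<times> {0..1}) H"
    "\<And>l s. l \<in> {0..1} \<Longrightarrow> s \<in> {0..1} \<Longrightarrow> H (l, s) \<in> U" "\<And>l. l \<in> {0..1} \<Longrightarrow> H (l, 0) = H (l, 1)"
  shows "cvar w (\<lambda>s. H (0, s)) = cvar w (\<lambda>s. H (1, s))"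
proof -
  have "cvar w (\<lambda>t. H (t, 0)) = cvar w (\<lambda>t. H (t, 1))" by (rule cvar_cong) (rule H(3))
  moreover have "H ` ({0..1} \<times> {0..1}) \<subseteq> U" using H(2) by auto
  ultimately show ?thesis using cvar_square[OF w H(1)] by simp
qed

lemma lipschitz_continuous_on:
  fixes f :: "real \<Rightarrow> 'a::real_normed_vector"
  assumes "\<And>s t. s \<in> S \<Longrightarrow> t \<in> S \<Longrightarrow> norm (f s - f t) \<le> L * \<bar>s - t\<bar>" "0 \<le> L"
  shows "continuous_on S f"
proof -
  have "L-lipschitz_on S f" using assms by (simp add: lipschitz_on_def dist_norm)
  then show ?thesis by (rule lipschitz_on_continuous_on)
qed

text \<open>The window average of a Lipschitz function is C^1, its derivative being a difference
  quotient. The function lives on [0, 2] so that windows starting in [0, 1] fit.\<close>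

lemma steklov_average:
  fixes f :: "real \<Rightarrow> 'a::euclidean_space"
  assumes lip: "\<And>s t. s \<in> {0..2} \<Longrightarrow> t \<in> {0..2} \<Longrightarrow> norm (f s - f t) \<le> L * \<bar>s - t\<bar>" and "0 \<le> L"
    and h: "0 < h" "h \<le> 1" and s: "s \<in> {0..1}"
  shows "((\<lambda>s. (1 / h) *\<^sub>R integral {s..s + h} f) has_vector_derivative (1 / h) *\<^sub>R (f (s + h) - f s)) (at s within {0..1})"
    and "norm ((1 / h) *\<^sub>R integral {s..s + h} f - f s) \<le> L * h"
    and "norm ((1 / h) *\<^sub>R (f (s + h) - f s)) \<le> L"
    and "(\<And>t. t \<in> {0..2} \<Longrightarrow> norm (f t) \<le> K) \<Longrightarrow> 0 \<le> K \<Longrightarrow> norm ((1 / h) *\<^sub>R integral {s..s + h} f) \<le> K"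
proof -
  have cf: "continuous_on {0..2} f" by (rule lipschitz_continuous_on[OF lip \<open>0 \<le> L\<close>])
  have int: "f integrable_on {a..b}" if "0 \<le> a" "b \<le> 2" for a b
    by (rule integrable_continuous_real[OF continuous_on_subset[OF cf]]) (use that in auto)
  define I where "I x = integral {0..x} f" for x
  have I: "(I has_vector_derivative f x) (at x within {0..2})" if "x \<in> {0..2}" for x
    unfolding I_def[abs_def] by (rule integral_has_vector_derivative[OF cf that])
  have eq: "(1 / h) *\<^sub>R (I (t + h) - I t) = (1 / h) *\<^sub>R integral {t..t + h} f" if "t \<in> {0..1}" for t
  proof -
    have "integral {0..t} f + integral {t..t + h} f = integral {0..t + h} f"
      using that h by (intro Henstock_Kurzweil_Integration.integral_combine int) auto
    then have "I (t + h) - I t = integral {t..t + h} f" by (simp add: I_def algebra_simps)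
    then show ?thesis by simp
  qed
  have "((\<lambda>t. t + h) has_vector_derivative 1) (at s within {0..1})"
    by (auto intro!: derivative_eq_intros)
  moreover have "(I has_vector_derivative f (s + h)) (at (s + h) within (\<lambda>t. t + h) ` {0..1})"
    by (rule has_vector_derivative_within_subset[OF I]) (use s h in auto)
  ultimately have "((\<lambda>t. I (t + h)) has_vector_derivative f (s + h)) (at s within {0..1})"
    using vector_diff_chain_within[of "\<lambda>t. t + h" 1 s "{0..1}" I "f (s + h)"] by (simp add: o_def)
  moreover have "(I has_vector_derivative f s) (at s within {0..1})"
    by (rule has_vector_derivative_within_subset[OF I]) (use s in auto)
  ultimately have "((\<lambda>t. (1 / h) *\<^sub>R (I (t + h) - I t)) has_vector_derivative (1 / h) *\<^sub>R (f (s + h) - f s)) (at s within {0..1})"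
    by (intro bounded_linear.has_vector_derivative[OF bounded_linear_scaleR_right] has_vector_derivative_diff)
  then show "((\<lambda>s. (1 / h) *\<^sub>R integral {s..s + h} f) has_vector_derivative (1 / h) *\<^sub>R (f (s + h) - f s)) (at s within {0..1})"
    by (rule has_vector_derivative_transform[OF s, rotated]) (rule eq[symmetric])
  have hi: "(f has_integral integral {s..s + h} f) {s..s + h}"
    using s h by (intro integrable_integral int) auto
  have "((\<lambda>t. f t - f s) has_integral (integral {s..s + h} f - h *\<^sub>R f s)) {s..s + h}"
    using has_integral_diff[OF hi has_integral_const_real[of "f s" s "s + h"]] h by simp
  moreover have "norm (f t - f s) \<le> L * h" if "t \<in> {s..s + h}" for t
  proof -
    have "norm (f t - f s) \<le> L * \<bar>t - s\<bar>" using that s h by (intro lip) auto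
    also have "\<dots> \<le> L * h" using that \<open>0 \<le> L\<close> by (intro mult_left_mono) auto
    finally show ?thesis .
  qed
  ultimately have "norm (integral {s..s + h} f - h *\<^sub>R f s) \<le> L * h * measure lborel {s..s + h}"
    using \<open>0 \<le> L\<close> h by (intro has_integral_bound_real[of _ "{}"]) auto
  then have le: "norm (integral {s..s + h} f - h *\<^sub>R f s) \<le> L * h * h" using h by simp
  have "(1 / h) *\<^sub>R integral {s..s + h} f - f s = (1 / h) *\<^sub>R (integral {s..s + h} f - h *\<^sub>R f s)"
    using h by (simp add: scaleR_diff_right)
  then have "norm ((1 / h) *\<^sub>R integral {s..s + h} f - f s) = norm (integral {s..s + h} f - h *\<^sub>R f s) / h"
    using h by simp
  also have "\<dots> \<le> L * h * h / h" using le h by (intro divide_right_mono) auto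
  finally show "norm ((1 / h) *\<^sub>R integral {s..s + h} f - f s) \<le> L * h" using h by simp
  have "norm (f (s + h) - f s) \<le> L * \<bar>s + h - s\<bar>" using s h by (intro lip) auto
  then show "norm ((1 / h) *\<^sub>R (f (s + h) - f s)) \<le> L" using h by (simp add: divide_le_eq)
  show "norm ((1 / h) *\<^sub>R integral {s..s + h} f) \<le> K" if "\<And>t. t \<in> {0..2} \<Longrightarrow> norm (f t) \<le> K" "0 \<le> K"
  proof -
    have "norm (integral {s..s + h} f) \<le> K * measure lborel {s..s + h}"
      using that s h by (intro has_integral_bound_real[OF _ _ hi, of _ "{}"]) auto
    then show ?thesis using h by (simp add: divide_le_eq)
  qed
qed

section \<open>Lifting a curve on the torus to a parameter and a unit normal\<close>

context thick_curve
begin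

text \<open>The two cocycles read off the two coordinates. The circulation is 4 pi on the meridian
  and 0 on the longitude by their linking numbers; the turn is 0 on the meridian, which contracts in
  the tube, and 1 on the longitude, which is homotopic to the core.\<close>

lemma cvar_of_torus_class:
  assumes "torus_class \<gamma> \<beta> p q"
  shows "cvar seg \<beta> = 4 * pi * of_int p" "cvar turn \<beta> = of_int q"
proof -
  obtain \<mu> l where ml: "is_meridian \<gamma> \<mu>" "is_longitude \<gamma> l"
    and w: "\<And>w. cocycle_on (torus \<gamma>) w \<Longrightarrow> cvar w \<beta> = of_int p * cvar w \<mu> + of_int q * cvar w l"
    using cvar_torus_class[OF assms] by blast
  have m: "closed_curve \<mu>" "range \<mu> \<subseteq> torus \<gamma>" "lk \<mu> \<gamma> = 1"
    and l: "closed_curve l" "range l \<subseteq> torus \<gamma>" "lk l \<gamma> = 0" "homotopic_loops (tube \<gamma>) l \<gamma>"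
    using ml by (auto simp: is_meridian_def is_longitude_def)
  obtain a where a: "homotopic_loops (tube \<gamma>) \<mu> (\<lambda>_. a)" using ml(1) by (auto simp: is_meridian_def)
  have off: "range \<mu> \<subseteq> - range \<gamma>" "range l \<subseteq> - range \<gamma>" using m(2) l(2) torus_off_axis by blast+
  show "cvar seg \<beta> = 4 * pi * of_int p"
    using w[OF cocycle_on_subset[OF cocycle_seg torus_off_axis]]
      cvar_seg_lk[OF m(1) off(1)] cvar_seg_lk[OF l(1) off(2)] m(3) l(3) by simp
  have "a \<in> tube \<gamma>" using homotopic_loops_imp_subset[OF a] by (auto simp: path_image_def)
  then have "cvar turn \<mu> = 0"
    using cvar_homotopic_loops[OF cocycle_turn a] cvar_const[OF cocycle_turn] by simp
  moreover have "cvar turn l = 1"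
    using cvar_homotopic_loops[OF cocycle_turn l(4)] cvar_turn_core by simp
  ultimately show "cvar turn \<beta> = of_int q"
    using w[OF cocycle_on_subset[OF cocycle_turn torus_subset_tube]] by simp
qed

lemma curve_lipschitz: "norm (\<gamma> a - \<gamma> b) \<le> A * \<bar>a - b\<bar>"
proof -
  have "norm (\<gamma> a - \<gamma> b) \<le> A * norm (a - b)"
  proof (rule differentiable_bound[where S = UNIV])
    fix x :: real
    show "(\<gamma> has_derivative (\<lambda>h. h *\<^sub>R vel \<gamma> x)) (at x within UNIV)"
      using vd[of x UNIV] by (simp add: has_vector_derivative_def)
    show "onorm (\<lambda>h. h *\<^sub>R vel \<gamma> x) \<le> A"
      using vel_le[of x] A_pos by (intro onorm_bound) (auto simp: mult.commute[of A] intro!: mult_left_mono)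
  qed auto
  then show ?thesis by simp
qed

end

lemma closed_curve_lipschitz:
  assumes "closed_curve \<beta>"
  obtains B where "0 \<le> B" "\<And>s t. norm (\<beta> s - \<beta> t) \<le> B * \<bar>s - t\<bar>"
proof -
  have "continuous_on {0..1} (\<lambda>t. norm (vel \<beta> t))"
    by (intro continuous_on_norm closed_curve_continuous_vel[OF assms])
  then obtain t0 where t0: "\<And>t. t \<in> {0..1} \<Longrightarrow> norm (vel \<beta> t) \<le> norm (vel \<beta> t0)"
    using continuous_attains_sup[of "{0..1::real}" "\<lambda>t. norm (vel \<beta> t)"] by fastforce
  have B: "norm (vel \<beta> t) \<le> norm (vel \<beta> t0)" for t
    using t0[of "frac t"] closed_curve_vel_period[OF assms, of "frac t" "\<lfloor>t\<rfloor>"]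
    by (simp add: frac_def frac_lt_1[unfolded frac_def] less_imp_le floor_le_iff)
  have "norm (\<beta> s - \<beta> t) \<le> norm (vel \<beta> t0) * norm (s - t)" for s t
  proof (rule differentiable_bound[where S = UNIV])
    fix x :: real
    show "(\<beta> has_derivative (\<lambda>h. h *\<^sub>R vel \<beta> x)) (at x within UNIV)"
      using closed_curve_has_vector_derivative[OF assms, of x UNIV] by (simp add: has_vector_derivative_def)
    show "onorm (\<lambda>h. h *\<^sub>R vel \<beta> x) \<le> norm (vel \<beta> t0)"
      using B[of x] by (intro onorm_bound) (auto simp: mult.commute[of "norm (vel \<beta> t0)"] intro!: mult_left_mono)
  qed auto
  then show ?thesis using that[of "norm (vel \<beta> t0)"] by simp
qed

context thick_curve
begin

text \<open>The lift covers two periods, to leave room for averaging windows. The unit normal is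
  twice the offset because the tube has radius 1/2.\<close>

lemma lift_exists:
  assumes \<beta>: "closed_curve \<beta>" "range \<beta> \<subseteq> torus \<gamma>" and q: "cvar turn \<beta> = q"
  obtains \<theta> v L where "0 \<le> L"
    "\<And>s. s \<in> {0..2} \<Longrightarrow> \<beta> s = \<gamma> (\<theta> s) + (1 / 2) *\<^sub>R v s"
    "\<And>s. s \<in> {0..2} \<Longrightarrow> v s \<bullet> vel \<gamma> (\<theta> s) = 0" "\<And>s. s \<in> {0..2} \<Longrightarrow> norm (v s) = 1"
    "\<And>s t. s \<in> {0..2} \<Longrightarrow> t \<in> {0..2} \<Longrightarrow> norm (\<theta> s - \<theta> t) \<le> L * \<bar>s - t\<bar>"
    "\<And>s t. s \<in> {0..2} \<Longrightarrow> t \<in> {0..2} \<Longrightarrow> norm (v s - v t) \<le> L * \<bar>s - t\<bar>"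
    "\<And>s. s \<in> {0..1} \<Longrightarrow> \<theta> (s + 1) = \<theta> s + q" "\<And>s. s \<in> {0..1} \<Longrightarrow> v (s + 1) = v s"
proof -
  have tub: "\<beta> s \<in> tube \<gamma>" for s using \<beta>(2) torus_subset_tube by blast
  obtain B where B: "0 \<le> B" "\<And>s t. norm (\<beta> s - \<beta> t) \<le> B * \<bar>s - t\<bar>"
    using closed_curve_lipschitz[OF \<beta>(1)] by blast
  obtain P0 where P0: "primitive_along turn \<beta> {0..2} P0"
    using primitive_along_interval[OF cocycle_turn closed_curve_continuous[OF \<beta>(1)], of 0 2] tub by auto
  \<comment> \<open>The additive constant makes the value at 0 a genuine foot parameter, as
    \<open>lift_foot\<close> requires.\<close>
  define \<theta> where "\<theta> s = P0 s - P0 0 + foot (\<beta> 0)" for s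
  have P: "primitive_along turn \<beta> {0..2} \<theta>" using P0 by (simp add: primitive_along_def \<theta>_def)
  have Ps: "primitive_along turn \<beta> {0..s} \<theta>" if "s \<in> {0..2}" for s
    by (rule primitive_along_subset[OF P]) (use that in auto)
  have ft: "\<gamma> (\<theta> s) = \<gamma> (foot (\<beta> s))" "vel \<gamma> (\<theta> s) = vel \<gamma> (foot (\<beta> s))" if "s \<in> {0..2}" for s
    using lift_foot[OF Ps[OF that]] that by (auto simp: \<theta>_def)
  \<comment> \<open>Uniqueness of tube coordinates identifies the offset from the chosen foot with
    the one of length 1/2 on the frontier.\<close>
  have nrm: "norm (\<beta> s - \<gamma> (foot (\<beta> s))) = 1 / 2" for s
  proof -
    obtain t w where w: "\<beta> s = \<gamma> t + w" "w \<bullet> vel \<gamma> t = 0" "norm w = 1 / 2"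
      using \<beta>(2) torusE by blast
    have "w = \<beta> s - \<gamma> (foot (\<beta> s))"
      using tube_unique[of t w "foot (\<beta> s)" "\<beta> s - \<gamma> (foot (\<beta> s))"] w foot[OF tub[of s]] by simp
    then show ?thesis using w(3) by simp
  qed
  define v where "v s = 2 *\<^sub>R (\<beta> s - \<gamma> (\<theta> s))" for s
  define L\<theta> where "L\<theta> = 3 / c * B"
  define L where "L = L\<theta> + 2 * (B + A * L\<theta>)"
  have L\<theta>0: "0 \<le> L\<theta>" using B c_pos by (simp add: L\<theta>_def)
  have lip\<theta>: "\<bar>\<theta> s - \<theta> t\<bar> \<le> L\<theta> * \<bar>s - t\<bar>" if "s \<in> {0..2}" "t \<in> {0..2}" for s t
  proof (cases "s \<le> t")
    case True
    have "\<bar>\<theta> t - \<theta> s\<bar> \<le> 3 / c * B * (t - s)"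
      by (rule lift_lipschitz[OF P _ B(2) True]) (use tub that in auto)
    then show ?thesis using True by (simp add: L\<theta>_def abs_minus_commute)
  next
    case False
    have "\<bar>\<theta> s - \<theta> t\<bar> \<le> 3 / c * B * (s - t)"
      by (rule lift_lipschitz[OF P _ B(2)]) (use tub that False in auto)
    then show ?thesis using False by (simp add: L\<theta>_def)
  qed
  show ?thesis
  proof (rule that[of L \<theta> v])
    show "0 \<le> L" using L\<theta>0 B A_pos by (simp add: L_def)
    show "\<beta> s = \<gamma> (\<theta> s) + (1 / 2) *\<^sub>R v s" for s by (simp add: v_def)
    show "v s \<bullet> vel \<gamma> (\<theta> s) = 0" "norm (v s) = 1" if "s \<in> {0..2}" for s
      using foot(1)[OF tub[of s]] nrm[of s] ft[OF that] by (simp_all add: v_def)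
    show "norm (\<theta> s - \<theta> t) \<le> L * \<bar>s - t\<bar>" if "s \<in> {0..2}" "t \<in> {0..2}" for s t
    proof -
      have "L\<theta> * \<bar>s - t\<bar> \<le> L * \<bar>s - t\<bar>"
        using L\<theta>0 B A_pos by (intro mult_right_mono) (auto simp: L_def)
      then show ?thesis using lip\<theta>[OF that] by simp
    qed
    show "norm (v s - v t) \<le> L * \<bar>s - t\<bar>" if "s \<in> {0..2}" "t \<in> {0..2}" for s t
    proof -
      have "v s - v t = 2 *\<^sub>R ((\<beta> s - \<beta> t) - (\<gamma> (\<theta> s) - \<gamma> (\<theta> t)))"
        by (simp add: v_def scaleR_diff_right)
      then have "norm (v s - v t) = 2 * norm ((\<beta> s - \<beta> t) - (\<gamma> (\<theta> s) - \<gamma> (\<theta> t)))" by simp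
      also have "\<dots> \<le> 2 * (norm (\<beta> s - \<beta> t) + norm (\<gamma> (\<theta> s) - \<gamma> (\<theta> t)))"
        using norm_triangle_ineq4 by (intro mult_left_mono) auto
      also have "\<dots> \<le> 2 * (B * \<bar>s - t\<bar> + A * (L\<theta> * \<bar>s - t\<bar>))"
      proof -
        have "A * \<bar>\<theta> s - \<theta> t\<bar> \<le> A * (L\<theta> * \<bar>s - t\<bar>)" using lip\<theta>[OF that] A_pos by (intro mult_left_mono) auto
        then show ?thesis using B(2)[of s t] curve_lipschitz[of "\<theta> s" "\<theta> t"] by simp
      qed
      also have "\<dots> = (L - L\<theta>) * \<bar>s - t\<bar>" by (simp add: L_def algebra_simps)
      also have "\<dots> \<le> L * \<bar>s - t\<bar>" using L\<theta>0 by (intro mult_right_mono) auto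
      finally show ?thesis .
    qed
    have per: "\<beta> (s + 1) = \<beta> s" for s using closed_curve_period[OF \<beta>(1), of s 1] by simp
    have P1: "primitive_along turn \<beta> {0..1} \<theta>" by (rule primitive_along_subset[OF P]) auto
    \<comment> \<open>The lift shifted by a period is another primitive along the same curve, so it
      differs from \<theta> by a constant, the total turn q.\<close>
    have "primitive_along turn (\<lambda>s. \<beta> (s + 1)) {0..1} (\<lambda>s. \<theta> (s + 1))"
      by (rule primitive_along_compose[OF P]) (auto intro!: continuous_intros)
    then have P2: "primitive_along turn \<beta> {0..1} (\<lambda>s. \<theta> (s + 1))" by (simp add: per)
    show th1: "\<theta> (s + 1) = \<theta> s + q" if "s \<in> {0..1}" for s
      using primitive_along_unique[OF P2 P1, of s 0] that cvar_eq[OF P1] q by simp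
    show "v (s + 1) = v s" if "s \<in> {0..1}" for s
    proof -
      have "\<gamma> (\<theta> (s + 1)) = \<gamma> (\<theta> s)" using ft(1)[of "s + 1"] ft(1)[of s] that by (simp add: per)
      then show ?thesis by (simp add: v_def per)
    qed
  qed
qed

end

context thick_curve
begin

text \<open>The defect is linear in the displacement d: A comes from moving the normal, M from
  moving the foot, and 2 bounds |V + v| in the difference of squares.\<close>

lemma near_frame:
  assumes v: "v \<bullet> vel \<gamma> t = 0" "norm v = 1" and V: "norm (V - v) \<le> d" "norm V \<le> 1" and a: "\<bar>a - t\<bar> \<le> d"
  shows "\<bar>V \<bullet> vel \<gamma> a\<bar> \<le> (A + M + 2) * d" "\<bar>(norm V)\<^sup>2 - 1\<bar> \<le> (A + M + 2) * d"
proof -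
  have d: "0 \<le> d" using a by linarith
  have "V \<bullet> vel \<gamma> a = (V - v) \<bullet> vel \<gamma> a + v \<bullet> (vel \<gamma> a - vel \<gamma> t)"
    using v by (simp add: inner_diff_left inner_diff_right)
  also have "\<bar>\<dots>\<bar> \<le> norm (V - v) * norm (vel \<gamma> a) + norm v * norm (vel \<gamma> a - vel \<gamma> t)"
    by (intro order_trans[OF abs_triangle_ineq] add_mono Cauchy_Schwarz_ineq2)
  also have "\<dots> \<le> d * A + 1 * (M * d)"
    using V v d vel_le[of a] A_pos M_nonneg order_trans[OF vel_lipschitz[of a t] mult_left_mono[OF a M_nonneg]]
    by (intro add_mono mult_mono) auto
  also have "\<dots> \<le> (A + M + 2) * d" using d by (simp add: algebra_simps)
  finally show "\<bar>V \<bullet> vel \<gamma> a\<bar> \<le> (A + M + 2) * d" .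
  have "(norm V)\<^sup>2 - 1 = (V - v) \<bullet> (V + v)"
    using v(2) by (simp add: power2_norm_eq_inner norm_eq_1 inner_diff_left inner_add_right inner_commute[of v V])
  also have "\<bar>\<dots>\<bar> \<le> norm (V - v) * norm (V + v)" by (rule Cauchy_Schwarz_ineq2)
  also have "\<dots> \<le> d * 2" using V v(2) d norm_triangle_ineq[of V v] by (intro mult_mono) auto
  also have "\<dots> \<le> (A + M + 2) * d" using d A_pos M_nonneg by (simp add: algebra_simps)
  finally show "\<bar>(norm V)\<^sup>2 - 1\<bar> \<le> (A + M + 2) * d" .
qed

text \<open>Three homotopies off the curve: the offset shrinks from 1/2 to \<epsilon>, the normal
  turns through a half circle in the normal plane, and the exact data are interpolated linearly to
  the averaged ones. The last one leaves the normal bundle, but only within the defect that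
  \<open>push_off_off\<close> tolerates.\<close>

lemma cvar_push_off:
  fixes \<theta> \<theta>h :: "real \<Rightarrow> real" and v Vh :: "real \<Rightarrow> E3" and n :: nat
  assumes c: "continuous_on {0..1} \<theta>" "continuous_on {0..1} v" "continuous_on {0..1} \<theta>h" "continuous_on {0..1} Vh"
    and \<beta>: "\<And>s. s \<in> {0..1} \<Longrightarrow> \<beta> s = \<gamma> (\<theta> s) + (1 / 2) *\<^sub>R v s"
    and v: "\<And>s. s \<in> {0..1} \<Longrightarrow> v s \<bullet> vel \<gamma> (\<theta> s) = 0" "\<And>s. s \<in> {0..1} \<Longrightarrow> norm (v s) = 1"
    and per: "\<theta> 1 = \<theta> 0 + of_nat n" "v 1 = v 0" "\<theta>h 1 = \<theta>h 0 + of_nat n" "Vh 1 = Vh 0"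
    and near: "\<And>s. s \<in> {0..1} \<Longrightarrow> \<bar>\<theta>h s - \<theta> s\<bar> \<le> d" "\<And>s. s \<in> {0..1} \<Longrightarrow> norm (Vh s - v s) \<le> d"
      "\<And>s. s \<in> {0..1} \<Longrightarrow> norm (Vh s) \<le> 1"
    and d: "0 \<le> d" "(A + M + 2) * d \<le> del_max" and e: "0 < \<epsilon>" "\<epsilon> \<le> eps_max" "\<epsilon> \<le> 1 / 2"
  shows "cvar seg (\<lambda>s. \<gamma> (\<theta>h s) + \<epsilon> *\<^sub>R Vh s) = cvar seg \<beta>"
    and "cvar seg (\<lambda>s. \<gamma> (\<theta>h s) - \<epsilon> *\<^sub>R Vh s) = cvar seg \<beta>"
proof -
  define Q where "Q = {0..1::real} \<times> {0..1::real}"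
  have cQ: "continuous_on Q (\<lambda>z. f (snd z))" if "continuous_on {0..1} f" for f :: "real \<Rightarrow> 'b::metric_space"
    by (rule continuous_on_compose2[OF that]) (auto simp: Q_def intro!: continuous_intros)
  have per\<gamma>: "\<gamma> (\<theta> 1) = \<gamma> (\<theta> 0)" "vel \<gamma> (\<theta> 1) = vel \<gamma> (\<theta> 0)"
    using period[of "\<theta> 0" "int n"] vel_period[of "\<theta> 0" "int n"] by (simp_all add: per)
  have tube: "\<gamma> (\<theta> s) + w \<in> - range \<gamma>" if "s \<in> {0..1}" "w \<bullet> vel \<gamma> (\<theta> s) = 0" "0 < norm w" "norm w < 1" for s w
    using off_axis[of w "\<theta> s"] that by auto
  have 1: "cvar seg \<beta> = cvar seg (\<lambda>s. \<gamma> (\<theta> s) + \<epsilon> *\<^sub>R v s)"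
  proof -
    define H where "H z = \<gamma> (\<theta> (snd z)) + ((1 - fst z) / 2 + fst z * \<epsilon>) *\<^sub>R v (snd z)" for z
    have "cvar seg (\<lambda>s. H (0, s)) = cvar seg (\<lambda>s. H (1, s))"
    proof (rule cvar_free_homotopy[OF cocycle_seg])
      show "continuous_on ({0..1} \<times> {0..1}) H"
        unfolding H_def Q_def[symmetric]
        by (intro continuous_intros continuous_on_curve cQ c) auto
      fix l s :: real assume ls: "l \<in> {0..1}" "s \<in> {0..1}"
      have "0 < (1 - l) / 2 + l * \<epsilon>"
        using ls e by (cases "l = 0") (auto intro!: add_nonneg_pos)
      moreover have "(1 - l) / 2 + l * \<epsilon> \<le> (1 - l) / 2 + l * (1 / 2)"
        using ls e by (intro add_left_mono mult_left_mono) auto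
      ultimately show "H (l, s) \<in> - range \<gamma>"
        unfolding H_def using v ls by (intro tube) (auto simp: field_simps)
    next
      show "H (l, 0) = H (l, 1)" for l by (simp add: H_def per\<gamma> per(2))
    qed
    moreover have "cvar seg (\<lambda>s. H (0, s)) = cvar seg \<beta>"
      by (rule cvar_cong) (simp add: H_def \<beta>)
    ultimately show ?thesis by (simp add: H_def)
  qed
  have 2: "cvar seg (\<lambda>s. \<gamma> (\<theta> s) + \<epsilon> *\<^sub>R v s) = cvar seg (\<lambda>s. \<gamma> (\<theta> s) - \<epsilon> *\<^sub>R v s)"
  proof -
    define T where "T s = vel \<gamma> (\<theta> s)" for s
    \<comment> \<open>Completes v to an orthonormal frame of the normal plane, so that cosine and
      sine combinations rotate v to -v through unit normals.\<close>
    define w where "w s = (1 / norm (T s)) *\<^sub>R cross3 (T s) (v s)" for s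
    have T0: "norm (T s) \<noteq> 0" for s
      using less_le_trans[OF m_pos vel_ge[of "\<theta> s"]] unfolding T_def by linarith
    have cT: "continuous_on {0..1} T" unfolding T_def by (rule continuous_on_curve(2)[OF c(1)])
    have cw: "continuous_on {0..1} w"
      unfolding w_def using T0 by (intro continuous_intros bounded_bilinear.continuous_on[OF bounded_bilinear_cross3] cT c) auto
    have w: "w s \<bullet> T s = 0" "w s \<bullet> v s = 0" "norm (w s) = 1" if "s \<in> {0..1}" for s
    proof -
      show "w s \<bullet> T s = 0" "w s \<bullet> v s = 0" by (simp_all add: w_def dot_cross_self)
      have "(norm (cross3 (T s) (v s)))\<^sup>2 = (norm (T s))\<^sup>2"
        using norm_cross_dot[of "T s" "v s"] v[OF that] by (simp add: T_def inner_commute)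
      then have "norm (cross3 (T s) (v s)) = norm (T s)" by simp
      then show "norm (w s) = 1" using T0[of s] by (simp add: w_def)
    qed
    define H where "H z = \<gamma> (\<theta> (snd z)) + \<epsilon> *\<^sub>R (cos (pi * fst z) *\<^sub>R v (snd z) + sin (pi * fst z) *\<^sub>R w (snd z))" for z
    have "cvar seg (\<lambda>s. H (0, s)) = cvar seg (\<lambda>s. H (1, s))"
    proof (rule cvar_free_homotopy[OF cocycle_seg])
      show "continuous_on ({0..1} \<times> {0..1}) H"
        unfolding H_def Q_def[symmetric]
        by (intro continuous_intros continuous_on_curve cQ c cw)
      fix l s :: real assume ls: "l \<in> {0..1}" "s \<in> {0..1}"
      define x where "x = cos (pi * l) *\<^sub>R v s + sin (pi * l) *\<^sub>R w s"
      have "(norm x)\<^sup>2 = (cos (pi * l))\<^sup>2 * (norm (v s))\<^sup>2 + (sin (pi * l))\<^sup>2 * (norm (w s))\<^sup>2"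
        unfolding power2_norm_eq_inner x_def using w(2)[OF ls(2)]
        by (simp add: inner_add_left inner_add_right inner_commute power2_eq_square)
      then have "(norm x)\<^sup>2 = 1" using v(2)[OF ls(2)] w(3)[OF ls(2)] by simp
      then have "norm x = 1" using power2_eq_imp_eq[of "norm x" 1] by simp
      moreover have "x \<bullet> T s = 0" using v(1)[OF ls(2)] w(1)[OF ls(2)] by (simp add: x_def T_def inner_add_left)
      ultimately show "H (l, s) \<in> - range \<gamma>"
        unfolding H_def fst_conv snd_conv x_def[symmetric] using e ls(2) by (intro tube) (auto simp: T_def)
    next
      show "H (l, 0) = H (l, 1)" for l by (simp add: H_def per\<gamma> per(2) w_def T_def)
    qed
    then show ?thesis by (simp add: H_def)
  qed
  have 3: "cvar seg (\<lambda>s. \<gamma> (\<theta> s) + \<sigma> *\<^sub>R v s) = cvar seg (\<lambda>s. \<gamma> (\<theta>h s) + \<sigma> *\<^sub>R Vh s)" if \<sigma>: "\<sigma> = \<epsilon> \<or> \<sigma> = - \<epsilon>" for \<sigma>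
  proof -
    define a where "a z = (1 - fst z) * \<theta> (snd z) + fst z * \<theta>h (snd z)" for z
    define V where "V z = (1 - fst z) *\<^sub>R v (snd z) + fst z *\<^sub>R Vh (snd z)" for z
    define H where "H z = \<gamma> (a z) + \<sigma> *\<^sub>R V z" for z
    have "cvar seg (\<lambda>s. H (0, s)) = cvar seg (\<lambda>s. H (1, s))"
    proof (rule cvar_free_homotopy[OF cocycle_seg])
      have "continuous_on Q a" "continuous_on Q V"
        unfolding a_def V_def by (intro continuous_intros cQ c)+
      then show "continuous_on ({0..1} \<times> {0..1}) H"
        unfolding H_def Q_def[symmetric] by (intro continuous_intros continuous_on_curve)
      fix l s :: real assume ls: "l \<in> {0..1}" "s \<in> {0..1}"
      have "a (l, s) - \<theta> s = l * (\<theta>h s - \<theta> s)" by (simp add: a_def algebra_simps)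
      then have "\<bar>a (l, s) - \<theta> s\<bar> \<le> 1 * d"        using near(1)[OF ls(2)] ls mult_mono[of l 1 "\<bar>\<theta>h s - \<theta> s\<bar>" d] by (simp add: abs_mult)
      moreover have "V (l, s) - v s = l *\<^sub>R (Vh s - v s)" by (simp add: V_def algebra_simps)
      then have "norm (V (l, s) - v s) = l * norm (Vh s - v s)" using ls by simp
      then have "norm (V (l, s) - v s) \<le> 1 * d" using mult_mono[of l 1 "norm (Vh s - v s)" d] near(2)[OF ls(2)] ls by simp
      moreover have "norm (V (l, s)) \<le> (1 - l) * 1 + l * 1"
      proof -
        have "norm (V (l, s)) \<le> (1 - l) * norm (v s) + l * norm (Vh s)"
          using norm_triangle_ineq[of "(1 - l) *\<^sub>R v s" "l *\<^sub>R Vh s"] ls by (simp add: V_def)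
        also have "\<dots> \<le> (1 - l) * 1 + l * 1" using v(2)[OF ls(2)] near(3)[OF ls(2)] ls by (intro add_mono mult_left_mono) auto
        finally show ?thesis .
      qed
      ultimately have nf: "\<bar>V (l, s) \<bullet> vel \<gamma> (a (l, s))\<bar> \<le> (A + M + 2) * d" "\<bar>(norm (V (l, s)))\<^sup>2 - 1\<bar> \<le> (A + M + 2) * d"
        using near_frame[OF v[OF ls(2)], of "V (l, s)" d "a (l, s)"] by auto
      have "0 \<le> (A + M + 2) * d" using d A_pos M_nonneg by simp
      from push_off_off[OF nf e(1,2) this d(2)] \<sigma> show "H (l, s) \<in> - range \<gamma>" by (auto simp: H_def)
    next
      fix l :: real
      have "a (l, 1) = a (l, 0) + of_int (int n)" by (simp add: a_def per algebra_simps)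
      then have "\<gamma> (a (l, 1)) = \<gamma> (a (l, 0))" by (simp only: period)
      then show "H (l, 0) = H (l, 1)" by (simp add: H_def V_def per)
    qed
    then show ?thesis by (simp add: H_def a_def V_def)
  qed
  show "cvar seg (\<lambda>s. \<gamma> (\<theta>h s) + \<epsilon> *\<^sub>R Vh s) = cvar seg \<beta>" using 1 3[of \<epsilon>] by simp
  show "cvar seg (\<lambda>s. \<gamma> (\<theta>h s) - \<epsilon> *\<^sub>R Vh s) = cvar seg \<beta>" using 1 2 3[of "- \<epsilon>"] by simp
qed

end

lemma closed_curve_increment:
  assumes \<beta>: "closed_curve \<beta>" and "0 < e"
  obtains d where "0 < d" "\<And>s h. s \<in> {0..1} \<Longrightarrow> 0 < h \<Longrightarrow> h < d \<Longrightarrow> h \<le> 1 \<Longrightarrow>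
    norm (\<beta> (s + h) - \<beta> s) \<le> h * (norm (vel \<beta> s) + e)"
proof -
  have "uniformly_continuous_on {0..2} (vel \<beta>)"
    by (intro compact_uniformly_continuous closed_curve_continuous_vel[OF \<beta>]) auto
  then obtain d where d: "0 < d" "\<And>s t. s \<in> {0..2} \<Longrightarrow> t \<in> {0..2} \<Longrightarrow> dist t s < d \<Longrightarrow> dist (vel \<beta> t) (vel \<beta> s) < e"
    using \<open>0 < e\<close> unfolding uniformly_continuous_on_def by metis
  show ?thesis
  proof (rule that[OF d(1)])
    fix s h :: real assume h: "s \<in> {0..1}" "0 < h" "h < d" "h \<le> 1"
    have "norm (\<beta> (s + h) - \<beta> s - (s + h - s) *\<^sub>R vel \<beta> s) \<le> norm (s + h - s) * e"
    proof (rule vector_differentiable_bound_linearization[where S = "{s..s + h}"])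
      fix x assume x: "x \<in> {s..s + h}"
      show "(\<beta> has_vector_derivative vel \<beta> x) (at x within {s..s + h})"
        by (rule closed_curve_has_vector_derivative[OF \<beta>])
      show "norm (vel \<beta> x - vel \<beta> s) \<le> e"
        using d(2)[of s x] x h by (auto simp: dist_norm dist_real_def)
    qed (use h in \<open>auto simp: closed_segment_eq_real_ivl\<close>)
    then have "norm (\<beta> (s + h) - \<beta> s - h *\<^sub>R vel \<beta> s) \<le> h * e" using h by simp
    moreover have "norm (\<beta> (s + h) - \<beta> s) \<le> norm (h *\<^sub>R vel \<beta> s) + norm (\<beta> (s + h) - \<beta> s - h *\<^sub>R vel \<beta> s)"
      by (rule norm_triangle_sub)
    ultimately show "norm (\<beta> (s + h) - \<beta> s) \<le> h * (norm (vel \<beta> s) + e)"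
      using h by (simp add: distrib_left)
  qed
qed

section \<open>The twist is bounded by the length\<close>

context thick_curve
begin

text \<open>The chord of \<gamma> is parallel to the tangent up to second order, so the cross
  product with the tangent leaves only the increment b of the torus curve. One factor 2 belongs to
  the twist density, the other to the radius 1/2.\<close>

lemma twist_of_difference_quotient:
  assumes h: "0 < h" and b: "v' - v = 2 *\<^sub>R (b - (\<gamma> x' - \<gamma> x))"
    and V: "norm V \<le> 1" and x: "\<bar>x' - x\<bar> \<le> L * h" "\<bar>a - x\<bar> \<le> L * h" and "0 \<le> L"
  shows "2 * \<bar>V \<bullet> cross3 ((1 / h) *\<^sub>R (v' - v)) (vel \<gamma> a)\<bar> / norm (vel \<gamma> a) \<le> 4 * norm b / h + 8 * M * L\<^sup>2 * h"
proof -
  define T where "T = vel \<gamma> a"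
  have T: "0 < norm T" unfolding T_def by (rule less_le_trans[OF m_pos vel_ge])
  define \<rho> where "\<rho> = \<gamma> x' - \<gamma> x - (x' - x) *\<^sub>R vel \<gamma> x"
  have Lh: "0 \<le> L * h" using h \<open>0 \<le> L\<close> by simp
  have "norm \<rho> \<le> M * (x' - x)\<^sup>2" unfolding \<rho>_def by (rule taylor)
  also have "\<dots> \<le> M * (L * h)\<^sup>2"
    using power_mono[OF x(1), of 2] M_nonneg by (intro mult_left_mono) auto
  finally have \<rho>: "norm \<rho> \<le> M * (L * h)\<^sup>2" .
  \<comment> \<open>The multiple of T inside the linear term drops out; its remainder and the Taylor
    remainder are both of order h^2.\<close>
  have "cross3 (\<gamma> x' - \<gamma> x) T = (x' - x) *\<^sub>R cross3 (vel \<gamma> x - T) T + cross3 \<rho> T"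
    by (simp add: \<rho>_def cross_add_left Cross3.left_diff_distrib cross_mult_left algebra_simps)
  then have "norm (cross3 (\<gamma> x' - \<gamma> x) T) \<le> \<bar>x' - x\<bar> * norm (cross3 (vel \<gamma> x - T) T) + norm (cross3 \<rho> T)"
    using norm_triangle_ineq[of "(x' - x) *\<^sub>R cross3 (vel \<gamma> x - T) T" "cross3 \<rho> T"] by simp
  also have "\<dots> \<le> (L * h) * (M * (L * h) * norm T) + M * (L * h)\<^sup>2 * norm T"
  proof (intro add_mono mult_mono)
    have "norm (vel \<gamma> x - T) \<le> M * \<bar>x - a\<bar>" unfolding T_def by (rule vel_lipschitz)
    also have "\<dots> \<le> M * (L * h)" using x(2) M_nonneg by (intro mult_left_mono) auto
    finally show "norm (cross3 (vel \<gamma> x - T) T) \<le> M * (L * h) * norm T"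
      by (intro order_trans[OF norm_cross3_le] mult_right_mono) auto
    show "norm (cross3 \<rho> T) \<le> M * (L * h)\<^sup>2 * norm T"
      using \<rho> by (intro order_trans[OF norm_cross3_le] mult_right_mono) auto
  qed (use x Lh in auto)
  also have "\<dots> = 2 * M * L\<^sup>2 * h\<^sup>2 * norm T" by (simp add: power2_eq_square algebra_simps)
  finally have g: "norm (cross3 (\<gamma> x' - \<gamma> x) T) \<le> 2 * M * L\<^sup>2 * h\<^sup>2 * norm T" .
  have "\<bar>V \<bullet> cross3 ((1 / h) *\<^sub>R (v' - v)) T\<bar> \<le> norm V * norm (cross3 ((1 / h) *\<^sub>R (v' - v)) T)"
    by (rule Cauchy_Schwarz_ineq2)
  also have "\<dots> \<le> 1 * norm (cross3 ((1 / h) *\<^sub>R (v' - v)) T)" using V by (intro mult_right_mono) auto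
  also have "\<dots> \<le> (2 / h) * (norm b * norm T + 2 * M * L\<^sup>2 * h\<^sup>2 * norm T)"
  proof -
    have "cross3 ((1 / h) *\<^sub>R (v' - v)) T = (2 / h) *\<^sub>R (cross3 b T - cross3 (\<gamma> x' - \<gamma> x) T)"
      unfolding b by (simp add: cross_mult_left Cross3.left_diff_distrib scaleR_diff_right)
    then have "1 * norm (cross3 ((1 / h) *\<^sub>R (v' - v)) T) = (2 / h) * norm (cross3 b T - cross3 (\<gamma> x' - \<gamma> x) T)"
      using h by simp
    also have "\<dots> \<le> (2 / h) * (norm b * norm T + 2 * M * L\<^sup>2 * h\<^sup>2 * norm T)"
      using h g norm_cross3_le[of b T] norm_triangle_ineq4[of "cross3 b T" "cross3 (\<gamma> x' - \<gamma> x) T"]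
      by (intro mult_left_mono) auto
    finally show ?thesis .
  qed
  also have "\<dots> = (2 * norm b / h + 4 * M * L\<^sup>2 * h) * norm T"
    using h by (simp add: field_simps power2_eq_square)
  finally have "\<bar>V \<bullet> cross3 ((1 / h) *\<^sub>R (v' - v)) T\<bar> / norm T \<le> 2 * norm b / h + 4 * M * L\<^sup>2 * h"
    using T by (simp add: pos_divide_le_eq)
  then show ?thesis by (simp add: T_def)
qed

text \<open>With window h, threshold \<eta> = h and offset at most h^3, the estimate for the
  averaged push-offs is 4 times the length plus O(h), and h tends to 0.\<close>

lemma twist_bound:
  assumes \<beta>: "closed_curve \<beta>" "range \<beta> \<subseteq> torus \<gamma>" and cl: "torus_class \<gamma> \<beta> p q" and q: "0 \<le> q"
  shows "pi * \<bar>of_int p - of_int q * Wr \<gamma>\<bar> \<le> integral {0..1} (\<lambda>t. norm (vel \<beta> t))"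
proof -
  define n where "n = nat q"
  have nq: "of_int q = real n" using q by (simp add: n_def)
  define I where "I = integral {0..1} (\<lambda>t. norm (vel \<beta> t))"
  define X where "X = \<bar>4 * pi * of_int p - of_nat n * (4 * pi * Wr \<gamma>)\<bar>"
  have seg\<beta>: "cvar seg \<beta> = 4 * pi * of_int p" and turn\<beta>: "cvar turn \<beta> = real n"
    using cvar_of_torus_class[OF cl] nq by simp_all
  obtain \<theta> v L where L: "0 \<le> L"
    and \<beta>eq: "\<And>s. s \<in> {0..2} \<Longrightarrow> \<beta> s = \<gamma> (\<theta> s) + (1 / 2) *\<^sub>R v s"
    and v: "\<And>s. s \<in> {0..2} \<Longrightarrow> v s \<bullet> vel \<gamma> (\<theta> s) = 0" "\<And>s. s \<in> {0..2} \<Longrightarrow> norm (v s) = 1"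
    and lip: "\<And>s t. s \<in> {0..2} \<Longrightarrow> t \<in> {0..2} \<Longrightarrow> norm (\<theta> s - \<theta> t) \<le> L * \<bar>s - t\<bar>"
      "\<And>s t. s \<in> {0..2} \<Longrightarrow> t \<in> {0..2} \<Longrightarrow> norm (v s - v t) \<le> L * \<bar>s - t\<bar>"
    and per: "\<And>s. s \<in> {0..1} \<Longrightarrow> \<theta> (s + 1) = \<theta> s + real n" "\<And>s. s \<in> {0..1} \<Longrightarrow> v (s + 1) = v s"
    by (rule lift_exists[OF \<beta> turn\<beta>], rule that; assumption)
  have c: "continuous_on {0..2} \<theta>" "continuous_on {0..2} v"
    by (rule lipschitz_continuous_on[OF lip(1) L] lipschitz_continuous_on[OF lip(2) L]; assumption)+
  obtain C where C: "0 \<le> C"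
    "\<And>\<epsilon> \<delta> \<eta> \<theta> \<theta>' V V' F n K. \<lbrakk>0 < \<epsilon>; \<epsilon> \<le> eps_max; 0 \<le> \<delta>; \<delta> \<le> del_max; 0 < \<eta>;
      \<And>s. s \<in> {0..1} \<Longrightarrow> (\<theta> has_real_derivative \<theta>' s) (at s within {0..1});
      \<And>s. s \<in> {0..1} \<Longrightarrow> (V has_vector_derivative V' s) (at s within {0..1});
      continuous_on {0..1} \<theta>'; continuous_on {0..1} V'; \<theta> 1 = \<theta> 0 + of_nat n;
      \<And>s. s \<in> {0..1} \<Longrightarrow> \<bar>V s \<bullet> vel \<gamma> (\<theta> s)\<bar> \<le> \<delta>; \<And>s. s \<in> {0..1} \<Longrightarrow> \<bar>(norm (V s))\<^sup>2 - 1\<bar> \<le> \<delta>;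
      \<And>s. s \<in> {0..1} \<Longrightarrow> norm (V' s) \<le> L; \<And>s. s \<in> {0..1} \<Longrightarrow> \<bar>\<theta>' s\<bar> \<le> L;
      F integrable_on {0..1};
      \<And>s. s \<in> {0..1} \<Longrightarrow> 2 * \<bar>V s \<bullet> cross3 (V' s) (vel \<gamma> (\<theta> s))\<bar> / norm (vel \<gamma> (\<theta> s)) \<le> F s;
      cvar seg (\<lambda>s. \<gamma> (\<theta> s) + \<epsilon> *\<^sub>R V s) = K; cvar seg (\<lambda>s. \<gamma> (\<theta> s) - \<epsilon> *\<^sub>R V s) = K\<rbrakk> \<Longrightarrow>
      \<bar>K - of_nat n * (4 * pi * Wr \<gamma>)\<bar> \<le> integral {0..1} F + C * (\<eta> + 2 * \<epsilon> / \<eta>\<^sup>2 + 2 * \<delta>)"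
    using push_off_variation[OF L] by blast
  \<comment> \<open>The averages are within L h of the exact data, so by \<open>near_frame\<close>
    their defect is at most K h.\<close>
  define K where "K = (A + M + 2) * L"
  have K: "0 \<le> K" using A_pos M_nonneg L by (simp add: K_def)
  \<comment> \<open>Collects the coefficients of h: the error of the difference quotient, and C
    times h + 2 h from the threshold and offset together with 2 K h from the defect.\<close>
  define E where "E = 8 * M * L\<^sup>2 + C * (3 + 2 * K)"
  have E: "0 \<le> E" using M_nonneg C(1) K by (simp add: E_def)
  have step: "X \<le> 4 * (I + e) + E * h"
    if e: "0 < e" and h: "0 < h" "h \<le> 1" "K * h \<le> del_max"
      and inc: "\<And>s. s \<in> {0..1} \<Longrightarrow> norm (\<beta> (s + h) - \<beta> s) \<le> h * (norm (vel \<beta> s) + e)" for e h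
  proof -
    define \<theta>h where "\<theta>h s = (1 / h) *\<^sub>R integral {s..s + h} \<theta>" for s
    define Vh where "Vh s = (1 / h) *\<^sub>R integral {s..s + h} v" for s
    define F where "F s = 4 * (norm (vel \<beta> s) + e) + 8 * M * L\<^sup>2 * h" for s
    note st\<theta> = steklov_average[OF lip(1) L h(1,2), folded \<theta>h_def]
    note stv = steklov_average[OF lip(2) L h(1,2), folded Vh_def]
    have d\<theta>: "(\<theta>h has_real_derivative (1 / h) *\<^sub>R (\<theta> (s + h) - \<theta> s)) (at s within {0..1})" if "s \<in> {0..1}" for s
      unfolding has_real_derivative_iff_has_vector_derivative \<theta>h_def by (rule steklov_average(1)[OF lip(1) L h(1,2) that])
    have dV: "(Vh has_vector_derivative (1 / h) *\<^sub>R (v (s + h) - v s)) (at s within {0..1})" if "s \<in> {0..1}" for s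
      unfolding Vh_def by (rule steklov_average(1)[OF lip(2) L h(1,2) that])
    have near: "\<bar>\<theta>h s - \<theta> s\<bar> \<le> L * h" "norm (Vh s - v s) \<le> L * h" "norm (Vh s) \<le> 1" if "s \<in> {0..1}" for s
      using st\<theta>(2)[OF _ _ that] stv(2)[OF _ _ that] stv(4)[OF _ _ that, of 1] v(2) by auto
    have bd: "\<bar>(1 / h) *\<^sub>R (\<theta> (s + h) - \<theta> s)\<bar> \<le> L" "norm ((1 / h) *\<^sub>R (v (s + h) - v s)) \<le> L" if "s \<in> {0..1}" for s
      using steklov_average(3)[OF lip(1) L h(1,2) that] steklov_average(3)[OF lip(2) L h(1,2) that] by auto
    have c01: "continuous_on {0..1} \<theta>" "continuous_on {0..1} v"
      by (rule continuous_on_subset[OF c(1)], simp, rule continuous_on_subset[OF c(2)], simp)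
    have sh: "continuous_on {0..1} (\<lambda>s. \<theta> (s + h))" "continuous_on {0..1} (\<lambda>s. v (s + h))"
    proof -
      have g: "continuous_on {0..1} (\<lambda>s. s + h)" "(\<lambda>s. s + h) ` {0..1} \<subseteq> {0..2}"
        using h by (auto intro!: continuous_intros)
      show "continuous_on {0..1} (\<lambda>s. \<theta> (s + h))" "continuous_on {0..1} (\<lambda>s. v (s + h))"
        by (rule continuous_on_compose2[OF c(1) g], rule continuous_on_compose2[OF c(2) g])
    qed
    have ch: "continuous_on {0..1} \<theta>h" by (rule DERIV_continuous_on[OF d\<theta>])
    have cVh: "continuous_on {0..1} Vh"
      unfolding continuous_on_eq_continuous_within by (intro ballI has_vector_derivative_continuous[OF dV])
    have int\<theta>: "\<theta> integrable_on {0..h}"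
      by (rule integrable_continuous_real[OF continuous_on_subset[OF c(1)]]) (use h in auto)
    have shift: "integral {1..1 + h} f = integral {0..h} (\<lambda>t. f (t + 1))" for f :: "real \<Rightarrow> 'b::euclidean_space"
      using integral_shift_real_ivl[of 1 1 "1 + h" f] by simp
    \<comment> \<open>The window at 1 is the window at 0 moved by one period, over which \<theta>
      gains n; so the averages keep the periodicity of the exact data.\<close>
    have "integral {1..1 + h} \<theta> = integral {0..h} (\<lambda>t. \<theta> t + real n)"
      unfolding shift by (rule integral_cong) (use per(1) h in auto)
    also have "\<dots> = integral {0..h} \<theta> + h * real n"
      using int\<theta> h by (subst integral_add) auto
    finally have p1: "\<theta>h 1 = \<theta>h 0 + real n" using h by (simp add: \<theta>h_def field_simps)
    have "integral {1..1 + h} v = integral {0..h} v"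
      unfolding shift by (rule integral_cong) (use per(2) h in auto)
    then have p2: "Vh 1 = Vh 0" by (simp add: Vh_def)
    \<comment> \<open>The cube makes \<epsilon> / \<eta>^2 with \<eta> = h at most h.\<close>
    define \<epsilon> where "\<epsilon> = min (min eps_max (1 / 2)) (h ^ 3)"
    have \<epsilon>: "0 < \<epsilon>" "\<epsilon> \<le> eps_max" "\<epsilon> \<le> 1 / 2" "\<epsilon> \<le> h ^ 3" using eps_del_max(1) h by (auto simp: \<epsilon>_def)
    have dl: "(A + M + 2) * (L * h) = K * h" by (simp add: K_def)
    have Lh: "0 \<le> L * h" using L h by simp
    have b01: "\<And>s. s \<in> {0..1} \<Longrightarrow> \<beta> s = \<gamma> (\<theta> s) + (1 / 2) *\<^sub>R v s"
      "\<And>s. s \<in> {0..1} \<Longrightarrow> v s \<bullet> vel \<gamma> (\<theta> s) = 0" "\<And>s. s \<in> {0..1} \<Longrightarrow> norm (v s) = 1"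
      using \<beta>eq v by auto
    have p0: "\<theta> 1 = \<theta> 0 + real n" "v 1 = v 0" using per(1)[of 0] per(2)[of 0] by auto
    note po = cvar_push_off[OF c01 ch cVh b01 p0 p1 p2 near Lh _ \<epsilon>(1-3), unfolded dl, OF _ _ _ _ _ _ h(3), unfolded seg\<beta>]
    have "X \<le> integral {0..1} F + C * (h + 2 * \<epsilon> / h\<^sup>2 + 2 * (K * h))"
      unfolding X_def
    proof (rule C(2)[OF \<epsilon>(1,2) _ h(3) h(1) d\<theta> dV _ _ p1])
      show "0 \<le> K * h" using K h by simp
      show "continuous_on {0..1} (\<lambda>s. (1 / h) *\<^sub>R (\<theta> (s + h) - \<theta> s))" by (intro continuous_intros sh c01)
      show "continuous_on {0..1} (\<lambda>s. (1 / h) *\<^sub>R (v (s + h) - v s))" by (intro continuous_intros sh c01)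
      fix s :: real assume s: "s \<in> {0..1}"
      show "\<bar>Vh s \<bullet> vel \<gamma> (\<theta>h s)\<bar> \<le> K * h" "\<bar>(norm (Vh s))\<^sup>2 - 1\<bar> \<le> K * h"
        using near_frame[OF b01(2,3)[OF s] near(2,3,1)[OF s]] unfolding dl by auto
      show "norm ((1 / h) *\<^sub>R (v (s + h) - v s)) \<le> L" "\<bar>(1 / h) *\<^sub>R (\<theta> (s + h) - \<theta> s)\<bar> \<le> L"
        using bd[OF s] by auto
      have s2: "s \<in> {0..2}" "s + h \<in> {0..2}" using s h by auto
      have "2 * \<bar>Vh s \<bullet> cross3 ((1 / h) *\<^sub>R (v (s + h) - v s)) (vel \<gamma> (\<theta>h s))\<bar> / norm (vel \<gamma> (\<theta>h s))
          \<le> 4 * norm (\<beta> (s + h) - \<beta> s) / h + 8 * M * L\<^sup>2 * h"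
      proof (rule twist_of_difference_quotient[OF h(1) _ near(3)[OF s] _ near(1)[OF s] L])
        show "v (s + h) - v s = 2 *\<^sub>R (\<beta> (s + h) - \<beta> s - (\<gamma> (\<theta> (s + h)) - \<gamma> (\<theta> s)))"
          unfolding \<beta>eq[OF s2(1)] \<beta>eq[OF s2(2)] by (simp add: algebra_simps)
        show "\<bar>\<theta> (s + h) - \<theta> s\<bar> \<le> L * h" using lip(1)[OF s2(2,1)] h by simp
      qed
      also have "\<dots> \<le> F s"
        using inc[OF s] h(1) by (simp add: F_def field_simps)
      finally show "2 * \<bar>Vh s \<bullet> cross3 ((1 / h) *\<^sub>R (v (s + h) - v s)) (vel \<gamma> (\<theta>h s))\<bar> / norm (vel \<gamma> (\<theta>h s)) \<le> F s" .
    next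
      show "F integrable_on {0..1}"
        unfolding F_def by (intro integrable_continuous_real continuous_intros closed_curve_continuous_vel[OF \<beta>(1)])
    qed (use po in auto)
    also have "integral {0..1} F = 4 * (I + e) + 8 * M * L\<^sup>2 * h"
    proof -
      have "((\<lambda>s. norm (vel \<beta> s)) has_integral I) {0..1}"
        unfolding I_def by (intro integrable_integral integrable_continuous_real continuous_intros closed_curve_continuous_vel[OF \<beta>(1)])
      then have "(F has_integral (4 * (I + e) + 8 * M * L\<^sup>2 * h)) {0..1}"
        unfolding F_def[abs_def]
        using has_integral_const_real[of e 0 1] has_integral_const_real[of "8 * M * L\<^sup>2 * h" 0 1]
        by (intro has_integral_add[OF has_integral_mult_right[OF has_integral_add]]) simp_all
      then show ?thesis by (rule integral_unique)
    qed
    also have "C * (h + 2 * \<epsilon> / h\<^sup>2 + 2 * (K * h)) \<le> C * (h + 2 * h + 2 * (K * h))"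
    proof (rule mult_left_mono[OF _ C(1)])
      have "2 * \<epsilon> / h\<^sup>2 \<le> 2 * h ^ 3 / h\<^sup>2" using \<epsilon>(4) h by (intro divide_right_mono) auto
      also have "\<dots> = 2 * h" using h by (simp add: power2_eq_square power3_eq_cube)
      finally show "h + 2 * \<epsilon> / h\<^sup>2 + 2 * (K * h) \<le> h + 2 * h + 2 * (K * h)" by simp
    qed
    finally show "X \<le> 4 * (I + e) + E * h" by (simp add: E_def algebra_simps)
  qed
  have "X \<le> 4 * I + e" if "0 < e" for e
  proof -
    define e' where "e' = e / 8"
    have e': "0 < e'" using that by (simp add: e'_def)
    obtain d where d: "0 < d" "\<And>s h. s \<in> {0..1} \<Longrightarrow> 0 < h \<Longrightarrow> h < d \<Longrightarrow> h \<le> 1 \<Longrightarrow>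
        norm (\<beta> (s + h) - \<beta> s) \<le> h * (norm (vel \<beta> s) + e')"
      using closed_curve_increment[OF \<beta>(1) e'] by blast
    \<comment> \<open>In order: the increment estimate applies, windows fit into [0, 2], the defect
      stays admissible, and the linear error is at most e / 2.\<close>
    define h where "h = min (min (d / 2) 1) (min (del_max / (K + 1)) (e / (2 * (E + 1))))"
    have h: "0 < h" "h < d" "h \<le> 1" "h \<le> del_max / (K + 1)" "h \<le> e / (2 * (E + 1))"
      using d(1) that K E eps_del_max(2) by (auto simp: h_def)
    have "(K + 1) * h \<le> del_max" using h(4) K by (simp add: field_simps)
    then have "K * h \<le> del_max" using h(1) by (simp add: distrib_right)
    then have "X \<le> 4 * (I + e') + E * h" using step[OF e' h(1,3)] d(2)[OF _ h(1-3)] by blast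
    moreover have "E * h \<le> e / 2"
    proof -
      have "(E + 1) * h \<le> e / 2" using h(5) E by (simp add: field_simps)
      then show ?thesis using h(1) by (simp add: distrib_right)
    qed
    ultimately show ?thesis by (simp add: e'_def)
  qed
  then have "X \<le> 4 * I" by (rule field_le_epsilon)
  moreover have "X = 4 * (pi * \<bar>of_int p - of_int q * Wr \<gamma>\<bar>)"
  proof -
    have "4 * pi * of_int p - of_nat n * (4 * pi * Wr \<gamma>) = 4 * pi * (of_int p - of_int q * Wr \<gamma>)"
      by (simp add: nq algebra_simps)
    then show ?thesis by (simp add: X_def abs_mult)
  qed
  ultimately show ?thesis by (simp add: I_def)
qed

end

section \<open>Boundary slopes\<close>

lemma boundary_collar_subset:
  assumes "boundary_collar F A" shows "A \<subseteq> F"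
proof -
  obtain h where h: "embedding_map (top_of_set ({0..1::real} \<times> bd F)) (top_of_set F) h" "A = h ` ({0..1} \<times> bd F)"
    using assms unfolding boundary_collar_def by (elim exE conjE) (rule that)
  have "h ` topspace (top_of_set ({0..1::real} \<times> bd F)) \<subseteq> topspace (top_of_set F)"
    using equalityD1[OF homeomorphic_imp_surjective_map[OF h(1)[unfolded embedding_map_def]]]
    unfolding topspace_subtopology by (rule order_trans) (rule Int_lower1)
  then show ?thesis by (simp add: h(2))
qed

text \<open>A single boundary component carries the slope; its length is at most that of the whole
  boundary, which the collar constant bounds by the area of a part of F.\<close>

lemma slope_writhe_bound:
  assumes \<gamma>: "c11_knot \<gamma>" "1 \<le> thickness \<gamma>" and F: "essential \<gamma> F" "surface_thickness_ge c0 L0 \<gamma> F \<tau>"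
    and area: "Area F \<le> ennreal \<Delta>" and slope: "numerical_boundary_slope \<gamma> F p q"
    and col: "collar_constant c0 L0 \<tau> c"
  shows "\<bar>of_int p / of_int q - Wr \<gamma>\<bar> \<le> enn2real (Area F) / (2 * pi * rho0 * c * of_int q)"
proof -
  have q: "1 \<le> q" and "boundary_slope \<gamma> F p q" using slope by (auto simp: numerical_boundary_slope_def)
  then have "bd F \<noteq> {}" and comp: "\<And>B. B \<in> components (bd F) \<Longrightarrow> \<exists>\<beta>. closed_curve \<beta> \<and> range \<beta> = B \<and> torus_class \<gamma> \<beta> p q"
    by (auto simp: boundary_slope_def)
  then obtain B where B: "B \<in> components (bd F)" using components_eq_empty by blast
  then obtain \<beta> where \<beta>: "closed_curve \<beta>" "range \<beta> = B" "torus_class \<gamma> \<beta> p q" using comp by blast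
  have "bd F = F \<inter> torus \<gamma>" using F(1) by (simp add: essential_def properly_embedded_surface_def)
  moreover have Bbd: "B \<subseteq> bd F" using B by (rule in_components_subset)
  ultimately have tor: "range \<beta> \<subseteq> torus \<gamma>" using \<beta>(2) by blast
  obtain m A M k where "c11_curve \<gamma> m A M k" using c11_knot_constants[OF \<gamma>(1)] .
  then interpret thick_curve \<gamma> m A M k using \<gamma>(2) by (simp add: thick_curve_def thick_curve_axioms_def)
  define l where "l = integral {0..1} (\<lambda>t. norm (vel \<beta> t))"
  have tw: "pi * \<bar>of_int p - of_int q * Wr \<gamma>\<bar> \<le> l"
    unfolding l_def using q by (intro twist_bound[OF \<beta>(1) tor \<beta>(3)]) simp
  have l0: "0 \<le> l" by (rule order_trans[OF _ tw]) simp
  have c: "0 < c" using col by (simp add: collar_constant_def)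
  obtain S where S: "boundary_collar F S" "ennreal c * Len (bd F) \<le> Area S"
    using col \<gamma> F unfolding collar_constant_def by blast
  have "ennreal (c * l) = ennreal c * ennreal l" using c l0 by (simp add: ennreal_mult)
  also have "\<dots> \<le> ennreal c * Len (bd F)"
    using length_le_hausdorff[OF \<beta>(1)] hausdorff_mono[of "range \<beta>" "bd F" 1] Bbd \<beta>(2)
    unfolding l_def Len_def by (intro mult_left_mono) auto
  also have "\<dots> \<le> Area F"
    using S hausdorff_mono[OF boundary_collar_subset[OF S(1)], of 2] unfolding Area_def by auto
  \<comment> \<open>The bound \<Delta> keeps the area finite; \<open>enn2real\<close> sends infinity
    to 0 and would break monotonicity.\<close>
  finally have "enn2real (ennreal (c * l)) \<le> enn2real (Area F)"
    using area by (intro enn2real_mono) (auto simp: top_unique intro: le_less_trans)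
  then have cl: "c * l \<le> enn2real (Area F)" using c l0 by simp
  have "\<bar>of_int p / of_int q - Wr \<gamma>\<bar> = \<bar>of_int p - of_int q * Wr \<gamma>\<bar> / of_int q"
  proof -
    have "of_int p / of_int q - Wr \<gamma> = (of_int p - of_int q * Wr \<gamma>) / of_int q" using q by (simp add: field_simps)
    then show ?thesis using q by (simp add: abs_divide)
  qed
  also have "\<dots> \<le> (l / pi) / of_int q"
    using tw q by (intro divide_right_mono) (auto simp: field_simps)
  \<comment> \<open>Here 2 pi \<open>rho0\<close> equals pi.\<close>
  also have "\<dots> = (c * l) / (2 * pi * rho0 * c * of_int q)" using c by (simp add: rho0_def)
  also have "\<dots> \<le> enn2real (Area F) / (2 * pi * rho0 * c * of_int q)"
    using cl c q by (intro divide_right_mono) (auto simp: rho0_def)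
  finally show ?thesis .
qed

lemma area_quotient_le_slope_width:
  assumes "Area F \<le> ennreal \<Delta>" "0 < \<Delta>" "0 < c_col \<tau>" "1 \<le> q"
  shows "enn2real (Area F) / (2 * pi * rho0 * c_col \<tau> * of_int q) \<le> slope_width c_col \<Delta> \<tau>"
proof -
  have "enn2real (Area F) \<le> \<Delta>" using assms by (simp add: enn2real_leI)
  moreover have "2 * pi * rho0 * c_col \<tau> * 1 \<le> 2 * pi * rho0 * c_col \<tau> * of_int q"
    using assms by (intro mult_left_mono) (auto simp: rho0_def)
  ultimately show ?thesis
    unfolding slope_width_def using assms by (intro frac_le) (auto simp: rho0_def)
qed

theorem theorem7p34:
  fixes c0 L0 \<Lambda> \<Delta> \<tau> :: real
    and c_col :: "real \<Rightarrow> real"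
    and K :: "(real^3) set set"
  assumes "0 < c0" and "c0 < 1" and "1 \<le> L0"
    and "\<And>t. 0 < t \<Longrightarrow> collar_constant c0 L0 t (c_col t)"
    and "knot_type K"
    and "0 < \<Lambda>" and "0 < \<Delta>" and "0 < \<tau>"
  shows
    "(\<forall>\<gamma> F p q.
        (\<gamma>, F) \<in> Z_ess c0 L0 K \<Lambda> \<Delta> \<tau> \<and> connected F \<and> bd F \<noteq> {} \<and>
        numerical_boundary_slope \<gamma> F p q \<longrightarrow>
          \<bar>real_of_int p / real_of_int q - Wr \<gamma>\<bar>
            \<le> enn2real (Area F) / (2 * pi * rho0 * c_col \<tau> * real_of_int q) \<and>
          enn2real (Area F) / (2 * pi * rho0 * c_col \<tau> * real_of_int q)
            \<le> slope_width c_col \<Delta> \<tau>) \<and>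
     (\<forall>\<gamma>. representative \<gamma> K \<and> 1 \<le> thickness \<gamma> \<longrightarrow>
        (\<forall>p q. realized_slope c0 L0 \<gamma> \<Delta> \<tau> p q \<longrightarrow>
           real_of_int p / real_of_int q
             \<in> {Wr \<gamma> - slope_width c_col \<Delta> \<tau> .. Wr \<gamma> + slope_width c_col \<Delta> \<tau>}) \<and>
        (\<forall>p q p' q'.
           realized_slope c0 L0 \<gamma> \<Delta> \<tau> p q \<and> realized_slope c0 L0 \<gamma> \<Delta> \<tau> p' q' \<longrightarrow>
             slope_rate p q p' q'
               = \<bar>real_of_int p / real_of_int q - real_of_int p' / real_of_int q'\<bar> \<and>
             \<bar>real_of_int p / real_of_int q - real_of_int p' / real_of_int q'\<bar>
               \<le> 2 * slope_width c_col \<Delta> \<tau>))"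
proof -
  have col: "collar_constant c0 L0 \<tau> (c_col \<tau>)" using assms(4,8) by blast
  then have c: "0 < c_col \<tau>" by (simp add: collar_constant_def)
  \<comment> \<open>Stated for thickness at least 1, so that it serves both the pairs of thickness
    exactly 1 and the fixed representative.\<close>
  have main: "\<bar>of_int p / of_int q - Wr \<gamma>\<bar> \<le> enn2real (Area F) / (2 * pi * rho0 * c_col \<tau> * of_int q) \<and>
      enn2real (Area F) / (2 * pi * rho0 * c_col \<tau> * of_int q) \<le> slope_width c_col \<Delta> \<tau>"
    if "c11_knot \<gamma>" "1 \<le> thickness \<gamma>" "essential \<gamma> F" "surface_thickness_ge c0 L0 \<gamma> F \<tau>"
      "Area F \<le> ennreal \<Delta>" "numerical_boundary_slope \<gamma> F p q" for \<gamma> F p q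
    using slope_writhe_bound[OF that col] area_quotient_le_slope_width[where c_col = c_col, OF that(5) assms(7), of \<tau>] that(6) c
    by (auto simp: numerical_boundary_slope_def)
  have realized: "\<bar>of_int p / of_int q - Wr \<gamma>\<bar> \<le> slope_width c_col \<Delta> \<tau>" "1 \<le> q"
    if "representative \<gamma> K" "1 \<le> thickness \<gamma>" "realized_slope c0 L0 \<gamma> \<Delta> \<tau> p q" for \<gamma> p q
  proof -
    have "c11_knot \<gamma>" using that(1) by (simp add: representative_def)
    then show "\<bar>of_int p / of_int q - Wr \<gamma>\<bar> \<le> slope_width c_col \<Delta> \<tau>"
      using main that(2,3) order_trans unfolding realized_slope_def by blast
    show "1 \<le> q" using that(3) by (auto simp: realized_slope_def numerical_boundary_slope_def)
  qed
  show ?thesis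
  proof (intro conjI allI impI; (elim conjE)?)
    fix \<gamma> F p q
    assume "(\<gamma>, F) \<in> Z_ess c0 L0 K \<Lambda> \<Delta> \<tau>" "numerical_boundary_slope \<gamma> F p q"
    then show "\<bar>real_of_int p / real_of_int q - Wr \<gamma>\<bar> \<le> enn2real (Area F) / (2 * pi * rho0 * c_col \<tau> * real_of_int q)"
      "enn2real (Area F) / (2 * pi * rho0 * c_col \<tau> * real_of_int q) \<le> slope_width c_col \<Delta> \<tau>"
      using main[of \<gamma> F p q] by (auto simp: Z_ess_def representative_def)
  next
    fix \<gamma> p q
    assume "representative \<gamma> K" "1 \<le> thickness \<gamma>" "realized_slope c0 L0 \<gamma> \<Delta> \<tau> p q"
    from realized(1)[OF this]
    show "real_of_int p / real_of_int q \<in> {Wr \<gamma> - slope_width c_col \<Delta> \<tau> .. Wr \<gamma> + slope_width c_col \<Delta> \<tau>}"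
      by (simp add: abs_le_iff)
  next
    fix \<gamma> p q p' q'
    assume \<gamma>: "representative \<gamma> K" "1 \<le> thickness \<gamma>"
      and r: "realized_slope c0 L0 \<gamma> \<Delta> \<tau> p q" "realized_slope c0 L0 \<gamma> \<Delta> \<tau> p' q'"
    note r = realized[OF \<gamma> r(1)] realized[OF \<gamma> r(2)]
    have pos: "0 < real_of_int q" "0 < real_of_int q'" using r(2,4) by auto
    have "of_int p / of_int q - of_int p' / of_int q' = real_of_int (p * q' - p' * q) / of_int (q * q')"
      using pos by (simp add: field_simps)
    then show "slope_rate p q p' q' = \<bar>real_of_int p / real_of_int q - real_of_int p' / real_of_int q'\<bar>"
      using pos by (simp add: slope_rate_def abs_divide abs_mult)
    show "\<bar>real_of_int p / real_of_int q - real_of_int p' / real_of_int q'\<bar> \<le> 2 * slope_width c_col \<Delta> \<tau>"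
      using r(1,3) by linarith
  qed
qed

end
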